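(* Let $\mathfrak C$ be a tribal system on the diagrams of an oriented virtual knot $\mathcal K$, and let $\hat A(D)$, $\hat A(f)$, $\pi^{\mathfrak C}_D$ be as in the context. Then the formula $$\hat\delta^{\mathfrak C}_D=\Bigl(\sum_{v\in\mathcal V(D)}\pi^{\mathfrak C}_D(v)\cdot D^r_v\Bigr)\oplus D\in C_1(D,\hat A(D))$$ defines a normalized invariant 1-cycle, in the sense that each $\hat\delta^{\mathfrak C}_D$ is a cycle, $D\cdot\hat\delta^{\mathfrak C}_D=0$, and $\hat A(f)(\hat\delta^{\mathfrak C}_D(a))=\hat\delta^{\mathfrak C}_{D'}(a')$ for any Reidemeister move $f\colon D\to D'$ and any correspondent arcs $a\in\mathcal A(D)$, $a'\in\mathcal A(D')$. The formula $$P^{\mathfrak C}_D(v)=\Bigl(\sum_{v'\in\mathcal V(D)}\pi^{\mathfrak C}_D(v')\cdot(D^l_v\cdot D^r_{v'}),\ -ip_D(v)\Bigr)$$ defines an oriented parity functor on the diagrams of $\mathcal K$ with coefficients in the groups $\hat A(D)$ (and partial isomorphisms $\hat A(f)$).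
   Context: Diagrams. A virtual knot diagram $D$ is a generic oriented closed curve in the plane whose double points are marked classical (with over/under information) or virtual. A virtual knot $\mathcal K$ is a class of diagrams modulo isotopy, classical Reidemeister moves R1, R2, R3 and detour moves (replacing a path containing only virtual crossings by another path with the same ends containing only virtual crossings). $\mathcal V(D)$ is the set of classical crossings; $\mathcal A(D)$ is the set of arcs, i.e. pieces of $D$ between consecutive classical crossings (one closed arc if there are no classical crossings). A move $f\colon D\to D'$ induces a partial bijection $f_*\colon\mathcal V(D)\to\mathcal V(D')$ between surviving crossings. Arcs $a\in\mathcal A(D)$, $a'\in\mathcal A(D')$ are correspondent under a Reidemeister move if they share a point outside the region of the move. Local picture. Draw a classical crossing $v$ with both strands directed upward: the incoming arcs are SW, SE, the outgoing ones NW, NE, and the strands run SW$\to$NE and SE$\to$NW. The oriented smoothing at $v$ splits $D$ into the left half $D^l_v$ (leaving $v$ along NW, returning along SW) and the right half $D^r_v$ (leaving along NE, returning along SE). Chains. For an abelian group $B$, $C_1(D,B)$ is the group of $B$-linear combinations of arcs, i.e. 1-chains of the graph $\tilde D$ with vertices $\mathcal V(D)$ and edges $\mathcal A(D)$ oriented along $D$. $\tilde D$ is embedded in the closed oriented surface $AD(D)$ obtained by gluing discs to the boundary of the ribbon surface that is the (immersed) neighbourhood of $D$ (virtual crossings not being vertices). $C_1\cdot C_2$ is the intersection number of cycles in $AD(D)$, a transverse intersection counting $+1$ when (tangent of $C_1$, tangent of $C_2$) is positively oriented. The index parity is $ip_D(v)=-(D^l_v\cdot D)\in\mathbb Z$.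 Tribal system. A family of partitions $\mathfrak C(D)$ of the sets $\mathcal V(D)$, for all diagrams $D$ of $\mathcal K$, into subsets called tribes such that: (T0) for a Reidemeister move $f\colon D\to D'$, if $v_1,v_2\in\mathcal V(D)$ belong to one tribe and $f_*(v_1),f_*(v_2)$ exist, then these belong to one tribe in $\mathfrak C(D')$; (T2) two crossings disappearing in a decreasing R2 belong to one tribe. Any Reidemeister move $f$ induces a partial bijection $f_{\mathfrak C}\colon\mathfrak C(D)\to\mathfrak C(D')$, $f_{\mathfrak C}(C)=C'$ if there is $v\in C$ with $f_*(v)\in C'$. Let $\pi^{\mathfrak C}_D(v)\in\mathfrak C(D)$ be the tribe containing $v$. Let $A(D)=\mathbb Z[\mathfrak C(D)]$ be the free abelian group on $\mathfrak C(D)$, and let $A(f)$ be the partial isomorphism $A(D)\to A(D')$ induced by $f_{\mathfrak C}$. The signature is $\sigma(\mathfrak C)_D=-\sum_{v\in\mathcal V(D)}\pi^{\mathfrak C}_D(v)\cdot ip_D(v)\in A(D)$; one has $A(f)(\sigma(\mathfrak C)_D)=\sigma(\mathfrak C)_{D'}$. Put $\hat A(D)=A(D)/\langle\sigma(\mathfrak C)_D\rangle\oplus\mathbb Z$, and write $A(f)$ also for the induced partial isomorphism of quotients. In the formula for $\hat\delta^{\mathfrak C}_D$ the first summand has coefficients in $A(D)/\langle\sigma(\mathfrak C)_D\rangle$ and the second, $D$, in $\mathbb Z$. Partial isomorphisms $\hat A(f)\colon\hat A(D)\to\hat A(D')$ (defined where the right-hand side makes sense): for an increasing R1 with new crossing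 $v'$: $\hat A(f)(x,y)=(A(f)(x)+k(f)\pi^{\mathfrak C}_{D'}(v')y,\,y)$; for a decreasing R1 with disappearing crossing $v$: $\hat A(f)(x,y)=(A(f)(x-k(f)\pi^{\mathfrak C}_D(v)y),\,y)$; here $k(f)=1$ if the loop of the move is the left half at the loop crossing and $k(f)=0$ if it is the right half; for an increasing R2 with new crossings $v'_1,v'_2$: $\hat A(f)(x,y)=(A(f)(x)+\pi^{\mathfrak C}_{D'}(v'_1)y,\,y)$; for a decreasing R2 with disappearing crossings $v_1,v_2$: $\hat A(f)(x,y)=(A(f)(x-\pi^{\mathfrak C}_D(v_1)y),\,y)$; for an R3: $\hat A(f)(x,y)=(A(f)(x),y)$. Parity functor. A partial isomorphism between abelian groups is an isomorphism between subgroups of them. An oriented parity functor on the diagrams of $\mathcal K$ is a family of pairs $(P_D,B(D))$, with $B(D)$ an abelian group and $P_D\colon\mathcal V(D)\to B(D)$ a map, and for every isotopy or Reidemeister move $f\colon D\to D'$ a partial isomorphism $B(f)$ between $B(D)$ and $B(D')$, such that: (P0) $P_{D'}(f_*(v))=B(f)(P_D(v))$ for corresponding crossings $v$ and $f_*(v)$; (P1) $P_D(v)=0$ if $v$ disappears in a decreasing R1; (P2) $P_D(v_1)+P_D(v_2)=0$ if $v_1,v_2$ disappear in a decreasing R2; (P3+) $\sum_{i=1}^3\epsilon_\Delta(v_i)P_D(v_i)=0$ if $v_1,v_2,v_3$ are the crossings of an R3 with disappearing triangle $\Delta$, where $\epsilon_\Delta(v)=+1$ if $\Delta$ lies to the left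 or right of $v$ in the local picture (between SW and NW, or between SE and NE) and $-1$ if it lies above or below $v$. *)

theory Defs
  imports
    "HOL-Combinatorics.Permutations"
    "HOL-Combinatorics.Orbits"
    "HOL-Library.Disjoint_Sets"
    "HOL-Algebra.Generated_Groups"
    "HOL-Algebra.Free_Abelian_Groups"
begin

section \<open>Virtual knot diagrams\<close>

text \<open>
  Near a double point both strands are drawn upwards; \<open>ToNE\<close> is the strand from SW to NE and
  \<open>ToNW\<close> the strand from SE to NW.  A passage of the curve through a double point is the double
  point together with the strand; a half-edge is a double point together with one of its four
  corners.
\<close>

datatype strand = ToNE | ToNW
datatype corner = NE | NW | SW | SE

type_synonym passage = "nat \<times> strand"
type_synonym half_edge = "nat \<times> corner"

fun in_corner :: "strand \<Rightarrow> corner" where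
  "in_corner ToNE = SW" | "in_corner ToNW = SE"

fun out_corner :: "strand \<Rightarrow> corner" where
  "out_corner ToNE = NE" | "out_corner ToNW = NW"

fun strand_of :: "corner \<Rightarrow> strand" where
  "strand_of NE = ToNE" | "strand_of SW = ToNE" | "strand_of NW = ToNW" | "strand_of SE = ToNW"

fun clockwise :: "corner \<Rightarrow> corner" where
  "clockwise NE = SE" | "clockwise SE = SW" | "clockwise SW = NW" | "clockwise NW = NE"

definition strand_at :: "half_edge \<Rightarrow> passage" where
  "strand_at h = (fst h, strand_of (snd h))"

text \<open>
  A generic closed oriented curve is recorded by its double points and the cyclic order \<open>nxt\<close> in
  which it runs through its passages.  The classical double points are \<open>clas\<close>, all others are
  virtual; \<open>over\<close> consists of the overpasses.
\<close>

record diag =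
  dpts :: "nat set"
  clas :: "nat set"
  over :: "passage set"
  nxt :: "passage \<Rightarrow> passage"

text \<open>The half-edge at the other end of the edge of the plane curve starting in \<open>h\<close>.\<close>

definition opp :: "diag \<Rightarrow> half_edge \<Rightarrow> half_edge" where
  "opp D h =
     (if snd h \<in> {NE, NW} then map_prod id in_corner (nxt D (strand_at h))
      else map_prod id out_corner (inv_into UNIV (nxt D) (strand_at h)))"

text \<open>
  Boundary walk of a face: leave along \<open>h\<close> with the face on the left, arrive at \<open>opp D h\<close>, and turn
  left.  A cycle of \<open>face_next\<close> is a face of the diagram, and each of its half-edges \<open>h\<close> stands for
  the angle of the face between \<open>h\<close> and the counterclockwise next half-edge.
\<close>

definition face_next :: "diag \<Rightarrow> half_edge \<Rightarrow> half_edge" where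
  "face_next D h = map_prod id clockwise (opp D h)"

text \<open>
  The last condition says that the surface obtained by gluing a disc to each boundary walk is a
  sphere: there are \<open>card (dpts D)\<close> vertices and twice as many edges, so Euler characteristic 2
  means \<open>card (dpts D) + 2\<close> faces.  Diagrams are taken on the sphere, i.e. no outer face is marked:
  moving a piece of the curve without crossings over the point at infinity is a detour move.
\<close>

definition knot_diagram :: "diag \<Rightarrow> bool" where
  "knot_diagram D \<longleftrightarrow>
     finite (dpts D) \<and> clas D \<subseteq> dpts D \<and>
     over D \<subseteq> clas D \<times> UNIV \<and> (\<forall>v\<in>clas D. \<exists>!s. (v, s) \<in> over D) \<and>
     nxt D permutes (dpts D \<times> UNIV) \<and>
     (dpts D \<noteq> {} \<longrightarrow>
        cyclic_on (nxt D) (dpts D \<times> UNIV) \<and>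
        card (orbit (face_next D) ` (dpts D \<times> UNIV)) = card (dpts D) + 2)"

text \<open>First return map of \<open>f\<close> to \<open>S\<close>, and the last point of \<open>S\<close> not after \<open>x\<close>.\<close>

definition return_map :: "('a \<Rightarrow> 'a) \<Rightarrow> 'a set \<Rightarrow> 'a \<Rightarrow> 'a" where
  "return_map f S x = (if x \<in> S then (f ^^ (LEAST k. 0 < k \<and> (f ^^ k) x \<in> S)) x else x)"

definition prior :: "('a \<Rightarrow> 'a) \<Rightarrow> 'a set \<Rightarrow> 'a \<Rightarrow> 'a" where
  "prior f S x = (inv_into UNIV f ^^ (LEAST k. (inv_into UNIV f ^^ k) x \<in> S)) x"

definition erase :: "nat set \<Rightarrow> diag \<Rightarrow> diag" where
  "erase X D =
     \<lparr>dpts = dpts D - X, clas = clas D - X, over = over D - X \<times> UNIV,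
      nxt = return_map (nxt D) ((dpts D - X) \<times> UNIV)\<rparr>"


section \<open>Arcs\<close>

text \<open>
  An arc is named by the classical passage where it starts; \<open>None\<close> is the closed arc of a diagram
  without classical crossings.  The map \<open>cnxt\<close> is the cyclic order of the classical passages.
\<close>

type_synonym arc = "passage option"

definition cnxt :: "diag \<Rightarrow> passage \<Rightarrow> passage" where
  "cnxt D = return_map (nxt D) (clas D \<times> UNIV)"

definition arcs :: "diag \<Rightarrow> arc set" where
  "arcs D = (if clas D = {} then {None} else Some ` (clas D \<times> UNIV))"

definition arc_at :: "diag \<Rightarrow> half_edge \<Rightarrow> arc" where
  "arc_at D h = Some (if snd h \<in> {NE, NW} then strand_at h
                      else inv_into UNIV (cnxt D) (strand_at h))"


section \<open>Moves\<close>

text \<open>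
  The regions of the decreasing R1 and R2 and of R3 are faces with one, two and three angles, all
  at classical crossings; they are given by the angles \<open>h\<close>.  The sides of such a face carry no
  virtual crossings, so they are whole arcs.
\<close>

definition monogon :: "diag \<Rightarrow> half_edge \<Rightarrow> bool" where
  "monogon D h \<longleftrightarrow> fst h \<in> clas D \<and> face_next D h = h"

definition side_over :: "diag \<Rightarrow> half_edge \<Rightarrow> bool" where
  "side_over D h \<longleftrightarrow> strand_at h \<in> over D \<and> strand_at (opp D h) \<in> over D"

definition side_under :: "diag \<Rightarrow> half_edge \<Rightarrow> bool" where
  "side_under D h \<longleftrightarrow> strand_at h \<notin> over D \<and> strand_at (opp D h) \<notin> over D"

definition bigon :: "diag \<Rightarrow> half_edge \<Rightarrow> half_edge \<Rightarrow> bool" where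
  "bigon D h\<^sub>1 h\<^sub>2 \<longleftrightarrow>
     {fst h\<^sub>1, fst h\<^sub>2} \<subseteq> clas D \<and> fst h\<^sub>1 \<noteq> fst h\<^sub>2 \<and>
     face_next D h\<^sub>1 = h\<^sub>2 \<and> face_next D h\<^sub>2 = h\<^sub>1 \<and>
     (\<exists>h\<in>{h\<^sub>1, h\<^sub>2}. side_over D h) \<and> (\<exists>h\<in>{h\<^sub>1, h\<^sub>2}. side_under D h)"

definition triangle :: "diag \<Rightarrow> half_edge \<Rightarrow> half_edge \<Rightarrow> half_edge \<Rightarrow> bool" where
  "triangle D h\<^sub>1 h\<^sub>2 h\<^sub>3 \<longleftrightarrow>
     {fst h\<^sub>1, fst h\<^sub>2, fst h\<^sub>3} \<subseteq> clas D \<and> distinct [fst h\<^sub>1, fst h\<^sub>2, fst h\<^sub>3] \<and>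
     face_next D h\<^sub>1 = h\<^sub>2 \<and> face_next D h\<^sub>2 = h\<^sub>3 \<and> face_next D h\<^sub>3 = h\<^sub>1 \<and>
     (\<exists>h\<in>{h\<^sub>1, h\<^sub>2, h\<^sub>3}. side_over D h) \<and> (\<exists>h\<in>{h\<^sub>1, h\<^sub>2, h\<^sub>3}. side_under D h)"

text \<open>
  R3 exchanges, on each of the three strands, the two consecutive passages bounding a side of the
  triangle.  This exchanges the two ends of every side, so that the cyclic order is conjugated by
  the product of three disjoint transpositions.
\<close>

definition side_swap :: "diag \<Rightarrow> half_edge \<Rightarrow> passage \<Rightarrow> passage" where
  "side_swap D h = transpose (strand_at h) (strand_at (opp D h))"

definition r3_swap :: "diag \<Rightarrow> half_edge \<Rightarrow> half_edge \<Rightarrow> half_edge \<Rightarrow> passage \<Rightarrow> passage" where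
  "r3_swap D h\<^sub>1 h\<^sub>2 h\<^sub>3 = side_swap D h\<^sub>1 \<circ> side_swap D h\<^sub>2 \<circ> side_swap D h\<^sub>3"

definition r3_diag :: "diag \<Rightarrow> half_edge \<Rightarrow> half_edge \<Rightarrow> half_edge \<Rightarrow> diag" where
  "r3_diag D h\<^sub>1 h\<^sub>2 h\<^sub>3 =
     D\<lparr>nxt := r3_swap D h\<^sub>1 h\<^sub>2 h\<^sub>3 \<circ> nxt D \<circ> r3_swap D h\<^sub>1 h\<^sub>2 h\<^sub>3\<rparr>"

definition isotopic_by :: "(nat \<Rightarrow> nat) \<Rightarrow> diag \<Rightarrow> diag \<Rightarrow> bool" where
  "isotopic_by g D D' \<longleftrightarrow>
     bij_betw g (dpts D) (dpts D') \<and> clas D' = g ` clas D \<and> over D' = map_prod g id ` over D \<and>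
     (\<forall>p \<in> dpts D \<times> UNIV. nxt D' (map_prod g id p) = map_prod g id (nxt D p))"

text \<open>
  The path that starts on the edge leaving the passage \<open>q\<close> and runs through the next \<open>n\<close>
  passages.
\<close>

definition path_points :: "diag \<Rightarrow> passage \<Rightarrow> nat \<Rightarrow> nat set" where
  "path_points D q n = (\<lambda>k. fst ((nxt D ^^ k) q)) ` {1..n}"

definition virtual_path :: "diag \<Rightarrow> passage \<Rightarrow> nat \<Rightarrow> bool" where
  "virtual_path D q n \<longleftrightarrow>
     (dpts D \<noteq> {} \<longrightarrow> fst q \<in> dpts D) \<and> n \<le> card (dpts D \<times> (UNIV :: strand set)) \<and>
     path_points D q n \<inter> clas D = {}"

text \<open>
  Removing the paths leaves the same curve with the same gap.  The remaining curve is connected, so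
  its embedding in the sphere, including the positions of the two ends of the path, is determined
  by the combinatorial data.
\<close>

definition detour :: "diag \<Rightarrow> diag \<Rightarrow> bool" where
  "detour D D' \<longleftrightarrow>
     (\<exists>q n q' n'.
        virtual_path D q n \<and> virtual_path D' q' n' \<and>
        erase (path_points D q n) D = erase (path_points D' q' n') D' \<and>
        (let R = (dpts D - path_points D q n) \<times> UNIV
         in R \<noteq> {} \<longrightarrow> prior (nxt D) R q = prior (nxt D') R q'))"

text \<open>
  The angles in \<open>R1_dec\<close>, \<open>R2_dec\<close>, \<open>R3\<close> refer to the source, those in \<open>R1_inc\<close>, \<open>R2_inc\<close> to the
  target of the move.  All moves but isotopies keep the names of the surviving classical crossings;
  a move with other names is such a move followed by an isotopy.
\<close>

datatype move =
    Isotopy "nat \<Rightarrow> nat"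
  | Detour
  | R1_dec half_edge
  | R1_inc half_edge
  | R2_dec half_edge half_edge
  | R2_inc half_edge half_edge
  | R3 half_edge half_edge half_edge

fun move_shape :: "diag \<Rightarrow> move \<Rightarrow> diag \<Rightarrow> bool" where
  "move_shape D (Isotopy g) D' \<longleftrightarrow> isotopic_by g D D'"
| "move_shape D Detour D' \<longleftrightarrow> detour D D'"
| "move_shape D (R1_dec h) D' \<longleftrightarrow> monogon D h \<and> D' = erase {fst h} D"
| "move_shape D (R1_inc h) D' \<longleftrightarrow> monogon D' h \<and> D = erase {fst h} D'"
| "move_shape D (R2_dec h\<^sub>1 h\<^sub>2) D' \<longleftrightarrow> bigon D h\<^sub>1 h\<^sub>2 \<and> D' = erase {fst h\<^sub>1, fst h\<^sub>2} D"
| "move_shape D (R2_inc h\<^sub>1 h\<^sub>2) D' \<longleftrightarrow> bigon D' h\<^sub>1 h\<^sub>2 \<and> D = erase {fst h\<^sub>1, fst h\<^sub>2} D'"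
| "move_shape D (R3 h\<^sub>1 h\<^sub>2 h\<^sub>3) D' \<longleftrightarrow> triangle D h\<^sub>1 h\<^sub>2 h\<^sub>3 \<and> D' = r3_diag D h\<^sub>1 h\<^sub>2 h\<^sub>3"

definition is_move :: "diag \<Rightarrow> move \<Rightarrow> diag \<Rightarrow> bool" where
  "is_move D m D' \<longleftrightarrow> knot_diagram D \<and> knot_diagram D' \<and> move_shape D m D'"

definition virtual_knot :: "diag set \<Rightarrow> bool" where
  "virtual_knot K \<longleftrightarrow>
     (\<exists>D\<^sub>0. knot_diagram D\<^sub>0 \<and> K = {D. (\<lambda>D D'. \<exists>m. is_move D m D')\<^sup>*\<^sup>* D\<^sub>0 D})"

definition crossing_map :: "diag \<Rightarrow> move \<Rightarrow> diag \<Rightarrow> nat \<rightharpoonup> nat" where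
  "crossing_map D m D' v =
     (if v \<in> clas D
      then (case m of Isotopy g \<Rightarrow> Some (g v) | _ \<Rightarrow> if v \<in> clas D' then Some v else None)
      else None)"

text \<open>
  Let \<open>D'\<close> be obtained from \<open>D\<close> by a decreasing R1 or R2.  The arcs of \<open>D\<close> inside the region are
  the sides of the face; the outer part of any other arc of \<open>D\<close> lies on a single arc of \<open>D'\<close>, which
  starts at the last surviving crossing.
\<close>

fun carrier_arc :: "diag \<Rightarrow> diag \<Rightarrow> arc \<Rightarrow> arc" where
  "carrier_arc D D' (Some p) =
     (if clas D' = {} then None else Some (prior (cnxt D) (clas D' \<times> UNIV) p))"
| "carrier_arc D D' None = None"

fun shares_outer_point :: "diag \<Rightarrow> move \<Rightarrow> diag \<Rightarrow> arc \<Rightarrow> arc \<Rightarrow> bool" where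
  "shares_outer_point D (Isotopy g) D' a a' \<longleftrightarrow> a' = map_option (map_prod g id) a"
| "shares_outer_point D Detour D' a a' \<longleftrightarrow> a' = a"
| "shares_outer_point D (R1_dec h) D' a a' \<longleftrightarrow> a \<noteq> arc_at D h \<and> a' = carrier_arc D D' a"
| "shares_outer_point D (R1_inc h) D' a a' \<longleftrightarrow> a' \<noteq> arc_at D' h \<and> a = carrier_arc D' D a'"
| "shares_outer_point D (R2_dec h\<^sub>1 h\<^sub>2) D' a a' \<longleftrightarrow>
     a \<notin> arc_at D ` {h\<^sub>1, h\<^sub>2} \<and> a' = carrier_arc D D' a"
| "shares_outer_point D (R2_inc h\<^sub>1 h\<^sub>2) D' a a' \<longleftrightarrow>
     a' \<notin> arc_at D' ` {h\<^sub>1, h\<^sub>2} \<and> a = carrier_arc D' D a'"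
| "shares_outer_point D (R3 h\<^sub>1 h\<^sub>2 h\<^sub>3) D' a a' \<longleftrightarrow>
     a \<notin> arc_at D ` {h\<^sub>1, h\<^sub>2, h\<^sub>3} \<and> a' = map_option (r3_swap D h\<^sub>1 h\<^sub>2 h\<^sub>3) a"

definition correspondent :: "diag \<Rightarrow> move \<Rightarrow> diag \<Rightarrow> arc \<Rightarrow> arc \<Rightarrow> bool" where
  "correspondent D m D' a a' \<longleftrightarrow>
     a \<in> arcs D \<and> a' \<in> arcs D' \<and> shares_outer_point D m D' a a'"


section \<open>Chains and intersection numbers\<close>

text \<open>Abelian groups are written multiplicatively, following the algebra library.\<close>

definition is_chain :: "('b, 'm) monoid_scheme \<Rightarrow> diag \<Rightarrow> (arc \<Rightarrow> 'b) \<Rightarrow> bool" where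
  "is_chain B D c \<longleftrightarrow> c \<in> arcs D \<rightarrow> carrier B"

definition is_cycle :: "('b, 'm) monoid_scheme \<Rightarrow> diag \<Rightarrow> (arc \<Rightarrow> 'b) \<Rightarrow> bool" where
  "is_cycle B D c \<longleftrightarrow>
     is_chain B D c \<and>
     (\<forall>v\<in>clas D.
        (c (arc_at D (v, SW)) \<otimes>\<^bsub>B\<^esub> c (arc_at D (v, SE))) \<otimes>\<^bsub>B\<^esub>
        inv\<^bsub>B\<^esub> (c (arc_at D (v, NW)) \<otimes>\<^bsub>B\<^esub> c (arc_at D (v, NE))) = \<one>\<^bsub>B\<^esub>)"

definition whole :: "arc \<Rightarrow> int" where
  "whole a = 1"

definition piece :: "diag \<Rightarrow> passage \<Rightarrow> passage \<Rightarrow> arc set" where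
  "piece D p q = {Some ((cnxt D ^^ k) p) | k. k < funpow_dist1 (cnxt D) p q}"

definition left_half :: "diag \<Rightarrow> nat \<Rightarrow> arc \<Rightarrow> int" where
  "left_half D v a = (if a \<in> piece D (v, ToNW) (v, ToNE) then 1 else 0)"

definition right_half :: "diag \<Rightarrow> nat \<Rightarrow> arc \<Rightarrow> int" where
  "right_half D v a = (if a \<in> piece D (v, ToNE) (v, ToNW) then 1 else 0)"

fun flux :: "corner \<Rightarrow> int" where
  "flux NE = 1" | "flux NW = 1" | "flux SW = -1" | "flux SE = -1"

fun position :: "corner \<Rightarrow> nat" where
  "position NE = 0" | "position NW = 1" | "position SW = 2" | "position SE = 3"

text \<open>
  Intersection number of an integral cycle \<open>X\<close> and a cycle \<open>Y\<close> with coefficients in \<open>B\<close>, in the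
  neighbourhood of the graph of classical crossings and arcs: all arcs of \<open>Y\<close> are shifted a bit to
  their right, so that \<open>X\<close> and \<open>Y\<close> meet only in discs around the crossings, transversally.  A shifted
  half-edge leaves the disc just before (clockwise of) the original one if the arc is outgoing and
  just after it if the arc is incoming, so the counterclockwise order on the boundary of the disc,
  starting at NE, is Y-NE, X-NE, Y-NW, X-NW, X-SW, Y-SW, X-SE, Y-SE.  Inside a disc the
  signed number of intersections (positive if the tangents of \<open>X\<close> and \<open>Y\<close> in this order are positively
  oriented) is minus the sum, over all pairs of a Y-end \<open>j\<close> preceding an X-end \<open>i\<close>, of the products of
  the outgoing fluxes.
\<close>

definition preceding :: "(corner \<times> corner) set" where
  "preceding = {(j, i). position j < position i \<or> j = i \<and> flux j = 1}"

definition intersection ::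
    "('b, 'm) monoid_scheme \<Rightarrow> diag \<Rightarrow> (arc \<Rightarrow> int) \<Rightarrow> (arc \<Rightarrow> 'b) \<Rightarrow> 'b" where
  "intersection B D X Y =
     (\<Otimes>\<^bsub>B\<^esub>v\<in>clas D. \<Otimes>\<^bsub>B\<^esub>e\<in>preceding.
        Y (arc_at D (v, fst e)) [^]\<^bsub>B\<^esub>
          (- (flux (snd e) * flux (fst e) * X (arc_at D (v, snd e)))))"

definition index_parity :: "diag \<Rightarrow> nat \<Rightarrow> int" where
  "index_parity D v = - intersection integer_group D (left_half D v) whole"


section \<open>Partial isomorphisms and parity functors\<close>

definition partial_iso ::
    "('a, 'm) monoid_scheme \<Rightarrow> ('b, 'n) monoid_scheme \<Rightarrow> ('a \<rightharpoonup> 'b) \<Rightarrow> bool" where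
  "partial_iso G H f \<longleftrightarrow>
     subgroup (dom f) G \<and> subgroup (ran f) H \<and>
     the \<circ> f \<in> iso (G\<lparr>carrier := dom f\<rparr>) (H\<lparr>carrier := ran f\<rparr>)"

text \<open>
  A triangle with angle \<open>h\<close> at a crossing lies to the left or right of the crossing iff the angle
  starts, counterclockwise, at NW or SE.
\<close>

definition incidence :: "half_edge \<Rightarrow> int" where
  "incidence h = (if snd h \<in> {NW, SE} then 1 else -1)"

definition oriented_parity_functor ::
    "diag set \<Rightarrow> (diag \<Rightarrow> ('b, 'm) monoid_scheme) \<Rightarrow> (diag \<Rightarrow> move \<Rightarrow> diag \<Rightarrow> 'b \<rightharpoonup> 'b) \<Rightarrow>
     (diag \<Rightarrow> nat \<Rightarrow> 'b) \<Rightarrow> bool" where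
  "oriented_parity_functor K B Bmap P \<longleftrightarrow>
     (\<forall>D\<in>K. comm_group (B D) \<and> P D \<in> clas D \<rightarrow> carrier (B D)) \<and>
     (\<forall>D\<in>K. \<forall>m D'. is_move D m D' \<longrightarrow>
        partial_iso (B D) (B D') (Bmap D m D') \<and>
        (\<forall>v v'. crossing_map D m D' v = Some v' \<longrightarrow> Bmap D m D' (P D v) = Some (P D' v'))) \<and>
     (\<forall>D\<in>K. \<forall>h D'. is_move D (R1_dec h) D' \<longrightarrow> P D (fst h) = \<one>\<^bsub>B D\<^esub>) \<and>
     (\<forall>D\<in>K. \<forall>h\<^sub>1 h\<^sub>2 D'. is_move D (R2_dec h\<^sub>1 h\<^sub>2) D' \<longrightarrow>
        P D (fst h\<^sub>1) \<otimes>\<^bsub>B D\<^esub> P D (fst h\<^sub>2) = \<one>\<^bsub>B D\<^esub>) \<and>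
     (\<forall>D\<in>K. \<forall>h\<^sub>1 h\<^sub>2 h\<^sub>3 D'. is_move D (R3 h\<^sub>1 h\<^sub>2 h\<^sub>3) D' \<longrightarrow>
        P D (fst h\<^sub>1) [^]\<^bsub>B D\<^esub> incidence h\<^sub>1 \<otimes>\<^bsub>B D\<^esub> P D (fst h\<^sub>2) [^]\<^bsub>B D\<^esub> incidence h\<^sub>2
          \<otimes>\<^bsub>B D\<^esub> P D (fst h\<^sub>3) [^]\<^bsub>B D\<^esub> incidence h\<^sub>3 = \<one>\<^bsub>B D\<^esub>)"

definition normalized_invariant_cycle ::
    "diag set \<Rightarrow> (diag \<Rightarrow> ('b, 'm) monoid_scheme) \<Rightarrow> (diag \<Rightarrow> move \<Rightarrow> diag \<Rightarrow> 'b \<rightharpoonup> 'b) \<Rightarrow>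
     (diag \<Rightarrow> arc \<Rightarrow> 'b) \<Rightarrow> bool" where
  "normalized_invariant_cycle K B Bmap \<delta> \<longleftrightarrow>
     (\<forall>D\<in>K. is_cycle (B D) D (\<delta> D) \<and> intersection (B D) D whole (\<delta> D) = \<one>\<^bsub>B D\<^esub>) \<and>
     (\<forall>D\<in>K. \<forall>m D' a a'. is_move D m D' \<and> correspondent D m D' a a' \<longrightarrow>
        Bmap D m D' (\<delta> D a) = Some (\<delta> D' a'))"


section \<open>Tribal systems\<close>

definition tribal_system :: "diag set \<Rightarrow> (diag \<Rightarrow> nat set set) \<Rightarrow> bool" where
  "tribal_system K C \<longleftrightarrow>
     (\<forall>D\<in>K. partition_on (clas D) (C D)) \<and>
     (\<forall>D\<in>K. \<forall>m D'. is_move D m D' \<longrightarrow>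
        (\<forall>T\<in>C D. \<forall>v\<^sub>1\<in>T. \<forall>v\<^sub>2\<in>T. \<forall>v\<^sub>1' v\<^sub>2'.
           crossing_map D m D' v\<^sub>1 = Some v\<^sub>1' \<and> crossing_map D m D' v\<^sub>2 = Some v\<^sub>2' \<longrightarrow>
           (\<exists>T'\<in>C D'. v\<^sub>1' \<in> T' \<and> v\<^sub>2' \<in> T'))) \<and>
     (\<forall>D\<in>K. \<forall>h\<^sub>1 h\<^sub>2 D'. is_move D (R2_dec h\<^sub>1 h\<^sub>2) D' \<longrightarrow>
        (\<exists>T\<in>C D. fst h\<^sub>1 \<in> T \<and> fst h\<^sub>2 \<in> T))"

context
  fixes C :: "diag \<Rightarrow> nat set set"
begin

definition tribe :: "diag \<Rightarrow> nat \<Rightarrow> nat set" where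
  "tribe D v = (THE T. T \<in> C D \<and> v \<in> T)"

definition tribe_map :: "diag \<Rightarrow> move \<Rightarrow> diag \<Rightarrow> nat set \<rightharpoonup> nat set" where
  "tribe_map D m D' T =
     (if T \<in> C D \<and> (\<exists>T'\<in>C D'. \<exists>v\<in>T. \<exists>v'\<in>T'. crossing_map D m D' v = Some v')
      then Some (THE T'. T' \<in> C D' \<and> (\<exists>v\<in>T. \<exists>v'\<in>T'. crossing_map D m D' v = Some v'))
      else None)"

definition tribe_group :: "diag \<Rightarrow> (nat set \<Rightarrow>\<^sub>0 int) monoid" where
  "tribe_group D = free_Abelian_group (C D)"

definition tribe_group_map ::
    "diag \<Rightarrow> move \<Rightarrow> diag \<Rightarrow> (nat set \<Rightarrow>\<^sub>0 int) \<rightharpoonup> (nat set \<Rightarrow>\<^sub>0 int)" where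
  "tribe_group_map D m D' x =
     (if Poly_Mapping.keys x \<subseteq> dom (tribe_map D m D')
      then Some (frag_extend (\<lambda>T. frag_of (the (tribe_map D m D' T))) x) else None)"

definition signature :: "diag \<Rightarrow> nat set \<Rightarrow>\<^sub>0 int" where
  "signature D = - (\<Sum>v\<in>clas D. frag_cmul (index_parity D v) (frag_of (tribe D v)))"

definition signature_subgroup :: "diag \<Rightarrow> (nat set \<Rightarrow>\<^sub>0 int) set" where
  "signature_subgroup D = generate (tribe_group D) {signature D}"

definition reduced_group :: "diag \<Rightarrow> (nat set \<Rightarrow>\<^sub>0 int) set monoid" where
  "reduced_group D = tribe_group D Mod signature_subgroup D"

text \<open>The partial map of quotients induced by \<open>tribe_group_map\<close>, in terms of representatives.\<close>

definition reduced_group_map ::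
    "diag \<Rightarrow> move \<Rightarrow> diag \<Rightarrow> (nat set \<Rightarrow>\<^sub>0 int) set \<rightharpoonup> (nat set \<Rightarrow>\<^sub>0 int) set" where
  "reduced_group_map D m D' X =
     (if X \<in> carrier (reduced_group D) \<and> (\<exists>x\<in>X. x \<in> dom (tribe_group_map D m D'))
      then Some (THE Y. Y \<in> carrier (reduced_group D') \<and>
                        (\<exists>x\<in>X. \<exists>y\<in>Y. tribe_group_map D m D' x = Some y))
      else None)"

definition tribe_class :: "diag \<Rightarrow> nat \<Rightarrow> (nat set \<Rightarrow>\<^sub>0 int) set" where
  "tribe_class D v = signature_subgroup D #>\<^bsub>tribe_group D\<^esub> frag_of (tribe D v)"

definition ext_group :: "diag \<Rightarrow> ((nat set \<Rightarrow>\<^sub>0 int) set \<times> int) monoid" where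
  "ext_group D = reduced_group D \<times>\<times> integer_group"

text \<open>The loop of an R1 with angle \<open>h\<close> is the left half iff it leaves the crossing along NW.\<close>

definition loop_coeff :: "half_edge \<Rightarrow> int" where
  "loop_coeff h = (if snd h = NW then 1 else 0)"

definition ext_group_map ::
    "diag \<Rightarrow> move \<Rightarrow> diag \<Rightarrow>
     ((nat set \<Rightarrow>\<^sub>0 int) set \<times> int) \<rightharpoonup> ((nat set \<Rightarrow>\<^sub>0 int) set \<times> int)" where
  "ext_group_map D m D' z =
     (let x = fst z; y = snd z;
          add_after = (\<lambda>v (k::int). map_option
            (\<lambda>u. (u \<otimes>\<^bsub>reduced_group D'\<^esub> tribe_class D' v [^]\<^bsub>reduced_group D'\<^esub> (k * y), y))
            (reduced_group_map D m D' x));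
          subtract_before = (\<lambda>v (k::int). map_option (\<lambda>u. (u, y))
            (reduced_group_map D m D'
              (x \<otimes>\<^bsub>reduced_group D\<^esub>
                 inv\<^bsub>reduced_group D\<^esub> (tribe_class D v [^]\<^bsub>reduced_group D\<^esub> (k * y)))))
      in if x \<notin> carrier (reduced_group D) then None
         else (case m of
             R1_inc h \<Rightarrow> add_after (fst h) (loop_coeff h)
           | R1_dec h \<Rightarrow> subtract_before (fst h) (loop_coeff h)
           | R2_inc h\<^sub>1 h\<^sub>2 \<Rightarrow> add_after (fst h\<^sub>1) 1
           | R2_dec h\<^sub>1 h\<^sub>2 \<Rightarrow> subtract_before (fst h\<^sub>1) 1
           | _ \<Rightarrow> map_option (\<lambda>u. (u, y)) (reduced_group_map D m D' x)))"

definition tribal_cycle :: "diag \<Rightarrow> arc \<Rightarrow> (nat set \<Rightarrow>\<^sub>0 int) set \<times> int" where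
  "tribal_cycle D a =
     (\<Otimes>\<^bsub>reduced_group D\<^esub>v\<in>clas D. tribe_class D v [^]\<^bsub>reduced_group D\<^esub> right_half D v a,
      whole a)"

definition tribal_parity :: "diag \<Rightarrow> nat \<Rightarrow> (nat set \<Rightarrow>\<^sub>0 int) set \<times> int" where
  "tribal_parity D v =
     (\<Otimes>\<^bsub>reduced_group D\<^esub>v'\<in>clas D. tribe_class D v' [^]\<^bsub>reduced_group D\<^esub>
        intersection integer_group D (left_half D v) (right_half D v'),
      - index_parity D v)"

end

end

theory Submission
  imports Defs
begin

text \<open>
  Both coordinates of the tribal cycle and of the tribal parity are governed by integers: the first
  one is the class of a sum \<open>\<Sum>v. f v \<cdot> tribe v\<close>, where \<open>f v\<close> is the value of a right half \<open>D\<^sup>r\<^sub>v\<close> on an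
  arc or an intersection number \<open>D\<^sup>l \<cdot> D\<^sup>r\<^sub>v\<close>.  So the parity \<open>P v\<close> is the intersection of the left half
  at \<open>v\<close> with the tribal cycle, and everything reduces to how the halves and their intersection
  numbers behave under the moves.

  Three facts about integral chains on the graph of arcs carry the proof.

  The left half at \<open>v\<close> is the only chain that has the values 1, 0, 1, 0 on the ends NW, NE, SW, SE of
  \<open>v\<close> and does not change along the curve at other crossings (\<open>left_half_unique\<close>).  This identifies
  the halves before and after a move.

  Twice the intersection number of two cycles is a sum over the crossings of an alternating form in
  the fluxes through the four ends, which does not depend on the end with which the enumeration
  starts (\<open>two_intersection\<close>, \<open>wedge_rotate\<close>).  Hence a crossing region can be described from the
  corner of a face, and all orientations of the strands are treated at once.

  The boundary of a face meets every cycle in zero (\<open>intersection_boundary\<close>), and the sum over the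
  angles of a face of the left halves, with the incidence signs, is a multiple of the whole diagram
  plus this boundary (\<open>sum_left_halves_face\<close>).  Applied to the monogon, bigon and triangle of the
  Reidemeister moves this gives all relations between the crossings of the region.  They hold up to
  multiples of \<open>D \<cdot> D\<^sup>r\<close>, and these multiples vanish in the quotient, because
  \<open>\<Sum>v. (D \<cdot> D\<^sup>r\<^sub>v) \<cdot> tribe v\<close> is the signature (\<open>ext_sum_whole\<close>).  The same computation gives the
  normalization \<open>D \<cdot> \<delta> = 0\<close>.

  For the invariance, the predicate \<open>transfers\<close> states which integers \<open>f\<close> before and \<open>f'\<close> after a move
  are matched by the maps of the extended groups.  It holds for the index parity, for the right
  halves on correspondent arcs and for the intersection numbers of the halves.  The first case shows
  that signatures are mapped to signatures.  Since the maps of tribes are injective, by the tribal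
  axioms for the inverse move, the maps of the quotients are then well defined and injective.  The
  other two cases are the invariance of the cycle and of the parity.
\<close>

section \<open>First return maps\<close>

lemma return_map_eqI:
  assumes "x \<in> S" "0 < k" "(f ^^ k) x \<in> S" "\<And>j. 0 < j \<Longrightarrow> j < k \<Longrightarrow> (f ^^ j) x \<notin> S"
  shows "return_map f S x = (f ^^ k) x"
proof -
  have "(LEAST k. 0 < k \<and> (f ^^ k) x \<in> S) = k"
    by (rule Least_equality) (use assms in \<open>auto intro: leI\<close>)
  then show ?thesis
    using assms(1) by (simp add: return_map_def)
qed

lemma return_map_first:
  assumes "f permutes A" "finite A" "x \<in> S"
  obtains k where "0 < k" "return_map f S x = (f ^^ k) x" "(f ^^ k) x \<in> S"
    "\<And>j. 0 < j \<Longrightarrow> j < k \<Longrightarrow> (f ^^ j) x \<notin> S"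
proof -
  define P where "P k \<longleftrightarrow> 0 < k \<and> (f ^^ k) x \<in> S" for k
  have "permutation f"
    using assms permutation_permutes by blast
  then have "x \<in> orbit f x"
    by (rule permutation_self_in_orbit)
  then obtain m where "0 < m" "(f ^^ m) x = x"
    unfolding orbit_altdef by auto
  with assms(3) have "P m"
    by (simp add: P_def)
  then have "P (LEAST k. P k)"
    by (rule LeastI)
  moreover have "\<not> P j" if "j < (LEAST k. P k)" for j
    using that by (rule not_less_Least)
  ultimately show thesis
    using that[of "LEAST k. P k"] assms(3) by (auto simp: P_def return_map_def)
qed

text \<open>
  By induction on the number of steps, cutting off the way up to the first return.  The last clause
  says that the points passed by the return map are passed by \<open>f\<close> as well; it turns first visits of
  the orbit of \<open>f\<close> into first visits of the orbit of the return map.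
\<close>

lemma return_map_reaches:
  assumes "f permutes A" "finite A" "x \<in> S" "(f ^^ k) x \<in> S"
  shows "\<exists>n. (return_map f S ^^ n) x = (f ^^ k) x \<and> (0 < k \<longrightarrow> 0 < n) \<and>
     (\<forall>j. 0 < j \<and> j < n \<longrightarrow> (\<exists>i. 0 < i \<and> i < k \<and> (return_map f S ^^ j) x = (f ^^ i) x))"
  using assms(3,4)
proof (induction k arbitrary: x rule: less_induct)
  case (less k)
  show ?case
  proof (cases "k = 0")
    case True
    then show ?thesis by (intro exI[of _ 0]) auto
  next
    case False
    obtain i where i: "0 < i" "return_map f S x = (f ^^ i) x" "(f ^^ i) x \<in> S"
        "\<And>j. 0 < j \<Longrightarrow> j < i \<Longrightarrow> (f ^^ j) x \<notin> S"
      by (rule return_map_first[OF assms(1,2) less.prems(1)]) blast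
    have ik: "i \<le> k"
      using i(4)[of k] False less.prems(2) by force
    have split: "(f ^^ (j + i)) x = (f ^^ j) (return_map f S x)" for j
      by (simp add: funpow_add i(2))
    have "(f ^^ (k - i)) (return_map f S x) \<in> S"
      using split[of "k - i"] ik less.prems(2) by simp
    moreover have "k - i < k" "return_map f S x \<in> S"
      using i False by auto
    ultimately obtain n where n: "(return_map f S ^^ n) (return_map f S x)
          = (f ^^ (k - i)) (return_map f S x)"
        "\<And>j. 0 < j \<and> j < n \<Longrightarrow> \<exists>l. 0 < l \<and> l < k - i \<and>
            (return_map f S ^^ j) (return_map f S x) = (f ^^ l) (return_map f S x)"
        "0 < k - i \<longrightarrow> 0 < n"
      using less.IH by blast
    show ?thesis
    proof (cases "k = i")
      case True
      then show ?thesis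
        using i by (intro exI[of _ 1]) auto
    next
      case False
      show ?thesis
      proof (rule exI[of _ "Suc n"], intro conjI allI impI)
        show "(return_map f S ^^ Suc n) x = (f ^^ k) x"
          using n(1) split[of "k - i"] ik by (simp add: funpow_swap1)
        fix j assume j: "0 < j \<and> j < Suc n"
        show "\<exists>l. 0 < l \<and> l < k \<and> (return_map f S ^^ j) x = (f ^^ l) x"
        proof (cases "j = 1")
          case True
          then show ?thesis using i ik False by auto
        next
          case neq: False
          then obtain j' where j': "j = Suc j'" "0 < j'" "j' < n"
            using j by (cases j) auto
          then obtain l where "0 < l" "l < k - i"
              "(return_map f S ^^ j') (return_map f S x) = (f ^^ l) (return_map f S x)"
            using n(2) by blast
          then show ?thesis
            using split[of l] j' by (intro exI[of _ "l + i"]) (auto simp: funpow_swap1)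
        qed
      qed auto
    qed
  qed
qed

text \<open>
  If two points had the same first return, the one with the longer way would pass through the other
  one before.
\<close>

lemma return_map_permutes:
  assumes f: "f permutes A" "finite A" and S: "S \<subseteq> A"
  shows "return_map f S permutes S"
proof (rule bij_imp_permutes)
  have fin: "finite S"
    using assms finite_subset by blast
  have into: "return_map f S ` S \<subseteq> S"
    
  proof safe
    fix x assume "x \<in> S"
    then show "return_map f S x \<in> S"
      using return_map_first[OF f, of x S] by metis
  qed
  have injf: "inj (f ^^ k)" for k
    using f(1) by (simp add: inj_fn permutes_inj)
  have key: "x = y" if xy: "x \<in> S" "y \<in> S" "k \<le> m" "(f ^^ k) x = (f ^^ m) y"
      "\<And>j. 0 < j \<Longrightarrow> j < m \<Longrightarrow> (f ^^ j) y \<notin> S" "0 < k" for x y k m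
  proof -
    have "(f ^^ k) ((f ^^ (m - k)) y) = (f ^^ k) x"
      using xy(3,4) by (simp flip: funpow_add[unfolded o_def, THEN fun_cong])
    then have "(f ^^ (m - k)) y = x"
      using injf by (auto dest: injD)
    show ?thesis
    proof (cases "m - k = 0")
      case False
      then have "(f ^^ (m - k)) y \<notin> S"
        using xy(3,6) by (intro xy(5)) auto
      then show ?thesis
        using \<open>(f ^^ (m - k)) y = x\<close> xy(1) by simp
    qed (use \<open>(f ^^ (m - k)) y = x\<close> in simp)
  qed
  then have "inj_on (return_map f S) S"
    
  proof (intro inj_onI)
    fix x y assume xy: "x \<in> S" "y \<in> S" "return_map f S x = return_map f S y"
    obtain k where k: "0 < k" "return_map f S x = (f ^^ k) x"
        "\<And>j. 0 < j \<Longrightarrow> j < k \<Longrightarrow> (f ^^ j) x \<notin> S"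
      by (rule return_map_first[OF f xy(1)]) blast
    obtain m where m: "0 < m" "return_map f S y = (f ^^ m) y"
        "\<And>j. 0 < j \<Longrightarrow> j < m \<Longrightarrow> (f ^^ j) y \<notin> S"
      by (rule return_map_first[OF f xy(2)]) blast
    show "x = y"
    proof (cases "k \<le> m")
      case True
      then show ?thesis using key[of x y k m] k m xy by simp
    next
      case False
      then show ?thesis using key[of y x m k] k m xy by simp
    qed
  qed
  then show "bij_betw (return_map f S) S S"
    using into fin by (simp add: bij_betw_def endo_inj_surj)
qed (simp add: return_map_def)

lemma return_map_return_map:
  assumes f: "f permutes A" "finite A" and TS: "T \<subseteq> S" "S \<subseteq> A"
  shows "return_map (return_map f S) T = return_map f T"
proof
  fix x
  show "return_map (return_map f S) T x = return_map f T x"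
  proof (cases "x \<in> T")
    case True
    obtain k where k: "0 < k" "return_map f T x = (f ^^ k) x" "(f ^^ k) x \<in> T"
        "\<And>j. 0 < j \<Longrightarrow> j < k \<Longrightarrow> (f ^^ j) x \<notin> T"
      by (rule return_map_first[OF f True]) blast
    have "x \<in> S" "(f ^^ k) x \<in> S"
      using True TS k by auto
    from return_map_reaches[OF f this] obtain n where
      n: "(return_map f S ^^ n) x = (f ^^ k) x" "0 < n"
         "\<And>j. 0 < j \<Longrightarrow> j < n \<Longrightarrow> \<exists>i. 0 < i \<and> i < k \<and> (return_map f S ^^ j) x = (f ^^ i) x"
      using k(1) by blast
    have "return_map (return_map f S) T x = (return_map f S ^^ n) x"
    proof (rule return_map_eqI)
      fix j assume "0 < j" "j < n"
      then obtain i where "0 < i" "i < k" "(return_map f S ^^ j) x = (f ^^ i) x"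
        using n(3) by blast
      then show "(return_map f S ^^ j) x \<notin> T"
        using k(4) by simp
    qed (use True k n in simp_all)
    then show ?thesis using n k by simp
  qed (simp add: return_map_def)
qed

lemma return_map_conj:
  assumes "\<And>p. g (g' p) = p" "\<And>p. g' (g p) = p" "\<And>p. p \<in> S \<longleftrightarrow> g p \<in> S'"
    and f': "f' = g \<circ> f \<circ> g'"
  shows "return_map f' S' = g \<circ> return_map f S \<circ> g'"
proof
  fix x
  have pow: "(f' ^^ k) x = g ((f ^^ k) (g' x))" for k
    by (induction k) (simp_all add: assms)
  have g: "g y \<in> S' \<longleftrightarrow> y \<in> S" for y using assms(3) by blast
  have x: "x \<in> S' \<longleftrightarrow> g' x \<in> S" using g[of "g' x"] assms(1) by simp
  then show "return_map f' S' x = (g \<circ> return_map f S \<circ> g') x"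
    by (simp add: return_map_def pow g x assms(1))
qed

section \<open>The cyclic order of the classical passages\<close>

lemma UNIV_strand: "(UNIV::strand set) = {ToNE, ToNW}"
  by (auto intro: strand.exhaust)

abbreviation passages :: "diag \<Rightarrow> passage set" where
  "passages D \<equiv> clas D \<times> UNIV"

lemma knot_diagram_nxt:
  assumes "knot_diagram D"
  shows "nxt D permutes (dpts D \<times> UNIV)" "finite (dpts D \<times> (UNIV::strand set))"
    "clas D \<subseteq> dpts D" "finite (clas D)"
proof -
  have "finite (UNIV::strand set)"
    by (simp add: UNIV_strand)
  then show "nxt D permutes (dpts D \<times> UNIV)" "finite (dpts D \<times> (UNIV::strand set))"
    "clas D \<subseteq> dpts D" "finite (clas D)"
    using assms finite_subset[of "clas D" "dpts D"] unfolding knot_diagram_def by auto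
qed

lemma cnxt_permutes:
  assumes "knot_diagram D" shows "cnxt D permutes (passages D)"
  unfolding cnxt_def using knot_diagram_nxt[OF assms]
  by (intro return_map_permutes) auto

lemma cnxt_transitive:
  assumes D: "knot_diagram D" and pq: "p \<in> passages D" "q \<in> passages D"
  shows "\<exists>n>0. (cnxt D ^^ n) p = q"
proof -
  note kd = knot_diagram_nxt[OF D]
  have "p \<in> dpts D \<times> UNIV" "q \<in> dpts D \<times> UNIV"
    using kd pq by auto
  moreover have "cyclic_on (nxt D) (dpts D \<times> UNIV)"
    using D pq kd(3) unfolding knot_diagram_def by auto
  ultimately have "q \<in> orbit (nxt D) p"
    using orbit_cyclic_eq3 by metis
  then obtain k where "0 < k" "(nxt D ^^ k) p = q"
    by (auto simp: orbit_altdef)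
  moreover have "\<exists>n. (cnxt D ^^ n) p = (nxt D ^^ k) p \<and> (0 < k \<longrightarrow> 0 < n)"
    using return_map_reaches[OF kd(1,2) pq(1), of k] pq(2) \<open>(nxt D ^^ k) p = q\<close>
    unfolding cnxt_def by auto
  ultimately show ?thesis
    by auto
qed

text \<open>
  Taking first returns in steps is the same as taking them at once.  So erasing commutes with
  forgetting the virtual crossings, and the classical cyclic order of the result depends only on the
  classical cyclic order of \<open>D\<close>.
\<close>

lemma cnxt_erase:
  assumes D: "knot_diagram D"
  shows "cnxt (erase X D) = return_map (cnxt D) ((clas D - X) \<times> UNIV)"
proof -
  note kd = knot_diagram_nxt[OF D]
  have 1: "return_map (return_map (nxt D) ((dpts D - X) \<times> UNIV)) ((clas D - X) \<times> UNIV)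
      = return_map (nxt D) ((clas D - X) \<times> UNIV)"
    using kd(3) by (intro return_map_return_map[OF kd(1,2)]) auto
  have 2: "return_map (return_map (nxt D) (passages D)) ((clas D - X) \<times> UNIV)
      = return_map (nxt D) ((clas D - X) \<times> UNIV)"
    using kd(3) by (intro return_map_return_map[OF kd(1,2)]) auto
  show ?thesis
    using 1 2 by (simp add: cnxt_def erase_def)
qed

lemma cnxt_eq_nxt:
  assumes "p \<in> passages D" "nxt D p \<in> passages D"
  shows "cnxt D p = nxt D p"
  using return_map_eqI[of p "passages D" 1 "nxt D"] assms by (simp add: cnxt_def)

section \<open>Half-edges and arcs\<close>

fun opposite :: "corner \<Rightarrow> corner" where
  "opposite NE = SW" | "opposite SW = NE" | "opposite NW = SE" | "opposite SE = NW"

fun counterclockwise :: "corner \<Rightarrow> corner" where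
  "counterclockwise NE = NW" | "counterclockwise NW = SW" |
  "counterclockwise SW = SE" | "counterclockwise SE = NE"

definition across :: "half_edge \<Rightarrow> half_edge" where
  "across h = (fst h, opposite (snd h))"

definition turn_left :: "half_edge \<Rightarrow> half_edge" where
  "turn_left h = (fst h, counterclockwise (snd h))"

lemma UNIV_corner: "(UNIV::corner set) = {NE, NW, SW, SE}"
  by (auto intro: corner.exhaust)

lemma finite_corner [simp]: "finite (A::corner set)"
proof -
  have "finite (UNIV::corner set)" by (simp add: UNIV_corner)
  then show ?thesis by (rule finite_subset[OF subset_UNIV])
qed

lemma sum_corner: "(\<Sum>c\<in>UNIV. f c) = f NE + f NW + f SW + (f SE :: 'a::comm_monoid_add)"
  by (simp add: UNIV_corner add_ac)

definition half_edges :: "diag \<Rightarrow> half_edge set" where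
  "half_edges D = clas D \<times> UNIV"

text \<open>The other end of an arc, as opposed to the other end of an edge of the plane curve.\<close>

definition other_end :: "diag \<Rightarrow> half_edge \<Rightarrow> half_edge" where
  "other_end D h =
     (if snd h \<in> {NE, NW} then map_prod id in_corner (cnxt D (strand_at h))
      else map_prod id out_corner (inv_into UNIV (cnxt D) (strand_at h)))"

abbreviation cprv :: "diag \<Rightarrow> passage \<Rightarrow> passage" where
  "cprv D \<equiv> inv_into UNIV (cnxt D)"

lemma cnxt_simps:
  assumes "knot_diagram D"
  shows "cnxt D (cprv D p) = p" "cprv D (cnxt D p) = p"
    "cnxt D p \<in> passages D \<longleftrightarrow> p \<in> passages D"
    "cprv D p \<in> passages D \<longleftrightarrow> p \<in> passages D"
  using permutes_inverses[OF cnxt_permutes[OF assms]] permutes_in_image[OF cnxt_permutes[OF assms]]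
    permutes_in_image[OF permutes_inv[OF cnxt_permutes[OF assms]]] by auto

lemma fst_cnxt_simps:
  assumes "knot_diagram D"
  shows "fst (cnxt D p) \<in> clas D \<longleftrightarrow> fst p \<in> clas D" "fst (cprv D p) \<in> clas D \<longleftrightarrow> fst p \<in> clas D"
  using cnxt_simps(3,4)[OF assms, of p] by (auto simp: mem_Times_iff)

lemma strand_at_corner [simp]:
  "strand_at (map_prod id in_corner p) = p" "strand_at (map_prod id out_corner p) = p"
  by (cases p; cases "snd p"; simp add: strand_at_def)+

lemma fst_strand_at [simp]: "fst (strand_at h) = fst h"
  by (simp add: strand_at_def)

lemma in_corner_neq [simp]: "in_corner s \<noteq> NE" "in_corner s \<noteq> NW" "out_corner s \<noteq> SW" "out_corner s \<noteq> SE"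
  by (cases s; simp)+

lemma out_corner_cases: "out_corner s = NE \<or> out_corner s = NW"
  by (cases s; simp)

lemma map_corner_strand_at:
  "snd h \<in> {NE, NW} \<Longrightarrow> map_prod id out_corner (strand_at h) = h"
  "snd h \<notin> {NE, NW} \<Longrightarrow> map_prod id in_corner (strand_at h) = h"
  by (cases h; cases "snd h"; simp add: strand_at_def)+

lemma other_end_other_end:
  assumes "knot_diagram D" shows "other_end D (other_end D h) = h"
proof (cases "snd h \<in> {NE, NW}")
  case True
  then show ?thesis
    using map_corner_strand_at(1)[of h]
    by (auto simp: other_end_def cnxt_simps[OF assms])
next
  case False
  then show ?thesis
    using map_corner_strand_at(2)[of h] out_corner_cases
    by (auto simp: other_end_def cnxt_simps[OF assms])
qed

lemma other_end_in:
  assumes "knot_diagram D" "h \<in> half_edges D" shows "other_end D h \<in> half_edges D"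
  using assms by (auto simp: half_edges_def other_end_def mem_Times_iff fst_cnxt_simps)

lemma flux_other_end [simp]: "flux (snd (other_end D h)) = - flux (snd h)"
proof -
  have "flux (in_corner s) = -1" "flux (out_corner s) = 1" for s
    by (cases s; simp)+
  moreover have "snd h \<in> {NE, NW} \<longleftrightarrow> flux (snd h) = 1" "flux (snd h) = 1 \<or> flux (snd h) = -1"
    by (cases "snd h"; simp)+
  ultimately show ?thesis
    by (auto simp: other_end_def)
qed

lemma arc_at_other_end:
  assumes "knot_diagram D" shows "arc_at D (other_end D h) = arc_at D h"
  using out_corner_cases by (auto simp: arc_at_def other_end_def cnxt_simps[OF assms])

text \<open>
  An arc has just two ends, since the cyclic order determines the end of an arc from its start.
\<close>

lemma arc_at_eq_iff:
  assumes "knot_diagram D"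
  shows "arc_at D h = arc_at D k \<longleftrightarrow> k = h \<or> k = other_end D h"
proof
  assume eq: "arc_at D h = arc_at D k"
  have inj: "cprv D p = cprv D q \<Longrightarrow> p = q" for p q
    by (metis cnxt_simps(1)[OF assms])
  note m = map_corner_strand_at[of h] map_corner_strand_at[of k]
  show "k = h \<or> k = other_end D h"
  proof (cases "snd h \<in> {NE, NW}"; cases "snd k \<in> {NE, NW}")
    assume a: "snd h \<in> {NE, NW}" "snd k \<in> {NE, NW}"
    then have "strand_at h = strand_at k" using eq by (auto simp: arc_at_def)
    then show ?thesis using m a by metis
  next
    assume a: "snd h \<in> {NE, NW}" "snd k \<notin> {NE, NW}"
    then have "strand_at h = cprv D (strand_at k)" using eq by (auto simp: arc_at_def)
    then have "cnxt D (strand_at h) = strand_at k" by (simp add: cnxt_simps[OF assms])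
    then show ?thesis using m a by (auto simp: other_end_def)
  next
    assume a: "snd h \<notin> {NE, NW}" "snd k \<in> {NE, NW}"
    then have "cprv D (strand_at h) = strand_at k" using eq by (auto simp: arc_at_def)
    then show ?thesis using m a by (auto simp: other_end_def)
  next
    assume a: "snd h \<notin> {NE, NW}" "snd k \<notin> {NE, NW}"
    then have "cprv D (strand_at h) = cprv D (strand_at k)" using eq by (auto simp: arc_at_def)
    then have "strand_at h = strand_at k" by (rule inj)
    then show ?thesis using m a by metis
  qed
qed (auto simp: arc_at_other_end[OF assms])

lemma arc_at_in:
  assumes "knot_diagram D" "h \<in> half_edges D"
  shows "\<exists>p\<in>passages D. arc_at D h = Some p" "arc_at D h \<in> arcs D"
proof -
  show "\<exists>p\<in>passages D. arc_at D h = Some p"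
    using assms by (auto simp: arc_at_def half_edges_def mem_Times_iff fst_cnxt_simps)
  then show "arc_at D h \<in> arcs D"
    by (auto simp: arcs_def)
qed

lemma arc_at_out: "Some p = arc_at D (map_prod id out_corner p)"
  using out_corner_cases by (auto simp: arc_at_def)

lemma arcs_cases:
  assumes "a \<in> arcs D" "clas D \<noteq> {}"
  obtains h where "h \<in> half_edges D" "snd h \<in> {NE, NW}" "a = arc_at D h"
proof -
  obtain p where "p \<in> passages D" "a = Some p"
    using assms by (auto simp: arcs_def)
  then show thesis
    using that[of "map_prod id out_corner p"] out_corner_cases arc_at_out
    by (auto simp: half_edges_def)
qed

section \<open>Chains with integral coefficients\<close>

definition outflow :: "diag \<Rightarrow> (arc \<Rightarrow> int) \<Rightarrow> half_edge \<Rightarrow> int" where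
  "outflow D X h = flux (snd h) * X (arc_at D h)"

definition balanced :: "diag \<Rightarrow> (arc \<Rightarrow> int) \<Rightarrow> bool" where
  "balanced D X \<longleftrightarrow> (\<forall>v\<in>clas D. (\<Sum>c\<in>UNIV. outflow D X (v, c)) = 0)"

lemma outflow_other_end:
  assumes "knot_diagram D" shows "outflow D X (other_end D h) = - outflow D X h"
  by (simp add: outflow_def arc_at_other_end[OF assms])

lemma finite_half_edges: "knot_diagram D \<Longrightarrow> finite (half_edges D)"
  by (simp add: half_edges_def knot_diagram_nxt)

lemma sum_half_edges: "(\<Sum>h\<in>half_edges D. f h) = (\<Sum>v\<in>clas D. \<Sum>c\<in>UNIV. f (v, c))"
  by (simp add: half_edges_def sum.cartesian_product)

text \<open>Every arc contributes twice, where it leaves a crossing and where it enters one.\<close>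

lemma sum_outflow:
  assumes "knot_diagram D"
  shows "(\<Sum>v\<in>clas D. \<Sum>c\<in>UNIV. outflow D X (v, c)) = 0"
proof -
  have "bij_betw (other_end D) (half_edges D) (half_edges D)"
    by (rule bij_betwI[of _ _ _ "other_end D"])
      (auto simp: other_end_in[OF assms] other_end_other_end[OF assms])
  then have "(\<Sum>h\<in>half_edges D. outflow D X h) = (\<Sum>h\<in>half_edges D. outflow D X (other_end D h))"
    by (rule sum.reindex_bij_betw[symmetric])
  also have "\<dots> = - (\<Sum>h\<in>half_edges D. outflow D X h)"
    by (simp add: outflow_other_end[OF assms] sum_negf)
  finally show ?thesis
    by (simp add: sum_half_edges)
qed

abbreviation isect :: "diag \<Rightarrow> (arc \<Rightarrow> int) \<Rightarrow> (arc \<Rightarrow> int) \<Rightarrow> int" where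
  "isect \<equiv> intersection integer_group"

lemma finprod_integer_group: "finite A \<Longrightarrow> finprod integer_group f A = (\<Sum>x\<in>A. f x)"
proof (induction A rule: finite_induct)
  case empty
  interpret comm_group integer_group by (rule abelian_integer_group)
  show ?case by simp
next
  case (insert x A)
  interpret comm_group integer_group by (rule abelian_integer_group)
  show ?case using insert by (simp add: Pi_def)
qed

lemma preceding_eq:
  "preceding = {(NE, NE), (NE, NW), (NE, SW), (NE, SE), (NW, NW), (NW, SW), (NW, SE), (SW, SE)}"
  (is "_ = ?R")
proof (rule Set.set_eqI)
  fix e :: "corner \<times> corner"
  show "e \<in> preceding \<longleftrightarrow> e \<in> ?R"
    by (cases e; cases "fst e"; cases "snd e") (auto simp: preceding_def)
qed

lemma intersection_integer:
  assumes "knot_diagram D"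
  shows "isect D X Y =
    - (\<Sum>v\<in>clas D.
        outflow D Y (v, NE) * (outflow D X (v, NE) + outflow D X (v, NW) + outflow D X (v, SW) + outflow D X (v, SE))
      + outflow D Y (v, NW) * (outflow D X (v, NW) + outflow D X (v, SW) + outflow D X (v, SE))
      + outflow D Y (v, SW) * outflow D X (v, SE))"
  unfolding intersection_def sum_negf[symmetric]
  using knot_diagram_nxt(4)[OF assms]
  by (auto simp: finprod_integer_group preceding_eq outflow_def algebra_simps intro!: sum.cong)

text \<open>
  Twice the local contribution of a crossing to the intersection number of cycles, up to terms that
  cancel globally: an alternating form in the fluxes.  As the fluxes of a cycle add up to zero, it
  does not depend on the corner \<open>c\<close> from which the four ends are enumerated.
\<close>

definition wedge :: "corner \<Rightarrow> (corner \<Rightarrow> int) \<Rightarrow> (corner \<Rightarrow> int) \<Rightarrow> int" where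
  "wedge c x y =
     (let c1 = counterclockwise c; c2 = counterclockwise c1; c3 = counterclockwise c2
      in (x c * y c1 - y c * x c1) + (x c * y c2 - y c * x c2) + (x c * y c3 - y c * x c3)
       + (x c1 * y c2 - y c1 * x c2) + (x c1 * y c3 - y c1 * x c3) + (x c2 * y c3 - y c2 * x c3))"

lemma wedge_rotate:
  assumes "(\<Sum>c\<in>UNIV. x c) = 0" "(\<Sum>c\<in>UNIV. y c) = 0"
  shows "wedge c x y = wedge c' x y"
proof -
  have x: "x NE = - (x NW + x SW + x SE)" and y: "y NE = - (y NW + y SW + y SE)"
    using assms by (simp_all add: sum_corner)
  have "wedge c x y = wedge NE x y" for c
    by (cases c) (simp_all add: wedge_def Let_def x y algebra_simps)
  then show ?thesis by metis
qed

text \<open>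
  The shift of the second chain to its right makes the intersection formula asymmetric: its double
  differs from the alternating form by the products of the fluxes of both chains through the same
  end, positive at incoming and negative at outgoing ends.  Up to sign these are the fluxes
  of the product of the two chains, and they add up to zero.
\<close>

lemma two_intersection:
  assumes D: "knot_diagram D" and X: "balanced D X" and Y: "balanced D Y"
  shows "2 * isect D X Y =
    (\<Sum>v\<in>clas D. wedge NE (\<lambda>c. outflow D X (v, c)) (\<lambda>c. outflow D Y (v, c)))"
proof -
  let ?x = "\<lambda>v c. outflow D X (v, c)" and ?y = "\<lambda>v c. outflow D Y (v, c)"
  have "(\<Sum>v\<in>clas D. wedge NE (?x v) (?y v)) - 2 * isect D X Y
      = (\<Sum>v\<in>clas D. wedge NE (?x v) (?y v) + 2 * (?y v NE * (?x v NE + ?x v NW + ?x v SW + ?x v SE)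
      + ?y v NW * (?x v NW + ?x v SW + ?x v SE) + ?y v SW * ?x v SE))"
    by (simp add: intersection_integer[OF D] sum.distrib sum_distrib_left)
  also have "\<dots> = (\<Sum>v\<in>clas D. \<Sum>c\<in>UNIV. outflow D (\<lambda>a. X a * Y a) (v, c))"
  proof (rule sum.cong)
    fix v assume v: "v \<in> clas D"
    then have x: "?x v SE = - (?x v NE + ?x v NW + ?x v SW)" and y: "?y v SE = - (?y v NE + ?y v NW + ?y v SW)"
      using X Y by (force simp: balanced_def sum_corner)+
    have "(\<Sum>c\<in>UNIV. outflow D (\<lambda>a. X a * Y a) (v, c))
        = ?x v NE * ?y v NE + ?x v NW * ?y v NW - ?x v SW * ?y v SW - ?x v SE * ?y v SE"
      by (simp add: sum_corner outflow_def)
    also have "\<dots> = wedge NE (?x v) (?y v) + 2 * (?y v NE * (?x v NE + ?x v NW + ?x v SW + ?x v SE)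
      + ?y v NW * (?x v NW + ?x v SW + ?x v SE) + ?y v SW * ?x v SE)"
      by (simp add: wedge_def Let_def x y algebra_simps)
    finally show "wedge NE (?x v) (?y v) + 2 * (?y v NE * (?x v NE + ?x v NW + ?x v SW + ?x v SE)
      + ?y v NW * (?x v NW + ?x v SW + ?x v SE) + ?y v SW * ?x v SE) =
      (\<Sum>c\<in>UNIV. outflow D (\<lambda>a. X a * Y a) (v, c))" by simp
  qed simp
  also have "\<dots> = 0"
    by (rule sum_outflow[OF D])
  finally show ?thesis by simp
qed

lemma intersection_antisym:
  assumes "knot_diagram D" "balanced D X" "balanced D Y"
  shows "isect D Y X = - isect D X Y"
proof -
  have alt: "wedge NE y x = - wedge NE x y" for x y
    by (simp add: wedge_def Let_def)
  have "2 * isect D Y X = - (2 * isect D X Y)"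
    unfolding two_intersection[OF assms] two_intersection[OF assms(1,3,2)] sum_negf[symmetric]
    by (rule sum.cong[OF refl]) (rule alt)
  then show ?thesis by simp
qed

lemma intersection_cong:
  assumes "knot_diagram D" "\<And>h. h \<in> half_edges D \<Longrightarrow> X (arc_at D h) = X' (arc_at D h)"
    "\<And>h. h \<in> half_edges D \<Longrightarrow> Y (arc_at D h) = Y' (arc_at D h)"
  shows "isect D X Y = isect D X' Y'"
  unfolding intersection_integer[OF assms(1)] outflow_def
  using assms(2,3) by (auto simp: half_edges_def intro!: sum.cong)

lemma intersection_linear_left:
  assumes "knot_diagram D"
  shows "isect D (\<lambda>a. X a + X' a) Y =
      isect D X Y + isect D X' Y"
    "isect D (\<lambda>a. k * X a) Y = k * isect D X Y"
  by (simp_all add: intersection_integer[OF assms] outflow_def algebra_simps sum.distrib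
      sum_distrib_left sum_subtractf sum_negf)

lemma intersection_sum_left:
  assumes "knot_diagram D" "finite H"
  shows "isect D (\<lambda>a. \<Sum>h\<in>H. X h a) Y =
    (\<Sum>h\<in>H. isect D (X h) Y)"
  using assms(2)
proof (induction H rule: finite_induct)
  case empty
  show ?case by (simp add: intersection_integer[OF assms(1)] outflow_def)
qed (simp add: intersection_linear_left[OF assms(1)])

lemma balanced_whole: "balanced D whole"
  by (simp add: balanced_def sum_corner outflow_def whole_def)

lemma intersection_whole_whole:
  assumes "knot_diagram D" shows "isect D whole whole = 0"
  using intersection_antisym[OF assms balanced_whole balanced_whole] by simp

section \<open>The halves at a crossing\<close>

text \<open>
  The walk from \<open>q\<close> stops just before it reaches \<open>r\<close> for the first time.  So membership changes only at the
  passage \<open>q\<close>, where the piece starts, and at the passage \<open>r\<close>, where it has ended.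
\<close>

lemma piece_props:
  assumes D: "knot_diagram D" and q: "q \<in> passages D" and r: "r \<in> passages D" and qr: "q \<noteq> r"
  shows "Some q \<in> piece D q r" "Some (cprv D r) \<in> piece D q r" "Some r \<notin> piece D q r"
    "Some (cprv D q) \<notin> piece D q r"
    "p \<notin> {q, r} \<Longrightarrow> Some (cprv D p) \<in> piece D q r \<longleftrightarrow> Some p \<in> piece D q r"
proof -
  define d where "d = funpow_dist1 (cnxt D) q r"
  have "\<exists>n>0. (cnxt D ^^ n) q = r"
    by (rule cnxt_transitive[OF D q r])
  then have "r \<in> orbit (cnxt D) q"
    by (auto simp: orbit_altdef)
  then have d: "(cnxt D ^^ d) q = r"
    unfolding d_def by (rule funpow_dist1_prop)
  have least: "(cnxt D ^^ k) q \<noteq> r" if "k < d" for k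
    using funpow_dist1_least[of k "cnxt D" q r] that qr by (cases "k = 0") (auto simp: d_def)
  have pos: "0 < d" by (simp add: d_def)
  have mem: "Some p \<in> piece D q r \<longleftrightarrow> (\<exists>k<d. p = (cnxt D ^^ k) q)" for p
    by (auto simp: piece_def d_def)
  have prv: "cprv D ((cnxt D ^^ Suc k) q) = (cnxt D ^^ k) q" for k
    by (simp add: cnxt_simps[OF D])
  have nxt: "cprv D p = (cnxt D ^^ k) q \<longleftrightarrow> p = (cnxt D ^^ Suc k) q" for p k
    by (metis funpow.simps(2) comp_apply cnxt_simps(1,2)[OF D])
  show "Some q \<in> piece D q r"
    unfolding mem using pos by (intro exI[of _ 0]) simp
  show "Some (cprv D r) \<in> piece D q r"
    unfolding mem using pos d prv[of "d - 1"] by (intro exI[of _ "d - 1"]) simp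
  show "Some r \<notin> piece D q r"
    unfolding mem using least by metis
  show "Some (cprv D q) \<notin> piece D q r"
  proof
    assume "Some (cprv D q) \<in> piece D q r"
    then obtain k where k: "k < d" "(cnxt D ^^ Suc k) q = q"
      unfolding mem nxt by metis
    have "(cnxt D ^^ (d - Suc k)) q = (cnxt D ^^ (d - Suc k)) ((cnxt D ^^ Suc k) q)"
      using k(2) by simp
    also have "\<dots> = (cnxt D ^^ (d - Suc k + Suc k)) q"
      by (simp only: funpow_add comp_apply)
    also have "\<dots> = r"
      using d k(1) by simp
    finally show False
      using least[of "d - Suc k"] pos by simp
  qed
  assume p: "p \<notin> {q, r}"
  show "Some (cprv D p) \<in> piece D q r \<longleftrightarrow> Some p \<in> piece D q r"
  proof
    assume "Some (cprv D p) \<in> piece D q r"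
    then obtain k where k: "k < d" "p = (cnxt D ^^ Suc k) q"
      unfolding mem nxt by metis
    then have "Suc k \<noteq> d" using d p by auto
    then show "Some p \<in> piece D q r"
      unfolding mem using k by (intro exI[of _ "Suc k"]) auto
  next
    assume "Some p \<in> piece D q r"
    then obtain k where k: "k < d" "p = (cnxt D ^^ k) q"
      unfolding mem by metis
    then have "k \<noteq> 0" using p by (intro notI) auto
    then obtain j where "k = Suc j" by (cases k) auto
    then show "Some (cprv D p) \<in> piece D q r"
      unfolding mem using k prv[of j] by (intro exI[of _ j]) auto
  qed
qed

lemma left_half_at:
  assumes D: "knot_diagram D" and v: "v \<in> clas D"
  shows "left_half D v (arc_at D (v, c)) = of_bool (c \<in> {NW, SW})"
  using piece_props(1-4)[OF D, of "(v, ToNW)" "(v, ToNE)"] v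
  by (cases c) (auto simp: left_half_def arc_at_def strand_at_def)

lemma right_half_at:
  assumes D: "knot_diagram D" and v: "v \<in> clas D"
  shows "right_half D v (arc_at D (v, c)) = of_bool (c \<in> {NE, SE})"
  using piece_props(1-4)[OF D, of "(v, ToNE)" "(v, ToNW)"] v
  by (cases c) (auto simp: right_half_def arc_at_def strand_at_def)

lemma halves_straight:
  assumes D: "knot_diagram D" and v: "v \<in> clas D" and h: "fst h \<noteq> v"
  shows "left_half D v (arc_at D (across h)) = left_half D v (arc_at D h)"
    "right_half D v (arc_at D (across h)) = right_half D v (arc_at D h)"
  using piece_props(5)[OF D, of "(v, ToNW)" "(v, ToNE)" "strand_at h"] v h
    piece_props(5)[OF D, of "(v, ToNE)" "(v, ToNW)" "strand_at h"]
  by (cases h; cases "snd h"; force simp: left_half_def right_half_def across_def arc_at_def strand_at_def)+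

text \<open>
  A chain is determined by one value and its jumps at the passages, as the curve is connected.
\<close>

lemma chain_eqI:
  assumes D: "knot_diagram D"
    and jump: "\<And>h. h \<in> half_edges D \<Longrightarrow> snd h \<in> {NE, NW} \<Longrightarrow>
      f (arc_at D h) - f (arc_at D (across h)) = g (arc_at D h) - g (arc_at D (across h))"
    and h0: "h0 \<in> half_edges D" "f (arc_at D h0) = (g (arc_at D h0) :: int)"
    and k: "k \<in> half_edges D"
  shows "f (arc_at D k) = g (arc_at D k)"
proof -
  obtain p0 where p0: "p0 \<in> passages D" "arc_at D h0 = Some p0"
    using arc_at_in[OF D h0(1)] by blast
  obtain p where p: "p \<in> passages D" "arc_at D k = Some p"
    using arc_at_in[OF D k] by blast
  have step: "f (Some (cnxt D q)) - f (Some q) = g (Some (cnxt D q)) - g (Some q)"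
    if "q \<in> passages D" for q
  proof -
    obtain w s where ws: "cnxt D q = (w, s)" by fastforce
    have "arc_at D (w, out_corner s) = Some (cnxt D q)"
      using arc_at_out[of "cnxt D q" D] ws by simp
    moreover have "arc_at D (across (w, out_corner s)) = Some q"
      using ws cnxt_simps(2)[OF D, of q] by (cases s) (auto simp: arc_at_def across_def strand_at_def)
    moreover have "(w, out_corner s) \<in> half_edges D"
      using cnxt_simps(3)[OF D, of q] that ws by (auto simp: half_edges_def)
    ultimately show ?thesis
      using jump[of "(w, out_corner s)"] out_corner_cases[of s] by auto
  qed
  have "(cnxt D ^^ n) p0 \<in> passages D \<and> f (Some ((cnxt D ^^ n) p0)) = g (Some ((cnxt D ^^ n) p0))" for n
  proof (induction n)
    case 0
    then show ?case using p0 h0 by simp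
  next
    case (Suc n)
    then show ?case using step[of "(cnxt D ^^ n) p0"] by (simp add: cnxt_simps[OF D] del: mem_Sigma_iff)
  qed
  then show ?thesis
    using cnxt_transitive[OF D p0(1) p(1)] p by metis
qed

text \<open>
  The conditions prescribe the jumps of \<open>f\<close> at all passages.  So the left half can be recognized after
  a move from its values at its own crossing and from not changing at the others.
\<close>

lemma left_half_unique:
  assumes D: "knot_diagram D" and v: "v \<in> clas D"
    and at: "\<And>c. f (arc_at D (v, c)) = of_bool (c \<in> {NW, SW})"
    and straight: "\<And>h. h \<in> half_edges D \<Longrightarrow> fst h \<noteq> v \<Longrightarrow> snd h \<in> {NE, NW} \<Longrightarrow>
      f (arc_at D (across h)) = f (arc_at D h)"
    and k: "k \<in> half_edges D"
  shows "f (arc_at D k) = left_half D v (arc_at D k)"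
proof (rule chain_eqI[OF D _ _ _ k])
  fix h assume h: "h \<in> half_edges D" "snd h \<in> {NE, NW}"
  show "f (arc_at D h) - f (arc_at D (across h)) =
      left_half D v (arc_at D h) - left_half D v (arc_at D (across h))"
  proof (cases "fst h = v")
    case True
    then show ?thesis
      using at[of "snd h"] at[of "opposite (snd h)"] left_half_at[OF D v] by (cases h) (simp add: across_def)
  next
    case False
    then show ?thesis using straight[OF h(1)] h halves_straight[OF D v] by simp
  qed
next
  show "(v, NW) \<in> half_edges D" using v by (simp add: half_edges_def)
  show "f (arc_at D (v, NW)) = left_half D v (arc_at D (v, NW))"
    using at left_half_at[OF D v] by simp
qed

lemma right_half_eq:
  assumes D: "knot_diagram D" and v: "v \<in> clas D" and k: "k \<in> half_edges D"
  shows "right_half D v (arc_at D k) = 1 - left_half D v (arc_at D k)"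
proof -
  have "(\<lambda>a. 1 - right_half D v a) (arc_at D k) = left_half D v (arc_at D k)"
  proof (rule left_half_unique[OF D v _ _ k])
    fix c show "1 - right_half D v (arc_at D (v, c)) = of_bool (c \<in> {NW, SW})"
      by (cases c) (simp_all add: right_half_at[OF D v])
  qed (simp add: halves_straight[OF D v])
  then show ?thesis by simp
qed

lemma balanced_halves:
  assumes D: "knot_diagram D" and v: "v \<in> clas D"
  shows "balanced D (left_half D v)" "balanced D (right_half D v)"
  unfolding balanced_def sum_corner
proof safe
  fix w
  show "outflow D (left_half D v) (w, NE) + outflow D (left_half D v) (w, NW)
      + outflow D (left_half D v) (w, SW) + outflow D (left_half D v) (w, SE) = 0"
    using left_half_at[OF D v] halves_straight(1)[OF D v, of "(w, NE)"] halves_straight(1)[OF D v, of "(w, NW)"]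
    by (cases "w = v") (simp_all add: outflow_def across_def)
  show "outflow D (right_half D v) (w, NE) + outflow D (right_half D v) (w, NW)
      + outflow D (right_half D v) (w, SW) + outflow D (right_half D v) (w, SE) = 0"
    using right_half_at[OF D v] halves_straight(2)[OF D v, of "(w, NE)"] halves_straight(2)[OF D v, of "(w, NW)"]
    by (cases "w = v") (simp_all add: outflow_def across_def)
qed

section \<open>Faces\<close>

text \<open>
  A union of cycles of \<open>face_next\<close>: each side of a face leaves along one angle \<open>h\<close> and arrives at the
  counterclockwise next half-edge of another angle.
\<close>

definition face :: "diag \<Rightarrow> half_edge set \<Rightarrow> bool" where
  "face D H \<longleftrightarrow> H \<subseteq> half_edges D \<and> other_end D ` H = turn_left ` H"

text \<open>
  The boundary is traversed with the face on the left, so a side counts positively if it leaves its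
  angle along the orientation of the diagram.
\<close>

definition boundary :: "diag \<Rightarrow> half_edge set \<Rightarrow> arc \<Rightarrow> int" where
  "boundary D H a = (\<Sum>h\<in>H. if arc_at D h = a then flux (snd h) else 0)"

lemma clockwise_counterclockwise [simp]:
  "clockwise (counterclockwise c) = c" "counterclockwise (clockwise c) = c"
  by (cases c; simp)+

lemma inj_turn_left: "inj turn_left"
  by (rule injI) (metis clockwise_counterclockwise(1) turn_left_def fst_conv snd_conv prod.expand)

lemma in_turn_left_image: "(v, c) \<in> turn_left ` H \<longleftrightarrow> (v, clockwise c) \<in> H"
  by (force simp: turn_left_def image_iff)

text \<open>
  The boundary leaves a crossing along the half-edge \<open>h\<close> of an angle and arrives along \<open>turn_left h\<close>.
\<close>

lemma outflow_boundary:
  assumes D: "knot_diagram D" and H: "face D H" and k: "(v, c) \<in> half_edges D"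
  shows "outflow D (boundary D H) (v, c) = of_bool ((v, c) \<in> H) - of_bool ((v, clockwise c) \<in> H)"
proof -
  let ?k = "(v, c)"
  have fin: "finite H"
    using H finite_half_edges[OF D] finite_subset unfolding face_def by blast
  have flux: "flux (snd h) * flux (snd h) = 1" for h :: half_edge
    by (cases "snd h"; simp)
  have contrib: "flux (snd ?k) * (if arc_at D h = arc_at D ?k then flux (snd h) else 0)
      = (if h = ?k then 1 else 0) - (if h = other_end D ?k then 1 else 0)" for h
  proof -
    have "flux c \<noteq> - flux c"
      by (cases c) auto
    then have ne: "other_end D ?k \<noteq> ?k"
      using flux_other_end[of D ?k] by (metis snd_conv)
    show ?thesis
      using flux[of ?k] flux_other_end[of D ?k] ne
      by (auto simp: arc_at_eq_iff[OF D] other_end_other_end[OF D])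
  qed
  have "outflow D (boundary D H) ?k = (\<Sum>h\<in>H. (if h = ?k then 1 else 0) - (if h = other_end D ?k then 1 else 0))"
    unfolding outflow_def boundary_def sum_distrib_left contrib ..
  also have "\<dots> = of_bool (?k \<in> H) - of_bool (other_end D ?k \<in> H)"
    using fin by (simp add: sum_subtractf)
  also have "other_end D ?k \<in> H \<longleftrightarrow> ?k \<in> other_end D ` H"
    by (metis image_eqI imageE other_end_other_end[OF D])
  also have "\<dots> \<longleftrightarrow> (v, clockwise c) \<in> H"
    using H in_turn_left_image unfolding face_def by metis
  finally show ?thesis .
qed

lemma balanced_boundary:
  assumes D: "knot_diagram D" and H: "face D H"
  shows "balanced D (boundary D H)"
  unfolding balanced_def sum_corner
  by (auto simp: outflow_boundary[OF D H] half_edges_def)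

text \<open>
  The boundary of a face meets every cycle in zero, because the cycle can be pushed off it.
  In terms of fluxes, the sum over the angles of the face of the two fluxes through the sides of
  the angle vanishes, as every side of the face is counted from both ends.
\<close>

lemma intersection_boundary:
  assumes D: "knot_diagram D" and H: "face D H" and Y: "balanced D Y"
  shows "isect D (boundary D H) Y = 0"
proof -
  have fin: "finite H" and sub: "H \<subseteq> half_edges D" and img: "other_end D ` H = turn_left ` H"
    using H finite_half_edges[OF D] finite_subset unfolding face_def by blast+
  let ?g = "\<lambda>h. of_bool (h \<in> H) * (outflow D Y h + outflow D Y (turn_left h))"
  have "2 * isect D (boundary D H) Y = (\<Sum>v\<in>clas D. \<Sum>c\<in>UNIV. ?g (v, c))"
    unfolding two_intersection[OF D balanced_boundary[OF D H] Y]
  proof (rule sum.cong[OF refl])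
    fix v assume v: "v \<in> clas D"
    let ?y = "\<lambda>c. outflow D Y (v, c)"
    have y: "?y SE = - (?y NE + ?y NW + ?y SW)"
      using Y v by (force simp: balanced_def sum_corner)
    have x: "outflow D (boundary D H) (v, c) = of_bool ((v, c) \<in> H) - of_bool ((v, clockwise c) \<in> H)" for c
      using v by (intro outflow_boundary[OF D H]) (simp add: half_edges_def)
    show "wedge NE (\<lambda>c. outflow D (boundary D H) (v, c)) ?y = (\<Sum>c\<in>UNIV. ?g (v, c))"
      unfolding x by (simp add: wedge_def Let_def sum_corner turn_left_def y algebra_simps)
  qed
  also have "\<dots> = (\<Sum>h\<in>half_edges D. ?g h)"
    by (simp add: sum_half_edges)
  also have "\<dots> = (\<Sum>h\<in>H. outflow D Y h + outflow D Y (turn_left h))"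
    using sub finite_half_edges[OF D] by (intro sum.mono_neutral_cong_right) auto
  also have "\<dots> = (\<Sum>h\<in>H. outflow D Y h) + (\<Sum>k\<in>turn_left ` H. outflow D Y k)"
    using inj_turn_left by (subst sum.reindex) (auto simp: sum.distrib inj_on_def inj_def)
  also have "(\<Sum>k\<in>turn_left ` H. outflow D Y k) = (\<Sum>h\<in>H. outflow D Y (other_end D h))"
    unfolding img[symmetric] by (subst sum.reindex) (auto intro: inj_on_inverseI[where g = "other_end D"] simp: other_end_other_end[OF D])
  finally show ?thesis
    by (simp add: outflow_other_end[OF D] sum_negf)
qed

text \<open>
  At a passage of the curve through an angle of the face, \<open>incidence\<close> turns the jump of the left
  half into the jump of the boundary of the face; so the two chains differ by a constant.
\<close>

lemma sum_left_halves_face: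
  assumes D: "knot_diagram D" and H: "face D H"
  obtains m where "\<And>k. k \<in> half_edges D \<Longrightarrow>
    (\<Sum>h\<in>H. incidence h * left_half D (fst h) (arc_at D k)) = m + boundary D H (arc_at D k)"
proof (cases "half_edges D = {}")
  case True
  then show ?thesis using that by auto
next
  case False
  then obtain k0 where k0: "k0 \<in> half_edges D" by blast
  have fin: "finite H" and sub: "H \<subseteq> half_edges D"
    using H finite_half_edges[OF D] finite_subset unfolding face_def by blast+
  define f where "f a = (\<Sum>h\<in>H. incidence h * left_half D (fst h) a)" for a
  define m where "m = f (arc_at D k0) - boundary D H (arc_at D k0)"
  have "f (arc_at D k) = (\<lambda>a. m + boundary D H a) (arc_at D k)" if k: "k \<in> half_edges D" for k
  proof (rule chain_eqI[OF D _ k0 _ k])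
    show "f (arc_at D k0) = m + boundary D H (arc_at D k0)"
      by (simp add: m_def)
    fix k assume k: "k \<in> half_edges D" "snd k \<in> {NE, NW}"
    obtain w c where wc: "k = (w, c)" by fastforce
    have w: "w \<in> clas D" using k wc by (simp add: half_edges_def)
    define s :: int where "s = (if c = NW then 1 else -1)"
    define t :: "corner \<Rightarrow> int" where "t c = of_bool ((w, c) \<in> H)" for c
    have jump: "left_half D (fst h) (arc_at D k) - left_half D (fst h) (arc_at D (across k))
        = (if fst h = w then s else 0)" if h: "h \<in> H" for h
    proof -
      have "fst h \<in> clas D" using h sub by (auto simp: half_edges_def)
      then show ?thesis
        using k wc left_half_at[OF D w] halves_straight(1)[OF D \<open>fst h \<in> clas D\<close>, of k]
        by (auto simp: across_def s_def)
    qed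
    have "f (arc_at D k) - f (arc_at D (across k)) = (\<Sum>h\<in>H. incidence h * (if fst h = w then s else 0))"
      unfolding f_def sum_subtractf[symmetric] right_diff_distrib[symmetric] by (simp add: jump)
    also have "\<dots> = (\<Sum>h\<in>half_edges D. of_bool (h \<in> H) * incidence h * (if fst h = w then s else 0))"
      using sub finite_half_edges[OF D] by (intro sum.mono_neutral_cong_left) auto
    also have "\<dots> = (\<Sum>v\<in>clas D. if v = w then s * (t NW + t SE - t NE - t SW) else 0)"
      unfolding sum_half_edges
      by (rule sum.cong) (auto simp: sum_corner incidence_def t_def algebra_simps)
    also have "\<dots> = s * (t NW + t SE - t NE - t SW)"
      using w knot_diagram_nxt(4)[OF D] by simp
    also have "\<dots> = outflow D (boundary D H) k + outflow D (boundary D H) (across k)"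
      using k w by (auto simp: wc across_def outflow_boundary[OF D H] half_edges_def s_def t_def)
    also have "\<dots> = boundary D H (arc_at D k) - boundary D H (arc_at D (across k))"
      using k wc by (auto simp: outflow_def across_def)
    finally show "f (arc_at D k) - f (arc_at D (across k)) =
        m + boundary D H (arc_at D k) - (m + boundary D H (arc_at D (across k)))" by simp
  qed
  then show ?thesis
    using that unfolding f_def by blast
qed

lemma intersection_left_halves_face:
  assumes D: "knot_diagram D" and H: "face D H" and Y: "balanced D Y"
    and m: "\<And>k. k \<in> half_edges D \<Longrightarrow>
      (\<Sum>h\<in>H. incidence h * left_half D (fst h) (arc_at D k)) = m + boundary D H (arc_at D k)"
  shows "(\<Sum>h\<in>H. incidence h * isect D (left_half D (fst h)) Y)
    = m * isect D whole Y"
proof -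
  have fin: "finite H"
    using H finite_half_edges[OF D] finite_subset unfolding face_def by blast
  have "(\<Sum>h\<in>H. incidence h * isect D (left_half D (fst h)) Y)
      = isect D (\<lambda>a. \<Sum>h\<in>H. incidence h * left_half D (fst h) a) Y"
    by (simp add: intersection_sum_left[OF D fin] intersection_linear_left[OF D])
  also have "\<dots> = isect D (\<lambda>a. m * whole a + boundary D H a) Y"
    by (rule intersection_cong[OF D]) (simp_all add: m whole_def)
  also have "\<dots> = m * isect D whole Y"
    by (simp add: intersection_linear_left[OF D] intersection_boundary[OF D H Y])
  finally show ?thesis .
qed

lemma boundary_eq_0: "a \<notin> arc_at D ` H \<Longrightarrow> boundary D H a = 0"
  unfolding boundary_def by (rule sum.neutral) auto

section \<open>The regions of the Reidemeister moves\<close>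

lemma opp_of_face_next: "face_next D h = k \<Longrightarrow> opp D h = turn_left k"
  by (cases "opp D h") (auto simp: face_next_def turn_left_def)

text \<open>
  An edge between two classical crossings carries no virtual crossing, so it is a whole arc.
\<close>

lemma other_end_eq_opp:
  assumes D: "knot_diagram D" and h: "fst h \<in> clas D" "fst (opp D h) \<in> clas D"
  shows "other_end D h = opp D h"
proof (cases "snd h \<in> {NE, NW}")
  case True
  then have "nxt D (strand_at h) \<in> passages D" "strand_at h \<in> passages D"
    using h by (auto simp: opp_def mem_Times_iff)
  then have "cnxt D (strand_at h) = nxt D (strand_at h)"
    by (intro cnxt_eq_nxt)
  then show ?thesis
    using True by (auto simp: other_end_def opp_def)
next
  case False
  let ?q = "inv_into UNIV (nxt D) (strand_at h)"
  have nq: "nxt D ?q = strand_at h"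
    using permutes_inverses(1)[OF knot_diagram_nxt(1)[OF D]] .
  have "?q \<in> passages D" "nxt D ?q \<in> passages D"
    using h False nq by (auto simp: opp_def mem_Times_iff)
  then have "cnxt D ?q = strand_at h"
    using cnxt_eq_nxt nq by metis
  then have "cprv D (strand_at h) = ?q"
    using cnxt_simps(2)[OF D] by metis
  then show ?thesis
    using False by (auto simp: other_end_def opp_def)
qed

lemma other_end_face_next:
  assumes "knot_diagram D" "face_next D h = k" "fst h \<in> clas D" "fst k \<in> clas D"
  shows "other_end D h = turn_left k"
  using other_end_eq_opp[OF assms(1,3)] opp_of_face_next[OF assms(2)] assms(4)
  by (simp add: turn_left_def)

text \<open>
  A side that leaves an angle along its orientation is incoming at the next one.  This bounds the
  possible corners of monogons and bigons.
\<close>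

lemma face_next_flux: "face_next D h = k \<Longrightarrow> flux (counterclockwise (snd k)) = - flux (snd h)"
proof -
  assume "face_next D h = k"
  then have "opp D h = turn_left k" by (rule opp_of_face_next)
  then have "counterclockwise (snd k) = snd (opp D h)" by (simp add: turn_left_def)
  then show ?thesis
    by (cases "snd h"; cases "strand_of (snd h)"; cases "snd (nxt D (strand_at h))";
        cases "snd (inv_into UNIV (nxt D) (strand_at h))") (simp_all add: opp_def)
qed

lemma monogon_face:
  assumes "knot_diagram D" "monogon D h" shows "face D {h}"
  using assms other_end_face_next[of D h h] by (auto simp: face_def monogon_def half_edges_def mem_Times_iff)

lemma bigon_face:
  assumes "knot_diagram D" "bigon D h1 h2" shows "face D {h1, h2}"
  using assms other_end_face_next[of D h1 h2] other_end_face_next[of D h2 h1]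
  by (auto simp: face_def bigon_def half_edges_def mem_Times_iff)

lemma triangle_face:
  assumes "knot_diagram D" "triangle D h1 h2 h3" shows "face D {h1, h2, h3}"
  using assms other_end_face_next[of D h1 h2] other_end_face_next[of D h2 h3] other_end_face_next[of D h3 h1]
  by (auto simp: face_def triangle_def half_edges_def mem_Times_iff)

lemma monogon_corner:
  assumes "monogon D h" shows "snd h \<in> {NW, SE}"
  using face_next_flux[of D h h] assms by (cases "snd h") (auto simp: monogon_def)

text \<open>
  The boundary of the monogon is the loop up to sign; the constant of the face relation is read off at the end
  opposite to the angle.
\<close>

lemma monogon_halves:
  assumes D: "knot_diagram D" and h: "monogon D h"
  shows "\<And>k. k \<in> half_edges D \<Longrightarrow> arc_at D k \<noteq> arc_at D h \<Longrightarrow>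
      left_half D (fst h) (arc_at D k) = 1 - loop_coeff h"
    and "\<And>Y. balanced D Y \<Longrightarrow> isect D (left_half D (fst h)) Y
      = (1 - loop_coeff h) * isect D whole Y"
proof -
  note F = monogon_face[OF D h]
  have v: "fst h \<in> clas D" using h by (simp add: monogon_def)
  have c: "snd h \<in> {NW, SE}" by (rule monogon_corner[OF h])
  then have inc: "incidence h = 1" by (auto simp: incidence_def)
  obtain m where m: "\<And>k. k \<in> half_edges D \<Longrightarrow>
      left_half D (fst h) (arc_at D k) = m + boundary D {h} (arc_at D k)"
    using sum_left_halves_face[OF D F] inc by auto
  have "across h \<in> half_edges D" "other_end D h = turn_left h"
    using v other_end_face_next[OF D, of h h] h by (auto simp: half_edges_def across_def monogon_def)
  moreover have "across h \<noteq> h" "across h \<noteq> turn_left h"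
    by (cases h; cases "snd h"; simp add: across_def turn_left_def)+
  ultimately have "boundary D {h} (arc_at D (across h)) = 0"
    using arc_at_eq_iff[OF D, of h "across h"] by (intro boundary_eq_0) auto
  then have "m = left_half D (fst h) (arc_at D (across h))"
    using m[of "across h"] \<open>across h \<in> half_edges D\<close> by simp
  also have "\<dots> = 1 - loop_coeff h"
    using c left_half_at[OF D v] by (auto simp: across_def loop_coeff_def)
  finally have m_eq: "m = 1 - loop_coeff h" .
  show "left_half D (fst h) (arc_at D k) = 1 - loop_coeff h"
    if "k \<in> half_edges D" "arc_at D k \<noteq> arc_at D h" for k
    using m[OF that(1)] boundary_eq_0[of "arc_at D k" D "{h}"] that m_eq by auto
  show "isect D (left_half D (fst h)) Y
      = (1 - loop_coeff h) * isect D whole Y" if "balanced D Y" for Y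
    using intersection_left_halves_face[OF D F that, of m] m inc m_eq by simp
qed

text \<open>
  The two angles of a bigon have the same incidence, so that up to this sign the sum of the two left
  halves is a constant plus the boundary of the bigon.
\<close>

lemma bigon_halves:
  assumes D: "knot_diagram D" and h: "bigon D h1 h2"
  shows "\<And>k. k \<in> half_edges D \<Longrightarrow> arc_at D k \<notin> arc_at D ` {h1, h2} \<Longrightarrow>
      left_half D (fst h1) (arc_at D k) + left_half D (fst h2) (arc_at D k) = 1"
    and "\<And>Y. balanced D Y \<Longrightarrow> isect D (left_half D (fst h1)) Y
      + isect D (left_half D (fst h2)) Y = isect D whole Y"
proof -
  note F = bigon_face[OF D h]
  have v: "fst h1 \<in> clas D" "fst h2 \<in> clas D" "fst h1 \<noteq> fst h2"
    and n: "face_next D h1 = h2" "face_next D h2 = h1"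
    using h by (auto simp: bigon_def)
  then have hh: "h1 \<noteq> h2" by auto
  have e1: "other_end D h1 = turn_left h2" and e2: "other_end D h2 = turn_left h1"
    using v n by (auto intro!: other_end_face_next[OF D])
  have c: "(snd h1, snd h2) \<in> {(NE, SW), (SW, NE), (NW, NW), (SE, SE)}"
    using face_next_flux[OF n(1)] face_next_flux[OF n(2)]
    by (cases "snd h1"; cases "snd h2"; simp)
  define e where "e = incidence h1"
  have inc: "incidence h1 = e" "incidence h2 = e" and ee: "e * e = 1"
    using c by (auto simp: incidence_def e_def)
  obtain m where m: "\<And>k. k \<in> half_edges D \<Longrightarrow>
      e * (left_half D (fst h1) (arc_at D k) + left_half D (fst h2) (arc_at D k))
      = m + boundary D {h1, h2} (arc_at D k)"
    using sum_left_halves_face[OF D F] hh inc by (auto simp: distrib_left)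
  \<comment> \<open>At this end outside of the bigon the left half of the first crossing is known from its own
    crossing, and that of the second one by following the side up to its crossing.\<close>
  let ?k = "across h1"
  have k: "?k \<in> half_edges D"
    using v by (auto simp: half_edges_def across_def)
  have "?k \<noteq> h1" "?k \<noteq> h2" "?k \<noteq> turn_left h1" "?k \<noteq> turn_left h2"
    using v(3) by (cases h1; cases "snd h1"; auto simp: across_def turn_left_def)+
  then have "boundary D {h1, h2} (arc_at D ?k) = 0"
    using arc_at_eq_iff[OF D, of h1 ?k] arc_at_eq_iff[OF D, of h2 ?k] e1 e2
    by (intro boundary_eq_0) auto
  then have "m = e * (left_half D (fst h1) (arc_at D ?k) + left_half D (fst h2) (arc_at D ?k))"
    using m[OF k] by simp
  also have "left_half D (fst h2) (arc_at D ?k) = left_half D (fst h2) (arc_at D (turn_left h2))"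
    using halves_straight(1)[OF D v(2,3)] arc_at_other_end[OF D, of h1] e1 by simp
  also have "left_half D (fst h1) (arc_at D ?k) + left_half D (fst h2) (arc_at D (turn_left h2)) = 1"
    using c left_half_at[OF D v(1)] left_half_at[OF D v(2)] by (auto simp: across_def turn_left_def)
  finally have m_eq: "m = e" by simp
  show "left_half D (fst h1) (arc_at D k) + left_half D (fst h2) (arc_at D k) = 1"
    if "k \<in> half_edges D" "arc_at D k \<notin> arc_at D ` {h1, h2}" for k
  proof -
    have "e * (left_half D (fst h1) (arc_at D k) + left_half D (fst h2) (arc_at D k)) = e"
      using m[OF that(1)] boundary_eq_0[OF that(2)] m_eq by simp
    then show ?thesis using ee by (metis mult_cancel_left2 mult_zero_left zero_neq_one)
  qed
  show "isect D (left_half D (fst h1)) Y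
      + isect D (left_half D (fst h2)) Y = isect D whole Y"
    if "balanced D Y" for Y
  proof -
    have "e * (isect D (left_half D (fst h1)) Y
        + isect D (left_half D (fst h2)) Y) = e * isect D whole Y"
      using intersection_left_halves_face[OF D F that, of m] m inc m_eq hh by (simp add: distrib_left)
    then show ?thesis using ee by (metis mult_cancel_left mult_zero_left zero_neq_one)
  qed
qed

lemma triangle_halves:
  assumes D: "knot_diagram D" and h: "triangle D h1 h2 h3"
  obtains m where "\<And>Y. balanced D Y \<Longrightarrow>
      incidence h1 * isect D (left_half D (fst h1)) Y
      + incidence h2 * isect D (left_half D (fst h2)) Y
      + incidence h3 * isect D (left_half D (fst h3)) Y
      = m * isect D whole Y"
proof -
  note F = triangle_face[OF D h]
  have hh: "h1 \<noteq> h2" "h1 \<noteq> h3" "h2 \<noteq> h3"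
    using h by (auto simp: triangle_def)
  obtain m where "\<And>k. k \<in> half_edges D \<Longrightarrow>
      (\<Sum>h\<in>{h1, h2, h3}. incidence h * left_half D (fst h) (arc_at D k))
      = m + boundary D {h1, h2, h3} (arc_at D k)"
    using sum_left_halves_face[OF D F] by blast
  from intersection_left_halves_face[OF D F _ this] show thesis
    using hh by (intro that[of m]) (auto simp: add.assoc)
qed

section \<open>Removing crossings\<close>

text \<open>
  The value of a chain that is straight at \<open>X\<close> does not depend on which of the arcs merging by the
  removal of \<open>X\<close> is taken, so it restricts to a chain of the smaller diagram.
\<close>

definition straight_at :: "nat set \<Rightarrow> diag \<Rightarrow> (arc \<Rightarrow> 'b) \<Rightarrow> bool" where
  "straight_at X D f \<longleftrightarrow>
     (\<forall>h\<in>half_edges D. fst h \<in> X \<longrightarrow> f (arc_at D (across h)) = f (arc_at D h))"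

lemma straight_at_cnxt:
  assumes D: "knot_diagram D" and f: "straight_at X D f"
    and q: "q \<in> passages D" "fst (cnxt D q) \<in> X"
  shows "f (Some (cnxt D q)) = f (Some q)"
proof -
  obtain w s where ws: "cnxt D q = (w, s)" by fastforce
  let ?h = "(w, in_corner s)"
  have "?h \<in> half_edges D"
    using q(1) cnxt_simps(3)[OF D, of q] ws by (auto simp: half_edges_def)
  moreover have "arc_at D ?h = Some q"
    using ws cnxt_simps(2)[OF D, of q] by (cases s) (auto simp: arc_at_def strand_at_def)
  moreover have "arc_at D (across ?h) = Some (cnxt D q)"
    using ws by (cases s) (auto simp: arc_at_def across_def strand_at_def)
  ultimately show ?thesis
    using f q(2) ws by (force simp: straight_at_def)
qed

lemma clas_erase [simp]: "clas (erase X D) = clas D - X"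
  by (simp add: erase_def)

lemma half_edges_erase: "half_edges (erase X D) = {h \<in> half_edges D. fst h \<notin> X}"
  by (auto simp: half_edges_def)

lemma straight_at_erase:
  assumes D: "knot_diagram D" and D': "knot_diagram (erase X D)" and f: "straight_at X D f"
    and h: "h \<in> half_edges (erase X D)"
  shows "f (arc_at (erase X D) h) = f (arc_at D h)"
proof (cases "snd h \<in> {NE, NW}")
  case True
  then show ?thesis by (auto simp: arc_at_def)
next
  case False
  let ?D = "erase X D"
  let ?S = "(clas D - X) \<times> (UNIV::strand set)"
  define x where "x = cprv ?D (strand_at h)"
  have x: "x \<in> ?S" "cnxt ?D x = strand_at h"
    using h cnxt_simps[OF D'] by (auto simp: x_def half_edges_def mem_Times_iff fst_cnxt_simps[OF D'])
  have fin: "finite (passages D)"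
    using knot_diagram_nxt(4)[OF D] by (simp add: UNIV_strand)
  obtain k where k: "0 < k" "strand_at h = (cnxt D ^^ k) x"
      "\<And>j. 0 < j \<Longrightarrow> j < k \<Longrightarrow> (cnxt D ^^ j) x \<notin> ?S"
    using x unfolding cnxt_erase[OF D]
    by (elim return_map_first[OF cnxt_permutes[OF D] fin, of x ?S]) metis
  have "(cnxt D ^^ j) x \<in> passages D \<and> f (Some ((cnxt D ^^ j) x)) = f (Some x)" if "j < k" for j
    using that
  proof (induction j)
    case 0
    then show ?case using x by auto
  next
    case (Suc j)
    let ?q = "(cnxt D ^^ j) x"
    have q: "?q \<in> passages D" "f (Some ?q) = f (Some x)"
      using Suc by auto
    moreover have "cnxt D ?q \<in> passages D"
      using q(1) by (simp only: cnxt_simps(3)[OF D])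
    moreover have "cnxt D ?q \<notin> ?S"
      using k(3)[of "Suc j"] Suc.prems by simp
    ultimately show ?case
      using straight_at_cnxt[OF D f q(1)] by (auto simp: mem_Times_iff)
  qed
  from this[of "k - 1"] k(1) have "f (Some ((cnxt D ^^ (k - 1)) x)) = f (Some x)"
    by simp
  moreover have "cprv D (strand_at h) = (cnxt D ^^ (k - 1)) x"
    using k(1,2) cnxt_simps(2)[OF D] by (cases k) auto
  ultimately show ?thesis
    using False by (auto simp: arc_at_def x_def)
qed

lemma straight_at_carrier_arc:
  assumes D: "knot_diagram D" and f: "straight_at X D f"
    and ne: "clas D - X \<noteq> {}" and p: "p \<in> passages D"
  shows "f (carrier_arc D (erase X D) (Some p)) = f (Some p)"
    and "carrier_arc D (erase X D) (Some p) \<in> arcs (erase X D)"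
proof -
  let ?S = "(clas D - X) \<times> (UNIV::strand set)"
  define n where "n = (LEAST k. (cprv D ^^ k) p \<in> ?S)"
  obtain y where y: "y \<in> ?S" using ne by auto
  then have "y \<in> passages D" by auto
  then obtain m where m: "(cnxt D ^^ m) y = p"
    using cnxt_transitive[OF D _ p] by blast
  have "(cprv D ^^ m) ((cnxt D ^^ m) y) = y"
  proof (induction m)
    case (Suc m)
    then show ?case
      unfolding funpow_Suc_right[of m "cprv D"] by (simp add: cnxt_simps[OF D])
  qed simp
  then have "(cprv D ^^ m) p \<in> ?S" using m y by simp
  then have n: "(cprv D ^^ n) p \<in> ?S"
    unfolding n_def by (rule LeastI)
  have "(cprv D ^^ j) p \<in> passages D \<and> f (Some ((cprv D ^^ j) p)) = f (Some p)" if "j \<le> n" for j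
    using that
  proof (induction j)
    case 0
    then show ?case using p by simp
  next
    case (Suc j)
    let ?q = "(cprv D ^^ Suc j) p"
    have "(cprv D ^^ j) p \<notin> ?S"
      using Suc.prems not_less_Least[of j "\<lambda>k. (cprv D ^^ k) p \<in> ?S"] by (simp add: n_def)
    moreover have q: "cnxt D ?q = (cprv D ^^ j) p"
      by (simp add: cnxt_simps[OF D])
    moreover have "(cprv D ^^ j) p \<in> passages D" using Suc by simp
    moreover from this have "?q \<in> passages D"
      using q cnxt_simps(3)[OF D, of ?q] by simp
    ultimately show ?case
      using straight_at_cnxt[OF D f, of ?q] Suc by (auto simp: mem_Times_iff simp del: funpow.simps)
  qed
  then have "f (Some ((cprv D ^^ n) p)) = f (Some p)" by simp
  moreover have "carrier_arc D (erase X D) (Some p) = Some ((cprv D ^^ n) p)"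
    using ne by (simp add: prior_def n_def)
  ultimately show "f (carrier_arc D (erase X D) (Some p)) = f (Some p)"
      "carrier_arc D (erase X D) (Some p) \<in> arcs (erase X D)"
    using n by (auto simp: arcs_def)
qed

lemma straight_at_halves:
  assumes D: "knot_diagram D" and v: "v \<in> clas D - X"
  shows "straight_at X D (left_half D v)" "straight_at X D (right_half D v)"
proof -
  have "fst h \<noteq> v" if "fst h \<in> X" for h :: half_edge
    using v that by auto
  then show "straight_at X D (left_half D v)" "straight_at X D (right_half D v)"
    using v by (simp_all add: straight_at_def halves_straight[OF D])
qed

text \<open>
  At the surviving crossings, a half of the larger diagram has the values and jumps that
  characterize the half of the smaller one.
\<close>

lemma halves_erase:
  assumes D: "knot_diagram D" and D': "knot_diagram (erase X D)" and v: "v \<in> clas D - X"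
    and k: "k \<in> half_edges (erase X D)"
  shows "left_half (erase X D) v (arc_at (erase X D) k) = left_half D v (arc_at (erase X D) k)"
    "right_half (erase X D) v (arc_at (erase X D) k) = right_half D v (arc_at (erase X D) k)"
proof -
  note eq = straight_at_erase[OF D D' straight_at_halves(1)[OF D v]]
  have vD: "v \<in> clas D" and vD': "v \<in> clas (erase X D)" using v by auto
  have "left_half D v (arc_at (erase X D) k) = left_half (erase X D) v (arc_at (erase X D) k)"
  proof (rule left_half_unique[OF D' vD' _ _ k])
    fix c show "left_half D v (arc_at (erase X D) (v, c)) = of_bool (c \<in> {NW, SW})"
      using v eq[of "(v, c)"] left_half_at[OF D vD] by (simp add: half_edges_def)
  next
    fix h assume h: "h \<in> half_edges (erase X D)" "fst h \<noteq> v"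
    moreover have "across h \<in> half_edges (erase X D)"
      using h by (auto simp: half_edges_def across_def)
    ultimately show "left_half D v (arc_at (erase X D) (across h)) = left_half D v (arc_at (erase X D) h)"
      using eq halves_straight(1)[OF D vD] by simp
  qed
  then show l: "left_half (erase X D) v (arc_at (erase X D) k) = left_half D v (arc_at (erase X D) k)" ..
  have kD: "k \<in> half_edges D" using k by (simp add: half_edges_erase)
  show "right_half (erase X D) v (arc_at (erase X D) k) = right_half D v (arc_at (erase X D) k)"
    using straight_at_erase[OF D D' straight_at_halves(2)[OF D v] k] eq[OF k] l
    by (simp add: right_half_eq[OF D' vD' k] right_half_eq[OF D vD kD])
qed

text \<open>
  What the erasure of \<open>X\<close> needs in order to preserve intersection numbers: the local contributions of
  the removed crossings cancel.
\<close>

definition removable :: "nat set \<Rightarrow> diag \<Rightarrow> bool" where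
  "removable X D \<longleftrightarrow> X \<subseteq> clas D \<and>
     (\<forall>Y Z. balanced D Y \<and> balanced D Z \<and> straight_at X D Y \<and> straight_at X D Z \<longrightarrow>
       (\<Sum>v\<in>X. wedge NE (\<lambda>c. outflow D Y (v, c)) (\<lambda>c. outflow D Z (v, c))) = 0)"

lemma intersection_erase:
  assumes D: "knot_diagram D" and D': "knot_diagram (erase X D)" and X: "removable X D"
    and Y: "balanced D Y" "balanced (erase X D) Y'" "straight_at X D Y"
      "\<And>k. k \<in> half_edges (erase X D) \<Longrightarrow> Y' (arc_at (erase X D) k) = Y (arc_at (erase X D) k)"
    and Z: "balanced D Z" "balanced (erase X D) Z'" "straight_at X D Z"
      "\<And>k. k \<in> half_edges (erase X D) \<Longrightarrow> Z' (arc_at (erase X D) k) = Z (arc_at (erase X D) k)"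
  shows "isect (erase X D) Y' Z' = isect D Y Z"
proof -
  let ?D = "erase X D"
  let ?w = "\<lambda>D Y Z v. wedge NE (\<lambda>c. outflow D Y (v, c)) (\<lambda>c. outflow D Z (v, c))"
  have sub: "X \<subseteq> clas D" and zero: "(\<Sum>v\<in>X. ?w D Y Z v) = 0"
    using X Y Z by (auto simp: removable_def)
  have "outflow ?D Y' (v, c) = outflow D Y (v, c)" "outflow ?D Z' (v, c) = outflow D Z (v, c)"
    if "v \<in> clas D - X" for v c
    using that Y(4)[of "(v, c)"] Z(4)[of "(v, c)"] straight_at_erase[OF D D' Y(3), of "(v, c)"]
      straight_at_erase[OF D D' Z(3), of "(v, c)"]
    by (auto simp: outflow_def half_edges_def)
  then have "2 * isect ?D Y' Z' = (\<Sum>v\<in>clas D - X. ?w D Y Z v)"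
    unfolding two_intersection[OF D' Y(2) Z(2)] by (auto intro: sum.cong)
  also have "\<dots> = (\<Sum>v\<in>clas D. ?w D Y Z v)"
    using sum.subset_diff[OF sub knot_diagram_nxt(4)[OF D], of "?w D Y Z"] zero by simp
  also have "\<dots> = 2 * isect D Y Z"
    by (rule two_intersection[OF D Y(1) Z(1), symmetric])
  finally show ?thesis by simp
qed

lemma outflow_across:
  assumes "straight_at X D Y" "h \<in> half_edges D" "fst h \<in> X"
  shows "outflow D Y (across h) = - outflow D Y h"
  using assms by (cases h; cases "snd h"; auto simp: straight_at_def outflow_def across_def)

text \<open>
  The loop joins the two strands of the crossing.  So all four fluxes of a straight chain agree up to
  sign, those of two chains are proportional, and the alternating form vanishes.
\<close>

lemma removable_monogon:
  assumes D: "knot_diagram D" and h: "monogon D h"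
  shows "removable {fst h} D"
  unfolding removable_def
proof safe
  show v: "fst h \<in> clas D" using h by (simp add: monogon_def)
  fix Y Z assume YZ: "balanced D Y" "balanced D Z" "straight_at {fst h} D Y" "straight_at {fst h} D Z"
  obtain w c where wc: "h = (w, c)" by fastforce
  have e: "other_end D h = turn_left h"
    using v other_end_face_next[OF D, of h h] h by (auto simp: monogon_def)
  have out: "outflow D X (turn_left h) = - outflow D X h" "outflow D X (across h) = - outflow D X h"
    "outflow D X (across (turn_left h)) = outflow D X h" if "straight_at {fst h} D X" for X
    using outflow_other_end[OF D, of X h] e outflow_across[OF that, of h] outflow_across[OF that, of "turn_left h"] v
    by (auto simp: half_edges_def turn_left_def mem_Times_iff)
  have corner: "opposite c = counterclockwise (counterclockwise c)" for c
    by (cases c) auto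
  have "wedge c (\<lambda>c. outflow D Y (w, c)) (\<lambda>c. outflow D Z (w, c)) = 0"
    using out[OF YZ(3)] out[OF YZ(4)]
    by (simp add: wedge_def Let_def wc turn_left_def across_def corner)
  moreover have "(\<Sum>c\<in>UNIV. outflow D Y (w, c)) = 0" "(\<Sum>c\<in>UNIV. outflow D Z (w, c)) = 0"
    using YZ(1,2) v wc by (auto simp: balanced_def)
  ultimately show "(\<Sum>v\<in>{fst h}. wedge NE (\<lambda>c. outflow D Y (v, c)) (\<lambda>c. outflow D Z (v, c))) = 0"
    using wedge_rotate[of "\<lambda>c. outflow D Y (w, c)" "\<lambda>c. outflow D Z (w, c)" NE c] wc by simp
qed

text \<open>
  At both crossings a straight chain has the same pair of fluxes along the two strands, but in
  opposite cyclic order.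
\<close>

lemma removable_bigon:
  assumes D: "knot_diagram D" and h: "bigon D h1 h2"
  shows "removable {fst h1, fst h2} D"
  unfolding removable_def
proof safe
  show v: "fst h1 \<in> clas D" "fst h2 \<in> clas D" using h by (auto simp: bigon_def)
  let ?X = "{fst h1, fst h2}"
  fix Y Z assume YZ: "balanced D Y" "balanced D Z" "straight_at ?X D Y" "straight_at ?X D Z"
  obtain v1 c1 v2 c2 where vc: "h1 = (v1, c1)" "h2 = (v2, c2)" by fastforce
  have ne: "v1 \<noteq> v2" using h vc by (auto simp: bigon_def)
  have e: "other_end D h1 = turn_left h2" "other_end D h2 = turn_left h1"
    using v other_end_face_next[OF D, of h1 h2] other_end_face_next[OF D, of h2 h1] h
    by (auto simp: bigon_def)
  have out: "outflow D X (turn_left h2) = - outflow D X h1" "outflow D X (turn_left h1) = - outflow D X h2"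
    "outflow D X (across h1) = - outflow D X h1" "outflow D X (across h2) = - outflow D X h2"
    "outflow D X (across (turn_left h1)) = outflow D X h2" "outflow D X (across (turn_left h2)) = outflow D X h1"
    if "straight_at ?X D X" for X
    using outflow_other_end[OF D, of X h1] outflow_other_end[OF D, of X h2] e v
      outflow_across[OF that, of h1] outflow_across[OF that, of "turn_left h1"]
      outflow_across[OF that, of h2] outflow_across[OF that, of "turn_left h2"]
    by (auto simp: half_edges_def turn_left_def mem_Times_iff)
  have corner: "opposite c = counterclockwise (counterclockwise c)" for c
    by (cases c) auto
  have "wedge c1 (\<lambda>c. outflow D Y (v1, c)) (\<lambda>c. outflow D Z (v1, c))
      + wedge c2 (\<lambda>c. outflow D Y (v2, c)) (\<lambda>c. outflow D Z (v2, c)) = 0"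
    using out[OF YZ(3)] out[OF YZ(4)]
    by (simp add: wedge_def Let_def vc turn_left_def across_def corner algebra_simps)
  moreover have "(\<Sum>c\<in>UNIV. outflow D Y (w, c)) = 0" "(\<Sum>c\<in>UNIV. outflow D Z (w, c)) = 0"
    if "w \<in> {v1, v2}" for w
    using YZ(1,2) v vc that by (auto simp: balanced_def)
  ultimately show "(\<Sum>v\<in>?X. wedge NE (\<lambda>c. outflow D Y (v, c)) (\<lambda>c. outflow D Z (v, c))) = 0"
    using wedge_rotate[of "\<lambda>c. outflow D Y (v1, c)" "\<lambda>c. outflow D Z (v1, c)" NE c1]
      wedge_rotate[of "\<lambda>c. outflow D Y (v2, c)" "\<lambda>c. outflow D Z (v2, c)" NE c2] vc ne by simp
qed

lemma intersections_erase:
  assumes D: "knot_diagram D" and D': "knot_diagram (erase X D)" and X: "removable X D"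
    and v: "v \<in> clas D - X"
  shows "w \<in> clas D - X \<Longrightarrow> isect (erase X D) (left_half (erase X D) v) (right_half (erase X D) w)
      = isect D (left_half D v) (right_half D w)"
    and "index_parity (erase X D) v = index_parity D v"
proof -
  have vD: "v \<in> clas D" and vD': "v \<in> clas (erase X D)" using v by auto
  show "isect (erase X D) (left_half (erase X D) v) (right_half (erase X D) w)
      = isect D (left_half D v) (right_half D w)" if w: "w \<in> clas D - X"
  proof -
    have wD: "w \<in> clas D" and wD': "w \<in> clas (erase X D)" using w by auto
    show ?thesis
      by (rule intersection_erase[OF D D' X balanced_halves(1)[OF D vD] balanced_halves(1)[OF D' vD']
          straight_at_halves(1)[OF D v] halves_erase(1)[OF D D' v]
          balanced_halves(2)[OF D wD] balanced_halves(2)[OF D' wD']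
          straight_at_halves(2)[OF D w] halves_erase(2)[OF D D' w]])
  qed
  show "index_parity (erase X D) v = index_parity D v"
    unfolding index_parity_def
    by (subst intersection_erase[OF D D' X balanced_halves(1)[OF D vD] balanced_halves(1)[OF D' vD']
          straight_at_halves(1)[OF D v] halves_erase(1)[OF D D' v] balanced_whole balanced_whole])
      (auto simp: straight_at_def whole_def)
qed

lemma right_half_carrier_arc:
  assumes D: "knot_diagram D" and D': "knot_diagram (erase X D)"
    and v: "v \<in> clas D - X" and p: "p \<in> passages D"
  shows "right_half (erase X D) v (carrier_arc D (erase X D) (Some p)) = right_half D v (Some p)"
proof -
  have ne: "clas D - X \<noteq> {}" using v by auto
  note c = straight_at_carrier_arc[OF D straight_at_halves(2)[OF D v] ne p]
  obtain k where "k \<in> half_edges (erase X D)" "carrier_arc D (erase X D) (Some p) = arc_at (erase X D) k"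
    by (rule arcs_cases[OF c(2)]) (use ne in simp)
  then show ?thesis
    using halves_erase(2)[OF D D' v] c(1) by metis
qed

section \<open>Isotopies and detour moves\<close>

text \<open>
  The trace of a move without change of the classical crossings: isotopies, and detour moves with
  \<open>g = id\<close>.
\<close>

definition relabels :: "(nat \<Rightarrow> nat) \<Rightarrow> diag \<Rightarrow> diag \<Rightarrow> bool" where
  "relabels g D D' \<longleftrightarrow> bij_betw g (clas D) (clas D') \<and>
     (\<forall>p\<in>passages D. cnxt D' (map_prod g id p) = map_prod g id (cnxt D p))"

lemma relabels_isotopy:
  assumes D: "knot_diagram D" and D': "knot_diagram D'" and iso: "isotopic_by g D D'"
  shows "relabels g D D'"
proof -
  have b: "bij_betw g (dpts D) (dpts D')" and c: "clas D' = g ` clas D"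
    and n: "\<And>p. p \<in> dpts D \<times> UNIV \<Longrightarrow> nxt D' (map_prod g id p) = map_prod g id (nxt D p)"
    using iso by (auto simp: isotopic_by_def)
  have inj: "inj_on g (dpts D)" using b by (rule bij_betw_imp_inj_on)
  note kd = knot_diagram_nxt[OF D]
  have pow: "(nxt D ^^ k) p \<in> dpts D \<times> UNIV \<and>
      (nxt D' ^^ k) (map_prod g id p) = map_prod g id ((nxt D ^^ k) p)"
    if "p \<in> dpts D \<times> UNIV" for k p
  proof (induction k)
    case (Suc k)
    then show ?case
      using n[of "(nxt D ^^ k) p"] permutes_in_image[OF kd(1), of "(nxt D ^^ k) p"]
      by (simp add: id_def del: mem_Sigma_iff)
  qed (use that in simp)
  have in_clas: "map_prod g id q \<in> passages D' \<longleftrightarrow> q \<in> passages D" if "q \<in> dpts D \<times> UNIV" for q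
    using that inj_on_image_mem_iff[OF inj _ kd(3), of "fst q"] by (auto simp: c mem_Times_iff)
  have "cnxt D' (map_prod g id p) = map_prod g id (cnxt D p)" if p: "p \<in> passages D" for p
  proof -
    have pd: "p \<in> dpts D \<times> UNIV" using p kd(3) by auto
    obtain k where k: "0 < k" "return_map (nxt D) (passages D) p = (nxt D ^^ k) p" "(nxt D ^^ k) p \<in> passages D"
        "\<And>j. 0 < j \<Longrightarrow> j < k \<Longrightarrow> (nxt D ^^ j) p \<notin> passages D"
      by (rule return_map_first[OF kd(1,2) p]) (rule that)
    have q: "(nxt D ^^ j) p \<in> dpts D \<times> UNIV"
        "(nxt D' ^^ j) (map_prod g id p) = map_prod g id ((nxt D ^^ j) p)" for j
      using pow[OF pd, of j] by blast+
    have "cnxt D' (map_prod g id p) = (nxt D' ^^ k) (map_prod g id p)"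
      unfolding cnxt_def
    proof (rule return_map_eqI)
      show "map_prod g id p \<in> passages D'"
        unfolding in_clas[OF pd] by (rule p)
      show "(nxt D' ^^ k) (map_prod g id p) \<in> passages D'"
        unfolding q(2) in_clas[OF q(1)] by (rule k(3))
      show "(nxt D' ^^ j) (map_prod g id p) \<notin> passages D'" if "0 < j" "j < k" for j
        unfolding q(2) in_clas[OF q(1)] by (rule k(4)[OF that])
    qed (rule k(1))
    then show ?thesis
      using q(2)[of k] k(2) by (simp add: cnxt_def)
  qed
  moreover have "bij_betw g (clas D) (clas D')"
    using inj kd(3) by (auto simp: bij_betw_def c inj_on_subset)
  ultimately show ?thesis
    by (simp add: relabels_def)
qed

text \<open>
  The removed paths are virtual, so the common rest of both diagrams has the classical cyclic order of
  either diagram.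
\<close>

lemma relabels_detour:
  assumes D: "knot_diagram D" and D': "knot_diagram D'" and d: "detour D D'"
  shows "relabels id D D'" "clas D' = clas D"
proof -
  obtain X X' where X: "X \<inter> clas D = {}" "X' \<inter> clas D' = {}" "erase X D = erase X' D'"
    using d by (auto simp: detour_def virtual_path_def)
  have idem: "cnxt (erase X D) = cnxt D" if "knot_diagram D" "X \<inter> clas D = {}" for X D
  proof -
    have "clas D - X = clas D" using that(2) by auto
    then show ?thesis
      using return_map_return_map[OF knot_diagram_nxt(1,2)[OF that(1)], of "passages D" "passages D"]
        knot_diagram_nxt(3)[OF that(1)]
      by (simp add: cnxt_erase[OF that(1)]) (auto simp: cnxt_def)
  qed
  have "clas D = clas (erase X D)" "clas D' = clas (erase X' D')"
    using X(1,2) by auto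
  then show c: "clas D' = clas D"
    by (metis X(3))
  have "cnxt D' = cnxt D"
    using idem[OF D X(1)] idem[OF D' X(2)] X(3) by simp
  then show "relabels id D D'"
    using c by (simp add: relabels_def prod.map_id)
qed

lemma arc_at_relabels:
  assumes D: "knot_diagram D" and D': "knot_diagram D'" and r: "relabels g D D'"
    and h: "h \<in> half_edges D"
  shows "arc_at D' (map_prod g id h) = map_option (map_prod g id) (arc_at D h)"
proof (cases "snd h \<in> {NE, NW}")
  case True
  then show ?thesis by (auto simp: arc_at_def strand_at_def)
next
  case False
  let ?q = "cprv D (strand_at h)"
  have "?q \<in> passages D"
    using h by (auto simp: half_edges_def mem_Times_iff fst_cnxt_simps[OF D])
  then have "cnxt D' (map_prod g id ?q) = map_prod g id (strand_at h)"
    using r unfolding relabels_def by (metis cnxt_simps(1)[OF D])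
  then have "map_prod g id ?q = cprv D' (map_prod g id (strand_at h))"
    using cnxt_simps(2)[OF D'] by metis
  then show ?thesis
    using False by (auto simp: arc_at_def strand_at_def)
qed

lemma half_edges_relabels:
  "relabels g D D' \<Longrightarrow> h \<in> half_edges D \<Longrightarrow> map_prod g id h \<in> half_edges D'"
  by (auto simp: relabels_def half_edges_def bij_betw_def)

lemma halves_relabels:
  assumes D: "knot_diagram D" and D': "knot_diagram D'" and r: "relabels g D D'"
    and v: "v \<in> clas D" and k: "k \<in> half_edges D"
  shows "left_half D' (g v) (arc_at D' (map_prod g id k)) = left_half D v (arc_at D k)"
    "right_half D' (g v) (arc_at D' (map_prod g id k)) = right_half D v (arc_at D k)"
proof -
  let ?f = "\<lambda>a. left_half D' (g v) (map_option (map_prod g id) a)"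
  note arc = arc_at_relabels[OF D D' r, symmetric]
  have gv: "g v \<in> clas D'" using r v by (auto simp: relabels_def bij_betw_def)
  have "?f (arc_at D k) = left_half D v (arc_at D k)"
  proof (rule left_half_unique[OF D v _ _ k])
    fix c show "?f (arc_at D (v, c)) = of_bool (c \<in> {NW, SW})"
      using v by (simp add: arc half_edges_def left_half_at[OF D' gv])
  next
    fix h assume h: "h \<in> half_edges D" "fst h \<noteq> v"
    have h': "across h \<in> half_edges D"
      using h by (auto simp: half_edges_def across_def)
    have "fst (map_prod g id h) \<noteq> g v"
      using r h v by (auto simp: relabels_def bij_betw_def half_edges_def dest: inj_onD)
    then show "?f (arc_at D (across h)) = ?f (arc_at D h)"
      using halves_straight(1)[OF D' gv, of "map_prod g id h"]
      by (simp add: arc[OF h'] arc[OF h(1)]) (simp add: across_def)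
  qed
  then show l: "left_half D' (g v) (arc_at D' (map_prod g id k)) = left_half D v (arc_at D k)"
    by (simp add: arc_at_relabels[OF D D' r k])
  show "right_half D' (g v) (arc_at D' (map_prod g id k)) = right_half D v (arc_at D k)"
    by (simp add: right_half_eq[OF D' gv half_edges_relabels[OF r k]] right_half_eq[OF D v k] l)
qed

lemma intersection_relabels:
  assumes D: "knot_diagram D" and D': "knot_diagram D'" and r: "relabels g D D'"
    and Y: "\<And>k. k \<in> half_edges D \<Longrightarrow> Y' (arc_at D' (map_prod g id k)) = Y (arc_at D k)"
    and Z: "\<And>k. k \<in> half_edges D \<Longrightarrow> Z' (arc_at D' (map_prod g id k)) = Z (arc_at D k)"
  shows "isect D' Y' Z' = isect D Y Z"
proof -
  have b: "bij_betw g (clas D) (clas D')" using r by (simp add: relabels_def)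
  have "outflow D' Y' (g v, c) = outflow D Y (v, c)" "outflow D' Z' (g v, c) = outflow D Z (v, c)"
    if "v \<in> clas D" for v c
    using Y[of "(v, c)"] Z[of "(v, c)"] that by (auto simp: outflow_def half_edges_def)
  then show ?thesis
    unfolding intersection_integer[OF D] intersection_integer[OF D'] sum.reindex_bij_betw[OF b, symmetric]
    by simp
qed

section \<open>Moving a strand across a crossing\<close>

text \<open>
  Conjugation of the cyclic order by an involution \<open>\<tau>\<close> of the passages acts on half-edges by moving
  the passage and keeping the direction.
\<close>

definition move_end :: "(passage \<Rightarrow> passage) \<Rightarrow> half_edge \<Rightarrow> half_edge" where
  "move_end t h =
     map_prod id (if snd h \<in> {NE, NW} then out_corner else in_corner) (t (strand_at h))"

lemma opp_opp:
  assumes "knot_diagram D" shows "opp D (opp D h) = h"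
proof -
  note inv = permutes_inverses[OF knot_diagram_nxt(1)[OF assms]]
  show ?thesis
  proof (cases "snd h \<in> {NE, NW}")
    case True
    then show ?thesis
      using map_corner_strand_at(1)[of h] by (auto simp: opp_def inv)
  next
    case False
    then show ?thesis
      using map_corner_strand_at(2)[of h] out_corner_cases by (auto simp: opp_def inv)
  qed
qed

lemma inv_conj_involution:
  fixes f t :: "'a \<Rightarrow> 'a"
  assumes "bij f" "\<And>p. t (t p) = p"
  shows "inv_into UNIV (t \<circ> f \<circ> t) p = t (inv_into UNIV f (t p))"
proof (rule inv_f_eq)
  have "inj t" by (metis injI assms(2))
  then show "inj (t \<circ> f \<circ> t)"
    using assms(1) by (intro inj_compose) (auto simp: bij_def)
  show "(t \<circ> f \<circ> t) (t (inv_into UNIV f (t p))) = p"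
    using assms by (simp add: surj_f_inv_f bij_is_surj)
qed

text \<open>
  Fluxes \<open>x\<^sub>i\<close> and \<open>x\<^sub>i'\<close> of cycles at the crossings of the triangle before and after the move, which
  agree at the six ends of the region.  The triangle before the move has its angles between \<open>c\<^sub>i\<close> and
  the next end; afterwards it has the opposite angles.
\<close>

definition triangle_fluxes ::
  "corner \<Rightarrow> corner \<Rightarrow> corner \<Rightarrow> (corner \<Rightarrow> int) \<Rightarrow> (corner \<Rightarrow> int) \<Rightarrow> (corner \<Rightarrow> int) \<Rightarrow>
   (corner \<Rightarrow> int) \<Rightarrow> (corner \<Rightarrow> int) \<Rightarrow> (corner \<Rightarrow> int) \<Rightarrow> bool" where
  "triangle_fluxes c1 c2 c3 x1 x2 x3 x1' x2' x3' \<longleftrightarrow>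
     (let n = counterclockwise; n2 = \<lambda>c. n (n c); n3 = \<lambda>c. n (n (n c)) in
      x1 c1 + x1 (n c1) + x1 (n2 c1) + x1 (n3 c1) = 0 \<and> x2 c2 + x2 (n c2) + x2 (n2 c2) + x2 (n3 c2) = 0 \<and>
      x3 c3 + x3 (n c3) + x3 (n2 c3) + x3 (n3 c3) = 0 \<and>
      x1' c1 + x1' (n c1) + x1' (n2 c1) + x1' (n3 c1) = 0 \<and> x2' c2 + x2' (n c2) + x2' (n2 c2) + x2' (n3 c2) = 0 \<and>
      x3' c3 + x3' (n c3) + x3' (n2 c3) + x3' (n3 c3) = 0 \<and>
      x2 (n c2) = - x1 c1 \<and> x3 (n c3) = - x2 c2 \<and> x1 (n c1) = - x3 c3 \<and>
      x1' c1 = x2 (n3 c2) \<and> x2' c2 = x3 (n3 c3) \<and> x3' c3 = x1 (n3 c1) \<and>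
      x2' (n c2) = x1 (n2 c1) \<and> x3' (n c3) = x2 (n2 c2) \<and> x1' (n c1) = x3 (n2 c3) \<and>
      x2' (n3 c2) = - x1' (n2 c1) \<and> x3' (n3 c3) = - x2' (n2 c2) \<and> x1' (n3 c1) = - x3' (n2 c3))"

text \<open>
  All fluxes are determined by those at the six ends and at one side before and one side after the
  move; substituting them leaves a polynomial identity.
\<close>

lemma wedge_triangle:
  assumes "triangle_fluxes c1 c2 c3 x1 x2 x3 x1' x2' x3'" "triangle_fluxes c1 c2 c3 y1 y2 y3 y1' y2' y3'"
  shows "wedge c1 x1' y1' + wedge c2 x2' y2' + wedge c3 x3' y3' = wedge c1 x1 y1 + wedge c2 x2 y2 + wedge c3 x3 y3"
proof -
  let ?n = counterclockwise
  let ?n2 = "\<lambda>c. ?n (?n c)" and ?n3 = "\<lambda>c. ?n (?n (?n c))"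
  have solve:
    "x1 (?n c1) = - x3 c3" "x2 (?n c2) = - x1 c1" "x3 (?n c3) = - x2 c2"
    "x1 (?n3 c1) = x3 c3 - x1 c1 - x1 (?n2 c1)" "x2 (?n3 c2) = x1 c1 - x2 c2 - x2 (?n2 c2)"
    "x3 (?n3 c3) = x2 c2 - x3 c3 - x3 (?n2 c3)"
    "x1' c1 = x1 c1 - x2 c2 - x2 (?n2 c2)" "x2' c2 = x2 c2 - x3 c3 - x3 (?n2 c3)"
    "x3' c3 = x3 c3 - x1 c1 - x1 (?n2 c1)"
    "x1' (?n c1) = x3 (?n2 c3)" "x2' (?n c2) = x1 (?n2 c1)" "x3' (?n c3) = x2 (?n2 c2)"
    "x1' (?n2 c1) = x3' (?n2 c3) - x1 c1 + x2 c2 + x2 (?n2 c2) - x3 (?n2 c3)"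
    "x2' (?n2 c2) = x3' (?n2 c3) - x1 c1 + x3 c3 + x2 (?n2 c2) - x1 (?n2 c1)"
    "x1' (?n3 c1) = - x3' (?n2 c3)"
    "x2' (?n3 c2) = - x3' (?n2 c3) + x1 c1 - x2 c2 - x2 (?n2 c2) + x3 (?n2 c3)"
    "x3' (?n3 c3) = - x3' (?n2 c3) + x1 c1 - x3 c3 - x2 (?n2 c2) + x1 (?n2 c1)"
    if "triangle_fluxes c1 c2 c3 x1 x2 x3 x1' x2' x3'" for x1 x2 x3 x1' x2' x3'
    using that unfolding triangle_fluxes_def Let_def by linarith+
  show ?thesis
    unfolding wedge_def Let_def solve[OF assms(1)] solve[OF assms(2)] by algebra
qed

text \<open>
  At each crossing \<open>v\<^sub>i\<close> of the triangle the four ends are \<open>h\<^sub>i\<close> and \<open>turn_left h\<^sub>i\<close>, which belong to the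
  sides, and the opposite ends, which lead out of the region.  The move reverses the order of the two
  crossings on each side, and the new triangle lies at the opposite corners.
\<close>

locale triangle_move =
  fixes D D' :: diag and h1 h2 h3 :: half_edge
  assumes D: "knot_diagram D" and D': "knot_diagram D'"
    and tri: "triangle D h1 h2 h3" and r3: "D' = r3_diag D h1 h2 h3"
begin

abbreviation "t \<equiv> r3_swap D h1 h2 h3"
abbreviation "H \<equiv> {h1, h2, h3}"

lemma clas': "clas D' = clas D"
  by (simp add: r3 r3_diag_def)

lemma half_edges': "half_edges D' = half_edges D"
  by (simp add: half_edges_def clas')

lemma angles:
  "fst h1 \<noteq> fst h2" "fst h1 \<noteq> fst h3" "fst h2 \<noteq> fst h3"
  "fst h1 \<in> clas D" "fst h2 \<in> clas D" "fst h3 \<in> clas D"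
  using tri by (auto simp: triangle_def)

lemma opp_angles: "opp D h1 = turn_left h2" "opp D h2 = turn_left h3" "opp D h3 = turn_left h1"
  using tri by (auto simp: triangle_def intro: opp_of_face_next)

lemma opp_angle: "h \<in> H \<Longrightarrow> \<exists>k\<in>H. opp D h = turn_left k"
  using opp_angles by auto

lemma angle_eqI: "h \<in> H \<Longrightarrow> k \<in> H \<Longrightarrow> fst h = fst k \<Longrightarrow> h = k"
  using angles(1-3) by auto

lemma strand_of_counterclockwise: "strand_of (counterclockwise c) \<noteq> strand_of c"
  by (cases c) auto

text \<open>
  The swap is a product of three disjoint transpositions, because the two sides meeting at a
  crossing belong to different strands.
\<close>

lemma t_swaps:
  assumes "h \<in> H"
  shows "t (strand_at h) = strand_at (opp D h)" "t (strand_at (opp D h)) = strand_at h"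
proof -
  have 1: "strand_at (turn_left h) \<noteq> strand_at h" for h
    using strand_of_counterclockwise by (auto simp: strand_at_def turn_left_def)
  have 2: "fst h \<noteq> fst k \<Longrightarrow> strand_at h \<noteq> strand_at k" for h k :: half_edge
    by (auto simp: strand_at_def)
  have 3: "fst (turn_left h) = fst h" for h
    by (simp add: turn_left_def)
  have ne: "strand_at h \<noteq> strand_at k" "strand_at h \<noteq> strand_at (turn_left k)"
      "strand_at (turn_left h) \<noteq> strand_at k" "strand_at (turn_left h) \<noteq> strand_at (turn_left k)"
    if "fst h \<noteq> fst k" for h k
    using that 2 3 by metis+
  note n = ne[OF angles(1)] ne[OF angles(2)] ne[OF angles(3)] 1[of h1] 1[of h2] 1[of h3]
  note n = n n[symmetric]
  show "t (strand_at h) = strand_at (opp D h)" "t (strand_at (opp D h)) = strand_at h"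
    using assms n by (auto simp: r3_swap_def side_swap_def opp_angles transpose_def)
qed

lemma t_fixes: "t p = p" if "fst p \<notin> fst ` H"
  using that by (auto simp: r3_swap_def side_swap_def opp_angles transpose_def turn_left_def)

lemma strand_at_triangle:
  assumes "fst p \<in> fst ` H"
  shows "\<exists>h\<in>H. p = strand_at h \<or> p = strand_at (opp D h)"
proof -
  have *: "p = strand_at h \<or> p = strand_at (turn_left h)" if "fst p = fst h" for h
    using that by (cases p; cases "snd p"; cases "snd h") (auto simp: strand_at_def turn_left_def)
  show ?thesis
    using assms *[of h1] *[of h2] *[of h3] by (auto simp: opp_angles)
qed

lemma t_t [simp]: "t (t p) = p"
proof (cases "fst p \<in> fst ` H")
  case True
  then obtain h where "h \<in> H" "p = strand_at h \<or> p = strand_at (opp D h)"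
    using strand_at_triangle by blast
  then show ?thesis using t_swaps by metis
qed (simp add: t_fixes)

lemma t_in_iff: "t p \<in> passages D \<longleftrightarrow> p \<in> passages D"
proof (cases "fst p \<in> fst ` H")
  case True
  then obtain h where h: "h \<in> H" "p = strand_at h \<or> p = strand_at (opp D h)"
    using strand_at_triangle by blast
  then have "fst h \<in> clas D" "fst (opp D h) \<in> clas D"
    using angles by (auto simp: opp_angles turn_left_def)
  then show ?thesis using h(2) t_swaps[OF h(1)] by (auto simp: mem_Times_iff)
qed (simp add: t_fixes)

lemma nxt': "nxt D' = t \<circ> nxt D \<circ> t"
  by (simp add: r3 r3_diag_def)

lemma cnxt': "cnxt D' = t \<circ> cnxt D \<circ> t"
  unfolding cnxt_def clas' by (rule return_map_conj) (auto simp: t_in_iff nxt' simp del: mem_Sigma_iff)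

lemma bij_nxt: "bij (nxt D)" "bij (cnxt D)"
  using permutes_bij knot_diagram_nxt(1)[OF D] cnxt_permutes[OF D] by blast+

lemma cprv': "cprv D' p = t (cprv D (t p))"
  unfolding cnxt' by (rule inv_conj_involution[OF bij_nxt(2)]) simp

lemma strand_at_move_end: "strand_at (move_end t h) = t (strand_at h)"
  by (simp add: move_end_def)

lemma move_end_out: "snd (move_end t h) \<in> {NE, NW} \<longleftrightarrow> snd h \<in> {NE, NW}"
  using out_corner_cases by (auto simp: move_end_def)

lemma arc_at': "arc_at D' h = map_option t (arc_at D (move_end t h))"
  using move_end_out[of h] by (auto simp: arc_at_def strand_at_move_end cprv')

lemma opp': "opp D' h = move_end t (opp D (move_end t h))"
  using move_end_out[of h] out_corner_cases
  by (auto simp: opp_def strand_at_move_end nxt' inv_conj_involution[OF bij_nxt(1)] move_end_def)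

lemma opp_out: "snd (opp D h) \<in> {NE, NW} \<longleftrightarrow> snd h \<notin> {NE, NW}"
  using out_corner_cases by (auto simp: opp_def)

lemma across_out: "snd (across h) \<in> {NE, NW} \<longleftrightarrow> snd h \<notin> {NE, NW}"
  by (cases h; cases "snd h") (auto simp: across_def)

lemma strand_at_across [simp]: "strand_at (across h) = strand_at h"
  by (cases h; cases "snd h") (auto simp: across_def strand_at_def)

lemma across_across [simp]: "across (across h) = h"
  by (cases h; cases "snd h") (auto simp: across_def)

lemma half_edge_eqI: "strand_at h = strand_at k \<Longrightarrow> snd h \<in> {NE, NW} \<longleftrightarrow> snd k \<in> {NE, NW} \<Longrightarrow> h = k"
  using map_corner_strand_at by metis

lemma move_end_angles:
  assumes h: "h \<in> H"
  shows "move_end t h = across (opp D h)" "move_end t (opp D h) = across h"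
    "move_end t (across h) = opp D h" "move_end t (across (opp D h)) = h"
  by (rule half_edge_eqI,
      simp add: strand_at_move_end t_swaps[OF h],
      metis move_end_out across_out opp_out)+

lemma opp_across':
  assumes "h \<in> H" shows "opp D' (across h) = across (opp D h)"
  unfolding opp' move_end_angles(3)[OF assms] opp_opp[OF D] by (rule move_end_angles(1)[OF assms])

text \<open>
  Moving the strand back: the conjugation is an involution, and the triangle after the move has the
  vertically opposite angles.
\<close>

lemma inverse_triangle_move: "triangle D' (across h1) (across h2) (across h3)"
    "r3_diag D' (across h1) (across h2) (across h3) = D"
proof -
  have fn: "face_next D' (across h) = across k" if "h \<in> H" "opp D h = turn_left k" for h k
    using opp_across'[OF that(1)] that(2) by (cases k; cases "snd k") (auto simp: face_next_def across_def turn_left_def)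
  have "over D' = over D" by (simp add: r3 r3_diag_def)
  then have side: "side_over D' (across h) = side_over D h" "side_under D' (across h) = side_under D h"
    if "h \<in> H" for h
    using opp_across'[OF that] by (simp_all add: side_over_def side_under_def)
  have fst: "fst (across h) = fst h" for h by (simp add: across_def)
  show "triangle D' (across h1) (across h2) (across h3)"
    using tri fn[of h1 h2] fn[of h2 h3] fn[of h3 h1] opp_angles side
    by (auto simp: triangle_def clas' fst)
  have "side_swap D' (across h) = side_swap D h" if "h \<in> H" for h
    using opp_across'[OF that] by (simp add: side_swap_def)
  then have "r3_swap D' (across h1) (across h2) (across h3) = t"
    by (simp add: r3_swap_def)
  moreover have "t \<circ> (t \<circ> nxt D \<circ> t) \<circ> t = nxt D"
    by (simp add: fun_eq_iff)
  ultimately show "r3_diag D' (across h1) (across h2) (across h3) = D"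
    by (simp add: r3_diag_def r3)
qed

lemma other_end_angle:
  assumes "h \<in> H" shows "other_end D h = opp D h" "other_end D' (across h) = across (opp D h)"
proof -
  have c: "fst h \<in> clas D" "fst (opp D h) \<in> clas D"
    using assms angles by (auto simp: opp_angles turn_left_def)
  then show "other_end D h = opp D h"
    by (rule other_end_eq_opp[OF D])
  show "other_end D' (across h) = across (opp D h)"
    using other_end_eq_opp[OF D', of "across h"] opp_across'[OF assms] c
    by (simp add: clas' across_def)
qed

lemma triangle_half_edges:
  assumes "fst k \<in> fst ` H"
  shows "\<exists>h\<in>H. k \<in> {h, across h, opp D h, across (opp D h)}"
proof -
  have *: "k \<in> {h, across h, turn_left h, across (turn_left h)}" if "fst k = fst h" for h
    using that by (cases k; cases "snd k"; cases "snd h") (auto simp: across_def turn_left_def prod_eq_iff)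
  show ?thesis
    using assms *[of h1] *[of h2] *[of h3] by (auto simp: opp_angles)
qed

lemma angle_ends:
  assumes "h \<in> H"
  shows "fst (opp D h) \<noteq> fst h" "fst (opp D h) \<in> fst ` H" "fst (across k) = fst k"
    "h \<in> half_edges D" "across h \<in> half_edges D" "opp D h \<in> half_edges D" "across (opp D h) \<in> half_edges D"
  using assms angles by (auto simp: opp_angles turn_left_def across_def half_edges_def mem_Times_iff)

lemma not_side:
  assumes "h \<in> H"
  shows "arc_at D (across h) \<notin> arc_at D ` H" "arc_at D (across (opp D h)) \<notin> arc_at D ` H"
proof -
  have outer: "across h \<noteq> k \<and> across h \<noteq> opp D k \<and> across (opp D h) \<noteq> k \<and> across (opp D h) \<noteq> opp D k"
    if k: "k \<in> H" for k
  proof -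
    have ne: "across k \<noteq> k'" "across k \<noteq> turn_left k'" "across (turn_left k) \<noteq> k'"
        "across (turn_left k) \<noteq> turn_left k'"
      if "fst k = fst k' \<longrightarrow> k = k'" for k k'
      using that by (cases k; cases k'; cases "snd k"; auto simp: across_def turn_left_def)+
    obtain j j' where j: "j \<in> H" "opp D h = turn_left j" "j' \<in> H" "opp D k = turn_left j'"
      using opp_angle[OF assms] opp_angle[OF k] by meson
    note e = impI[OF angle_eqI[OF assms k]] impI[OF angle_eqI[OF assms j(3)]]
      impI[OF angle_eqI[OF j(1) k]] impI[OF angle_eqI[OF j(1) j(3)]]
    show ?thesis
      unfolding j(2,4) using ne(1)[OF e(1)] ne(2)[OF e(2)] ne(3)[OF e(3)] ne(4)[OF e(4)] by blast
  qed
  show "arc_at D (across h) \<notin> arc_at D ` H"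
  proof (rule notI, elim imageE)
    fix k assume "k \<in> H" "arc_at D (across h) = arc_at D k"
    then show False
      using arc_at_eq_iff[OF D, of k "across h"] outer[of k] other_end_angle(1)[of k] by simp
  qed
  show "arc_at D (across (opp D h)) \<notin> arc_at D ` H"
  proof (rule notI, elim imageE)
    fix k assume "k \<in> H" "arc_at D (across (opp D h)) = arc_at D k"
    then show False
      using arc_at_eq_iff[OF D, of k "across (opp D h)"] outer[of k] other_end_angle(1)[of k] by simp
  qed
qed

lemma not_side_away: "fst k \<notin> fst ` H \<Longrightarrow> arc_at D k \<notin> arc_at D ` H"
proof
  assume k: "fst k \<notin> fst ` H" and "arc_at D k \<in> arc_at D ` H"
  then obtain h where h: "h \<in> H" "arc_at D h = arc_at D k" by (metis imageE)
  then have "k = h \<or> k = opp D h"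
    using arc_at_eq_iff[OF D, of h k] other_end_angle(1)[OF h(1)] by simp
  then show False
    using k h(1) angle_ends(2)[OF h(1)] by auto
qed

text \<open>
  The outer arc ending at \<open>across h\<close> in \<open>D\<close> reaches, after the move, first the other crossing of the
  side, where it ends at \<open>opp D h\<close>.  The new side lies between \<open>across h\<close> and \<open>across (opp D h)\<close>.
\<close>

lemma arc_at'_angle:
  assumes "h \<in> H"
  shows "map_option t (arc_at D (across h)) = arc_at D' (opp D h)"
    "map_option t (arc_at D (across (opp D h))) = arc_at D' h"
    "arc_at D' (across (opp D h)) = arc_at D' (across h)"
  using arc_at'[of "opp D h"] arc_at'[of h] move_end_angles[OF assms]
    arc_at_other_end[OF D', of "across h"] other_end_angle(2)[OF assms] by simp_all

lemma arc_at'_away: "fst k \<notin> fst ` H \<Longrightarrow> map_option t (arc_at D k) = arc_at D' k"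
proof -
  assume "fst k \<notin> fst ` H"
  then have "move_end t k = k"
    by (intro half_edge_eqI) (simp_all add: strand_at_move_end t_fixes move_end_out[simplified])
  then show ?thesis using arc_at'[of k] by simp
qed

text \<open>
  The left half of \<open>D'\<close>, transported to the outer arcs of \<open>D\<close> and suitably extended to the sides,
  satisfies the characterization of the left half of \<open>D\<close>: along a strand the two crossings of a side
  are only passed in the opposite order.
\<close>

lemma left_half':
  assumes v: "v \<in> clas D" and k: "k \<in> half_edges D" and out: "arc_at D k \<notin> arc_at D ` H"
  shows "left_half D' v (map_option t (arc_at D k)) = left_half D v (arc_at D k)"
proof -
  let ?l = "left_half D' v"
  have v': "v \<in> clas D'" using v by (simp add: clas')
  note at = left_half_at[OF D' v'] and st = halves_straight(1)[OF D' v']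
  \<comment> \<open>The value of the left half on a side of the triangle, read off from the other diagram.\<close>
  define side where "side h = ?l (arc_at D' (if fst h = v then h else opp D h))" for h
  define f where "f a = (if a \<in> arc_at D ` H then side (SOME h. h \<in> H \<and> arc_at D h = a)
      else ?l (map_option t a))" for a
  have f_out: "f (arc_at D k) = ?l (map_option t (arc_at D k))" if "arc_at D k \<notin> arc_at D ` H" for k
    using that by (simp add: f_def)
  have f_side: "f (arc_at D h) = side h" "f (arc_at D (opp D h)) = side h" if h: "h \<in> H" for h
  proof -
    have "h' = h" if "h' \<in> H" "arc_at D h' = arc_at D h" for h'
    proof -
      have "h' = h \<or> h' = opp D h"
        using arc_at_eq_iff[OF D, of h h'] other_end_angle(1)[OF h] that(2) by auto
      moreover have "h' \<noteq> opp D h"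
      proof -
        have "k \<noteq> turn_left k'" if "fst k = fst k' \<longrightarrow> k = k'" for k k'
        proof
          assume eq: "k = turn_left k'"
          then have "k = k'" using that by (simp add: turn_left_def)
          then have "counterclockwise (snd k') = snd k'"
            using eq by (metis snd_conv turn_left_def)
          then show False by (cases "snd k'") auto
        qed
        moreover obtain k where k: "k \<in> H" "opp D h = turn_left k"
          using opp_angle[OF h] by meson
        moreover have "fst h' = fst k \<longrightarrow> h' = k"
          using angle_eqI[OF that(1) k(1)] by simp
        ultimately show ?thesis by simp
      qed
      ultimately show ?thesis by blast
    qed
    then have "(SOME h'. h' \<in> H \<and> arc_at D h' = arc_at D h) = h"
      using h by (intro some_equality) auto
    moreover have "arc_at D h \<in> arc_at D ` H"
      using h by (rule imageI)
    ultimately show "f (arc_at D h) = side h"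
      by (simp only: f_def if_True)
    then show "f (arc_at D (opp D h)) = side h"
      using arc_at_other_end[OF D, of h] other_end_angle(1)[OF h] by simp
  qed
  have f_across: "f (arc_at D (across h)) = ?l (arc_at D' (opp D h))"
    "f (arc_at D (across (opp D h))) = ?l (arc_at D' h)" if h: "h \<in> H" for h
    using f_out not_side[OF h] arc_at'_angle[OF h] by simp_all
  \<comment> \<open>Passing a crossing other than \<open>v\<close> of the reversed side does not change the value.\<close>
  have pass: "?l (arc_at D' (opp D h)) = ?l (arc_at D' (across h))" if "h \<in> H" "fst (opp D h) \<noteq> v" for h
    using st[OF that(2)] arc_at'_angle(3)[OF that(1)] by simp
  have pass': "?l (arc_at D' h) = ?l (arc_at D' (across (opp D h)))" if "h \<in> H" "fst h \<noteq> v" for h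
    using st[OF that(2)] arc_at'_angle(3)[OF that(1)] by simp
  have at_v: "f (arc_at D (v, c)) = of_bool (c \<in> {NW, SW})" for c
  proof (cases "v \<in> fst ` H")
    case False
    then show ?thesis
      using f_out[of "(v, c)"] not_side_away[of "(v, c)"] arc_at'_away[of "(v, c)"] at by simp
  next
    case True
    obtain h where h: "h \<in> H" "(v, c) \<in> {h, across h, opp D h, across (opp D h)}"
      by (rule bexE[OF triangle_half_edges[of "(v, c)"]]) (use True in simp, rule that)
    note ne = angle_ends(1)[OF h(1)] and acr = angle_ends(3)[OF h(1)]
    consider "h = (v, c)" | "across h = (v, c)" | "opp D h = (v, c)" | "across (opp D h) = (v, c)"
      using h(2) by auto
    then show ?thesis
    proof cases
      case 1
      then show ?thesis using f_side(1)[OF h(1)] at[of c] by (simp add: side_def)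
    next
      case 2
      then have "fst h = v" using acr[of h] by simp
      then show ?thesis
        using f_across(1)[OF h(1)] pass[OF h(1)] ne 2 at[of c] by auto
    next
      case 3
      then have "fst h \<noteq> v" using ne by auto
      then show ?thesis using f_side(2)[OF h(1)] 3 at[of c] by (simp add: side_def)
    next
      case 4
      then have "fst h \<noteq> v" using acr[of "opp D h"] ne by auto
      then show ?thesis
        using f_across(2)[OF h(1)] pass'[OF h(1)] 4 at[of c] by auto
    qed
  qed
  have straight: "f (arc_at D (across k)) = f (arc_at D k)" if k: "fst k \<noteq> v" for k
  proof (cases "fst k \<in> fst ` H")
    case False
    then have "fst (across k) \<notin> fst ` H" by (simp add: across_def)
    then show ?thesis
      using False k st f_out not_side_away arc_at'_away by simp
  next
    case True
    obtain h where h: "h \<in> H" "k \<in> {h, across h, opp D h, across (opp D h)}"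
      by (rule bexE[OF triangle_half_edges[OF True]]) (rule that)
    have acr: "fst (across k) = fst k" for k by (simp add: across_def)
    have 1: "f (arc_at D (across h)) = f (arc_at D h)" if "fst h \<noteq> v"
      using f_across(1)[OF h(1)] f_side(1)[OF h(1)] that by (simp add: side_def)
    have 2: "f (arc_at D (across (opp D h))) = f (arc_at D (opp D h))" if "fst (opp D h) \<noteq> v"
      using f_across(2)[OF h(1)] f_side(2)[OF h(1)] that pass[OF h(1)] pass'[OF h(1)] arc_at'_angle(3)[OF h(1)]
      by (auto simp: side_def)
    show ?thesis
      using h(2) 1 2 k acr[of h] acr[of "opp D h"] by auto
  qed
  have "f (arc_at D k) = left_half D v (arc_at D k)"
    by (rule left_half_unique[OF D v at_v straight k])
  then show ?thesis
    using f_out[OF out] by simp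
qed

definition agree :: "(arc \<Rightarrow> int) \<Rightarrow> (arc \<Rightarrow> int) \<Rightarrow> bool" where
  "agree X X' \<longleftrightarrow> (\<forall>k\<in>half_edges D. arc_at D k \<notin> arc_at D ` H \<longrightarrow>
     X' (map_option t (arc_at D k)) = X (arc_at D k))"

lemma agree_left_half: "v \<in> clas D \<Longrightarrow> agree (left_half D v) (left_half D' v)"
  using left_half' by (simp add: agree_def)

lemma agree_whole: "agree whole whole"
  by (simp add: agree_def whole_def)

lemma outside_arc':
  assumes k: "k \<in> half_edges D" and out: "arc_at D k \<notin> arc_at D ` H"
  shows "\<exists>k'\<in>half_edges D'. map_option t (arc_at D k) = arc_at D' k'"
proof (cases "fst k \<in> fst ` H")
  case False
  then show ?thesis using arc_at'_away k half_edges' by auto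
next
  case True
  obtain h where h: "h \<in> H" "k \<in> {h, across h, opp D h, across (opp D h)}"
    by (rule bexE[OF triangle_half_edges[OF True]]) (rule that)
  have "arc_at D (opp D h) \<in> arc_at D ` H"
    using arc_at_other_end[OF D, of h] other_end_angle(1)[OF h(1)] h(1) by force
  then show ?thesis
    using h out arc_at'_angle[OF h(1)] angle_ends(4,6)[OF h(1)] half_edges' by blast
qed

lemma agree_right_half: "v \<in> clas D \<Longrightarrow> agree (right_half D v) (right_half D' v)"
  unfolding agree_def
  using left_half' outside_arc' right_half_eq[OF D] right_half_eq[OF D'] clas' by metis

text \<open>
  Both local pictures of the move are triangles with the same six ends.  The fluxes through the
  ends determine those through the sides up to a circulation around the triangle, which does not
  affect the sum of the three local contributions.
\<close>

lemma intersection_agree: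
  assumes X: "balanced D X" "balanced D' X'" "agree X X'"
    and Y: "balanced D Y" "balanced D' Y'" "agree Y Y'"
  shows "isect D' X' Y' = isect D X Y"
proof -
  let ?w = "\<lambda>D X Y v. wedge NE (\<lambda>c. outflow D X (v, c)) (\<lambda>c. outflow D Y (v, c))"
  let ?V = "fst ` H"
  have V: "?V \<subseteq> clas D" using angles by auto
  have away: "outflow D' Z' (v, c) = outflow D Z (v, c)" if "v \<in> clas D - ?V" "agree Z Z'" for v c Z Z'
  proof -
    have "fst (v, c) \<notin> ?V" "(v, c) \<in> half_edges D" using that by (auto simp: half_edges_def)
    then show ?thesis
      using that(2) not_side_away[of "(v, c)"] arc_at'_away[of "(v, c)"]
      unfolding agree_def outflow_def by metis
  qed
  have flux: "flux (snd (opp D h)) = - flux (snd h)" "flux (snd (across h)) = - flux (snd h)"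
    "flux (snd (across (opp D h))) = flux (snd h)" if "h \<in> H" for h
  proof -
    have "flux (snd (across h)) = - flux (snd h)" for h
      by (cases "snd h") (auto simp: across_def)
    then show "flux (snd (opp D h)) = - flux (snd h)" "flux (snd (across h)) = - flux (snd h)"
      "flux (snd (across (opp D h))) = flux (snd h)"
      using flux_other_end[of D h] other_end_angle(1)[OF that] by simp_all
  qed
  have sides: "outflow D Z (opp D h) = - outflow D Z h"
    "outflow D' Z' h = outflow D Z (across (opp D h))"
    "outflow D' Z' (opp D h) = outflow D Z (across h)"
    "outflow D' Z' (across (opp D h)) = - outflow D' Z' (across h)"
    if "h \<in> H" "agree Z Z'" for h Z Z'
    using outflow_other_end[OF D, of Z h] other_end_angle[OF that(1)]
      outflow_other_end[OF D', of Z' "across h"] flux[OF that(1)]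
      that(2)[unfolded agree_def, rule_format, OF angle_ends(5)[OF that(1)] not_side(1)[OF that(1)]]
      that(2)[unfolded agree_def, rule_format, OF angle_ends(7)[OF that(1)] not_side(2)[OF that(1)]]
      arc_at'_angle[OF that(1)]
    by (simp_all add: outflow_def)
  obtain v1 c1 v2 c2 v3 c3 where vc: "h1 = (v1, c1)" "h2 = (v2, c2)" "h3 = (v3, c3)"
    by (metis prod.exhaust)
  have corner: "opposite c = counterclockwise (counterclockwise c)" for c
    by (cases c) auto
  have sum0: "outflow E Z (v, c) + outflow E Z (v, counterclockwise c)
      + outflow E Z (v, counterclockwise (counterclockwise c))
      + outflow E Z (v, counterclockwise (counterclockwise (counterclockwise c))) = 0"
    if "balanced E Z" "v \<in> clas E" for E Z v c
    using that by (cases c) (auto simp: balanced_def sum_corner algebra_simps)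
  have v: "v1 \<in> clas D" "v2 \<in> clas D" "v3 \<in> clas D" "v1 \<noteq> v2" "v1 \<noteq> v3" "v2 \<noteq> v3"
    using angles vc by auto
  have fluxes: "triangle_fluxes c1 c2 c3
      (\<lambda>c. outflow D Z (v1, c)) (\<lambda>c. outflow D Z (v2, c)) (\<lambda>c. outflow D Z (v3, c))
      (\<lambda>c. outflow D' Z' (v1, c)) (\<lambda>c. outflow D' Z' (v2, c)) (\<lambda>c. outflow D' Z' (v3, c))"
    if "balanced D Z" "balanced D' Z'" "agree Z Z'" for Z Z'
    using sides[OF _ that(3), of h1] sides[OF _ that(3), of h2] sides[OF _ that(3), of h3]
      sum0[OF that(1) v(1), of c1] sum0[OF that(1) v(2), of c2] sum0[OF that(1) v(3), of c3]
      sum0[OF that(2), unfolded clas', OF v(1), of c1] sum0[OF that(2), unfolded clas', OF v(2), of c2]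
      sum0[OF that(2), unfolded clas', OF v(3), of c3]
    unfolding opp_angles triangle_fluxes_def
    by (simp add: vc turn_left_def across_def corner clas')
  note local = wedge_triangle[OF fluxes[OF X] fluxes[OF Y]]
  have rot: "?w E Z U v = wedge c (\<lambda>c. outflow E Z (v, c)) (\<lambda>c. outflow E U (v, c))"
    if "balanced E Z" "balanced E U" "v \<in> clas E" for E Z U v c
    using that by (intro wedge_rotate) (auto simp: balanced_def)
  have V_eq: "?V = {v1, v2, v3}" by (auto simp: vc)
  have split: "(\<Sum>v\<in>clas D. f v) = f v1 + f v2 + f v3 + (\<Sum>v\<in>clas D - ?V. f v)" for f :: "nat \<Rightarrow> int"
    using sum.subset_diff[OF V knot_diagram_nxt(4)[OF D], of f] v(4-6) by (simp add: vc)
  have "2 * isect D' X' Y' = (\<Sum>v\<in>clas D. ?w D' X' Y' v)"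
    using two_intersection[OF D' X(2) Y(2)] by (simp add: clas')
  also have "\<dots> = (\<Sum>v\<in>clas D. ?w D X Y v)"
    unfolding split
    using local v away[OF _ X(3)] away[OF _ Y(3)]
      rot[OF X(1) Y(1), of v1 c1] rot[OF X(1) Y(1), of v2 c2] rot[OF X(1) Y(1), of v3 c3]
      rot[OF X(2) Y(2), of v1 c1] rot[OF X(2) Y(2), of v2 c2] rot[OF X(2) Y(2), of v3 c3]
    by (simp add: clas')
  also have "\<dots> = 2 * isect D X Y"
    using two_intersection[OF D X(1) Y(1)] by simp
  finally show ?thesis by simp
qed

end

section \<open>What the moves preserve\<close>

lemma intersection_right_half:
  assumes D: "knot_diagram D" and w: "w \<in> clas D"
  shows "isect D X (right_half D w) =
    isect D X whole - isect D X (left_half D w)"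
proof -
  have "isect D X (right_half D w)
      = isect D X (\<lambda>a. whole a - left_half D w a)"
    by (rule intersection_cong[OF D]) (simp_all add: right_half_eq[OF D w] whole_def)
  also have "\<dots> = isect D X whole - isect D X (left_half D w)"
    by (simp add: intersection_integer[OF D] outflow_def algebra_simps sum.distrib sum_subtractf sum_negf)
  finally show ?thesis .
qed

text \<open>
  Obtained from the relation for the left half at the loop crossing by antisymmetry and by passing to
  the complement.  The three parts are what the decreasing R1 requires of the index parity, of the
  parity and of the cycle.
\<close>

lemma monogon_intersections:
  assumes D: "knot_diagram D" and h: "monogon D h"
  shows "index_parity D (fst h) = 0"
    and "v \<in> clas D \<Longrightarrow> isect D (left_half D v) (right_half D (fst h))
      = loop_coeff h * - index_parity D v"
    and "a \<in> arcs D \<Longrightarrow> a \<noteq> arc_at D h \<Longrightarrow> right_half D (fst h) a = loop_coeff h"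
proof -
  have w: "fst h \<in> clas D" using h by (simp add: monogon_def)
  note m = monogon_halves[OF D h]
  show "index_parity D (fst h) = 0"
    by (simp add: index_parity_def m(2)[OF balanced_whole] intersection_whole_whole[OF D])
  show "isect D (left_half D v) (right_half D (fst h)) = loop_coeff h * - index_parity D v"
    if v: "v \<in> clas D"
  proof -
    note b = balanced_halves(1)[OF D v] and bw = balanced_halves(1)[OF D w]
    have "isect D (left_half D v) (left_half D (fst h))
        = - ((1 - loop_coeff h) * isect D whole (left_half D v))"
      using intersection_antisym[OF D bw b] m(2)[OF b] by simp
    also have "isect D whole (left_half D v) = index_parity D v"
      using intersection_antisym[OF D b balanced_whole] by (simp add: index_parity_def)
    finally show ?thesis
      unfolding intersection_right_half[OF D w] by (simp add: index_parity_def algebra_simps)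
  qed
  show "right_half D (fst h) a = loop_coeff h" if a: "a \<in> arcs D" "a \<noteq> arc_at D h"
  proof -
    obtain k where k: "k \<in> half_edges D" "a = arc_at D k"
      by (rule arcs_cases[OF a(1)]) (use w in auto)
    then show ?thesis using m(1)[of k] a(2) by (simp add: right_half_eq[OF D w k(1)])
  qed
qed

text \<open>
  The analogue for the decreasing R2, where only the sums over the two crossings matter.
\<close>

lemma bigon_intersections:
  assumes D: "knot_diagram D" and h: "bigon D h1 h2"
  shows "index_parity D (fst h1) + index_parity D (fst h2) = 0"
    and "v \<in> clas D \<Longrightarrow> isect D (left_half D v) (right_half D (fst h1))
      + isect D (left_half D v) (right_half D (fst h2)) = - index_parity D v"
    and "a \<in> arcs D \<Longrightarrow> a \<notin> arc_at D ` {h1, h2} \<Longrightarrow>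
      right_half D (fst h1) a + right_half D (fst h2) a = 1"
proof -
  have w: "fst h1 \<in> clas D" "fst h2 \<in> clas D" using h by (auto simp: bigon_def)
  note m = bigon_halves[OF D h]
  show "index_parity D (fst h1) + index_parity D (fst h2) = 0"
    using m(2)[OF balanced_whole] by (simp add: index_parity_def intersection_whole_whole[OF D])
  show "isect D (left_half D v) (right_half D (fst h1))
      + isect D (left_half D v) (right_half D (fst h2)) = - index_parity D v"
    if v: "v \<in> clas D"
  proof -
    note b = balanced_halves(1)[OF D v] and bw = balanced_halves(1)[OF D w(1)] balanced_halves(1)[OF D w(2)]
    have "isect D (left_half D v) (left_half D (fst h1))
        + isect D (left_half D v) (left_half D (fst h2))
        = - isect D whole (left_half D v)"
      using intersection_antisym[OF D bw(1) b] intersection_antisym[OF D bw(2) b] m(2)[OF b] by simp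
    also have "\<dots> = - index_parity D v"
      using intersection_antisym[OF D b balanced_whole] by (simp add: index_parity_def)
    finally show ?thesis
      unfolding intersection_right_half[OF D w(1)] intersection_right_half[OF D w(2)]
      by (simp add: index_parity_def)
  qed
  show "right_half D (fst h1) a + right_half D (fst h2) a = 1"
    if a: "a \<in> arcs D" "a \<notin> arc_at D ` {h1, h2}"
  proof -
    obtain k where k: "k \<in> half_edges D" "a = arc_at D k"
      by (rule arcs_cases[OF a(1)]) (use w in auto)
    then show ?thesis
      using m(1)[of k] a(2) by (simp add: right_half_eq[OF D w(1) k(1)] right_half_eq[OF D w(2) k(1)])
  qed
qed

text \<open>
  The integers \<open>f v\<close> and \<open>f' v'\<close> on the crossings of \<open>D\<close> and \<open>D'\<close> agree on corresponding crossings,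
  and on the other crossings they have the values that make the partial isomorphism of the
  extended tribe groups carry one sum of tribes into the other.
\<close>

definition transfers ::
    "diag \<Rightarrow> move \<Rightarrow> diag \<Rightarrow> (nat \<Rightarrow> int) \<Rightarrow> (nat \<Rightarrow> int) \<Rightarrow> int \<Rightarrow> bool" where
  "transfers D m D' f f' y \<longleftrightarrow>
     (\<forall>v v'. crossing_map D m D' v = Some v' \<longrightarrow> f' v' = f v) \<and>
     (case m of
        R1_dec h \<Rightarrow> f (fst h) = loop_coeff h * y
      | R1_inc h \<Rightarrow> f' (fst h) = loop_coeff h * y
      | R2_dec h1 h2 \<Rightarrow> f (fst h1) + f (fst h2) = y
      | R2_inc h1 h2 \<Rightarrow> f' (fst h1) + f' (fst h2) = y
      | _ \<Rightarrow> True)"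

lemma is_moveD:
  assumes "is_move D m D'"
  shows "knot_diagram D" "knot_diagram D'" "move_shape D m D'"
  using assms by (auto simp: is_move_def)

lemma intersections_relabels:
  assumes D: "knot_diagram D" and D': "knot_diagram D'" and r: "relabels g D D'" and v: "v \<in> clas D"
  shows "w \<in> clas D \<Longrightarrow> isect D' (left_half D' (g v)) (right_half D' (g w))
      = isect D (left_half D v) (right_half D w)"
    and "index_parity D' (g v) = index_parity D v"
  using intersection_relabels[OF D D' r, of "left_half D' (g v)" "left_half D v" whole whole]
    intersection_relabels[OF D D' r, of "left_half D' (g v)" "left_half D v" "right_half D' (g w)" "right_half D w"]
  by (simp_all add: halves_relabels[OF D D' r] v whole_def index_parity_def)

lemma (in triangle_move) intersections_triangle:
  assumes v: "v \<in> clas D"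
  shows "w \<in> clas D \<Longrightarrow> isect D' (left_half D' v) (right_half D' w)
      = isect D (left_half D v) (right_half D w)"
    and "index_parity D' v = index_parity D v"
  unfolding index_parity_def
  using assms clas'
  by (simp_all add: intersection_agree balanced_halves D D' balanced_whole agree_whole
      agree_left_half agree_right_half)

text \<open>
  Relabelling changes nothing, the crossings removed by R1 and R2 contribute zero in total, and at an
  R3 the contributions of the triangle are preserved.  Increasing moves are read backwards.
\<close>

lemma intersections_move:
  assumes m: "is_move D m D'" and v: "crossing_map D m D' v = Some v'"
  shows "crossing_map D m D' w = Some w' \<Longrightarrow>
      isect D' (left_half D' v') (right_half D' w')
      = isect D (left_half D v) (right_half D w)"
    and "index_parity D' v' = index_parity D v"
proof -
  note D = is_moveD(1)[OF m] and D' = is_moveD(2)[OF m] and shape = is_moveD(3)[OF m]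
  have "(crossing_map D m D' w = Some w' \<longrightarrow>
      isect D' (left_half D' v') (right_half D' w')
      = isect D (left_half D v) (right_half D w)) \<and>
    index_parity D' v' = index_parity D v"
  proof (cases m)
    case (Isotopy g)
    then have r: "relabels g D D'" using relabels_isotopy[OF D D'] shape by simp
    show ?thesis
      using intersections_relabels[OF D D' r] v by (auto simp: crossing_map_def Isotopy split: if_splits)
  next
    case Detour
    then have r: "relabels id D D'" using relabels_detour[OF D D'] shape by simp
    show ?thesis
      using intersections_relabels[OF D D' r] v by (auto simp: crossing_map_def Detour split: if_splits)
  next
    case (R1_dec h)
    then have e: "monogon D h" "D' = erase {fst h} D" using shape by auto
    show ?thesis
      using intersections_erase[OF D D'[unfolded e(2)] removable_monogon[OF D e(1)]] v
      by (auto simp: crossing_map_def R1_dec e(2) split: if_splits)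
  next
    case (R1_inc h)
    then have e: "monogon D' h" "D = erase {fst h} D'" using shape by auto
    show ?thesis
      using intersections_erase[OF D' D[unfolded e(2)] removable_monogon[OF D' e(1)]] v
      by (auto simp: crossing_map_def R1_inc e(2) split: if_splits)
  next
    case (R2_dec h1 h2)
    then have e: "bigon D h1 h2" "D' = erase {fst h1, fst h2} D" using shape by auto
    show ?thesis
      using intersections_erase[OF D D'[unfolded e(2)] removable_bigon[OF D e(1)]] v
      by (auto simp: crossing_map_def R2_dec e(2) split: if_splits)
  next
    case (R2_inc h1 h2)
    then have e: "bigon D' h1 h2" "D = erase {fst h1, fst h2} D'" using shape by auto
    show ?thesis
      using intersections_erase[OF D' D[unfolded e(2)] removable_bigon[OF D' e(1)]] v
      by (auto simp: crossing_map_def R2_inc e(2) split: if_splits)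
  next
    case (R3 h1 h2 h3)
    then interpret triangle_move D D' h1 h2 h3
      using D D' shape by unfold_locales auto
    show ?thesis
      using intersections_triangle v by (auto simp: crossing_map_def R3 clas' split: if_splits)
  qed
  then show "crossing_map D m D' w = Some w' \<Longrightarrow>
      isect D' (left_half D' v') (right_half D' w')
      = isect D (left_half D v) (right_half D w)"
    "index_parity D' v' = index_parity D v" by blast+
qed

lemma transfers_index_parity:
  assumes m: "is_move D m D'"
  shows "transfers D m D' (index_parity D) (index_parity D') 0"
  unfolding transfers_def
  using intersections_move(2)[OF m] is_moveD[OF m] monogon_intersections(1) bigon_intersections(1)
  by (cases m) auto

lemma transfers_intersection:
  assumes m: "is_move D m D'" and v: "crossing_map D m D' v = Some v'"
  shows "transfers D m D' (\<lambda>w. isect D (left_half D v) (right_half D w))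
      (\<lambda>w. isect D' (left_half D' v') (right_half D' w)) (- index_parity D v)"
proof -
  have c: "v \<in> clas D" using v by (auto simp: crossing_map_def split: if_splits)
  have "v' \<in> clas D'" if "\<And>g. m \<noteq> Isotopy g"
    using v that by (cases m) (auto simp: crossing_map_def split: if_splits)
  then show ?thesis
    unfolding transfers_def
    using intersections_move[OF m v] is_moveD[OF m] c
      monogon_intersections(2)[of D _ v] bigon_intersections(2)[of D _ _ v]
      monogon_intersections(2)[of D' _ v'] bigon_intersections(2)[of D' _ _ v']
    by (cases m) auto
qed

text \<open>
  Correspondent arcs have a common outer point, and at a surviving crossing \<open>v\<close> it is the same part of
  the curve that runs from \<open>v\<close> back to \<open>v\<close>.
\<close>

lemma right_half_correspondent:
  assumes m: "is_move D m D'" and a: "correspondent D m D' a a'" and v: "crossing_map D m D' v = Some v'"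
  shows "right_half D' v' a' = right_half D v a"
proof -
  note D = is_moveD(1)[OF m] and D' = is_moveD(2)[OF m] and shape = is_moveD(3)[OF m]
  have vD: "v \<in> clas D" using v by (auto simp: crossing_map_def split: if_splits)
  have arcs: "a \<in> arcs D" "a' \<in> arcs D'" and outer: "shares_outer_point D m D' a a'"
    using a by (auto simp: correspondent_def)
  obtain k where k: "k \<in> half_edges D" "a = arc_at D k"
    by (rule arcs_cases[OF arcs(1)]) (use vD in auto)
  obtain p where p: "p \<in> passages D" "a = Some p"
    using arc_at_in(1)[OF D k(1)] k(2) by blast
  have p': "\<exists>p'\<in>passages D'. a' = Some p'" if "clas D' \<noteq> {}"
    using arcs(2) that by (auto simp: arcs_def)
  show ?thesis
  proof (cases m)
    case (Isotopy g)
    then have r: "relabels g D D'" using relabels_isotopy[OF D D'] shape by simp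
    show ?thesis
      using halves_relabels(2)[OF D D' r vD k(1)] arc_at_relabels[OF D D' r k(1)] v outer k(2)
      by (auto simp: crossing_map_def Isotopy split: if_splits)
  next
    case Detour
    then have r: "relabels id D D'" using relabels_detour[OF D D'] shape by simp
    show ?thesis
      using halves_relabels(2)[OF D D' r vD k(1)] arc_at_relabels[OF D D' r k(1)] v outer k(2)
      by (auto simp: crossing_map_def Detour prod.map_id0 option.map_id split: if_splits)
  next
    case (R1_dec h)
    then have e: "monogon D h" "D' = erase {fst h} D" using shape by auto
    show ?thesis
      using right_half_carrier_arc[OF D D'[unfolded e(2)] _ p(1), of v] v outer p(2)
      by (auto simp: crossing_map_def R1_dec e(2) simp del: carrier_arc.simps split: if_splits)
  next
    case (R1_inc h)
    then have e: "monogon D' h" "D = erase {fst h} D'" using shape by auto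
    then obtain p' where "p' \<in> passages D'" "a' = Some p'" using p' by (auto simp: monogon_def)
    then show ?thesis
      using right_half_carrier_arc[OF D' D[unfolded e(2)], of v p'] v outer vD
      by (auto simp: crossing_map_def R1_inc e(2) simp del: carrier_arc.simps split: if_splits)
  next
    case (R2_dec h1 h2)
    then have e: "bigon D h1 h2" "D' = erase {fst h1, fst h2} D" using shape by auto
    show ?thesis
      using right_half_carrier_arc[OF D D'[unfolded e(2)] _ p(1), of v] v outer p(2)
      by (auto simp: crossing_map_def R2_dec e(2) simp del: carrier_arc.simps split: if_splits)
  next
    case (R2_inc h1 h2)
    then have e: "bigon D' h1 h2" "D = erase {fst h1, fst h2} D'" using shape by auto
    then obtain p' where "p' \<in> passages D'" "a' = Some p'" using p' by (auto simp: bigon_def)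
    then show ?thesis
      using right_half_carrier_arc[OF D' D[unfolded e(2)], of v p'] v outer vD
      by (auto simp: crossing_map_def R2_inc e(2) simp del: carrier_arc.simps split: if_splits)
  next
    case (R3 h1 h2 h3)
    then interpret triangle_move D D' h1 h2 h3
      using D D' shape by unfold_locales auto
    have "v' = v" using v by (auto simp: crossing_map_def R3 split: if_splits)
    moreover have "a' = map_option t a" "a \<notin> arc_at D ` H"
      using outer by (simp_all add: R3)
    ultimately show ?thesis
      using agree_right_half[OF vD] k unfolding agree_def by blast
  qed
qed

lemma transfers_right_half:
  assumes m: "is_move D m D'" and a: "correspondent D m D' a a'"
  shows "transfers D m D' (\<lambda>v. right_half D v a) (\<lambda>v. right_half D' v a') 1"
proof -
  have "a \<in> arcs D" "a' \<in> arcs D'" "shares_outer_point D m D' a a'"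
    using a by (auto simp: correspondent_def)
  then show ?thesis
    unfolding transfers_def
    using right_half_correspondent[OF m a] is_moveD[OF m]
      monogon_intersections(3)[of D _ a] bigon_intersections(3)[of D _ _ a]
      monogon_intersections(3)[of D' _ a'] bigon_intersections(3)[of D' _ _ a']
    by (cases m) auto
qed

section \<open>Sums of tribes\<close>

lemma virtual_knot_move:
  assumes "virtual_knot K" "D \<in> K" "is_move D m D'" shows "D' \<in> K"
proof -
  obtain D0 where "K = {D. (\<lambda>D D'. \<exists>m. is_move D m D')\<^sup>*\<^sup>* D0 D}"
    using assms(1) by (auto simp: virtual_knot_def)
  then show ?thesis
    using assms(2,3) by (auto intro: rtranclp.rtrancl_into_rtrancl)
qed

lemma virtual_knot_knot_diagram:
  assumes "virtual_knot K" "D \<in> K" shows "knot_diagram D"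
proof -
  obtain D0 where D0: "knot_diagram D0" "(\<lambda>D D'. \<exists>m. is_move D m D')\<^sup>*\<^sup>* D0 D"
    using assms by (auto simp: virtual_knot_def)
  from D0(2) show ?thesis
    by (cases rule: rtranclp.cases) (auto simp: D0(1) is_move_def)
qed

locale tribal =
  fixes K :: "diag set" and C :: "diag \<Rightarrow> nat set set"
  assumes K: "virtual_knot K" and C: "tribal_system K C"
begin

abbreviation "Red \<equiv> reduced_group C"
abbreviation "Ext \<equiv> ext_group C"
abbreviation support :: "(nat set \<Rightarrow>\<^sub>0 int) \<Rightarrow> nat set set" where
  "support \<equiv> Poly_Mapping.keys"

lemma knot: "D \<in> K \<Longrightarrow> knot_diagram D"
  by (rule virtual_knot_knot_diagram[OF K])

lemma partition: "D \<in> K \<Longrightarrow> partition_on (clas D) (C D)"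
  using C by (auto simp: tribal_system_def)

lemma tribe_eqI:
  assumes "D \<in> K" "T \<in> C D" "v \<in> T" shows "tribe C D v = T"
  unfolding tribe_def
proof (rule the_equality)
  fix T' assume "T' \<in> C D \<and> v \<in> T'"
  then show "T' = T"
    using partition_onD2[OF partition[OF assms(1)]] assms(2,3) unfolding disjoint_def by blast
qed (use assms in simp)

lemma tribe_in:
  assumes "D \<in> K" "v \<in> clas D" shows "tribe C D v \<in> C D" "v \<in> tribe C D v"
proof -
  obtain T where "T \<in> C D" "v \<in> T"
    using partition_onD1[OF partition[OF assms(1)]] assms(2) by blast
  then show "tribe C D v \<in> C D" "v \<in> tribe C D v"
    using tribe_eqI[OF assms(1)] by auto
qed

definition tribe_sum :: "diag \<Rightarrow> (nat \<Rightarrow> int) \<Rightarrow> nat set \<Rightarrow>\<^sub>0 int" where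
  "tribe_sum D f = (\<Sum>v\<in>clas D. frag_cmul (f v) (frag_of (tribe C D v)))"

abbreviation cls :: "diag \<Rightarrow> (nat set \<Rightarrow>\<^sub>0 int) \<Rightarrow> (nat set \<Rightarrow>\<^sub>0 int) set" where
  "cls D x \<equiv> signature_subgroup C D #>\<^bsub>tribe_group C D\<^esub> x"

lemma keys_sum_subset:
  assumes "\<And>v. v \<in> A \<Longrightarrow> t v \<in> T"
  shows "support (\<Sum>v\<in>A. frag_cmul (f v) (frag_of (t v))) \<subseteq> T"
  by (rule order_trans[OF keys_sum]) (use assms in \<open>auto simp: keys_frag_of\<close>)

lemma tribe_sum_in: "D \<in> K \<Longrightarrow> support (tribe_sum D f) \<subseteq> C D"
  unfolding tribe_sum_def by (rule keys_sum_subset) (rule tribe_in)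

lemma tribe_sum_add: "tribe_sum D (\<lambda>v. f v + g v) = tribe_sum D f + tribe_sum D g"
  by (simp add: tribe_sum_def frag_cmul_distrib sum.distrib)

lemma tribe_sum_cmul: "tribe_sum D (\<lambda>v. k * f v) = frag_cmul k (tribe_sum D f)"
  unfolding tribe_sum_def
  by (cases "finite (clas D)") (simp_all add: frag_cmul_sum o_def)

lemma tribe_sum_cong: "(\<And>v. v \<in> clas D \<Longrightarrow> f v = g v) \<Longrightarrow> tribe_sum D f = tribe_sum D g"
  by (simp add: tribe_sum_def)

lemma signature_eq: "signature C D = tribe_sum D (\<lambda>v. - index_parity D v)"
  by (simp add: signature_def tribe_sum_def sum_negf flip: minus_frag_cmul)

lemma tribe_comm_group: "comm_group (tribe_group C D)"
  by (simp add: tribe_group_def abelian_free_Abelian_group)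

lemma in_tribe_group: "x \<in> carrier (tribe_group C D) \<longleftrightarrow> support x \<subseteq> C D"
  by (simp add: tribe_group_def)

lemma signature_subgroup_eq:
  assumes "D \<in> K" shows "signature_subgroup C D = range (\<lambda>n. frag_cmul n (signature C D))"
proof -
  interpret comm_group "tribe_group C D" by (rule tribe_comm_group)
  have "signature C D \<in> carrier (tribe_group C D)"
    by (simp add: in_tribe_group signature_eq tribe_sum_in assms)
  then show ?thesis
    unfolding signature_subgroup_def generate_pow[OF \<open>signature C D \<in> carrier _\<close>]
    by (auto simp: tribe_group_def image_def)
qed

lemma signature_normal:
  assumes "D \<in> K" shows "signature_subgroup C D \<lhd> tribe_group C D"
proof -
  interpret comm_group "tribe_group C D" by (rule tribe_comm_group)
  show ?thesis
    unfolding normal_iff_subgroup signature_subgroup_def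
    by (rule generate_is_subgroup) (simp add: in_tribe_group signature_eq tribe_sum_in assms)
qed

lemma reduced_comm_group:
  assumes "D \<in> K" shows "comm_group (Red D)"
proof -
  interpret comm_group "tribe_group C D" by (rule tribe_comm_group)
  show ?thesis
    unfolding reduced_group_def using signature_normal[OF assms]
    by (intro abelian_FactGroup) (simp add: normal_iff_subgroup)
qed

lemma carrier_reduced: "X \<in> carrier (Red D) \<longleftrightarrow>
    (\<exists>x. support x \<subseteq> C D \<and> X = cls D x)"
  by (simp add: reduced_group_def carrier_FactGroup in_tribe_group image_iff Bex_def)

lemma in_cls:
  assumes "D \<in> K" shows "z \<in> cls D x \<longleftrightarrow> (\<exists>n. z = frag_cmul n (signature C D) + x)"
  unfolding r_coset_def signature_subgroup_eq[OF assms] by (auto simp: tribe_group_def)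

text \<open>
  The signature subgroup consists of the multiples of the signature.
\<close>

lemma cls_eq_iff:
  assumes "D \<in> K" shows "cls D x = cls D y \<longleftrightarrow> (\<exists>n. x = frag_cmul n (signature C D) + y)"
proof
  have "x \<in> cls D x"
    unfolding in_cls[OF assms] by (rule exI[of _ 0]) simp
  then show "cls D x = cls D y \<Longrightarrow> \<exists>n. x = frag_cmul n (signature C D) + y"
    using in_cls[OF assms] by simp
next
  assume "\<exists>n. x = frag_cmul n (signature C D) + y"
  then obtain n where n: "x = frag_cmul n (signature C D) + y" by blast
  have "z \<in> cls D x \<longleftrightarrow> z \<in> cls D y" for z
  proof -
    have "(\<exists>k. z = frag_cmul k (signature C D) + x) \<longleftrightarrow> (\<exists>k. z = frag_cmul k (signature C D) + y)"
    proof safe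
      fix k show "\<exists>k'. frag_cmul k (signature C D) + x = frag_cmul k' (signature C D) + y"
        by (rule exI[of _ "k + n"]) (simp add: n frag_cmul_distrib add.assoc)
      show "\<exists>k'. frag_cmul k (signature C D) + y = frag_cmul k' (signature C D) + x"
        by (rule exI[of _ "k - n"]) (simp add: n frag_cmul_diff_distrib)
    qed
    then show ?thesis by (simp add: in_cls[OF assms])
  qed
  then show "cls D x = cls D y" by blast
qed

lemma cls_mult:
  assumes "D \<in> K" "support x \<subseteq> C D" "support y \<subseteq> C D"
  shows "cls D x \<otimes>\<^bsub>Red D\<^esub> cls D y = cls D (x + y)"
  using normal.rcos_sum[OF signature_normal[OF assms(1)], of x y] assms
  by (simp add: reduced_group_def tribe_group_def)

lemma cls_pow:
  assumes "D \<in> K" "support x \<subseteq> C D"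
  shows "cls D x [^]\<^bsub>Red D\<^esub> (k::int) = cls D (frag_cmul k x)"
  using normal.FactGroup_int_pow[OF signature_normal[OF assms(1)], of x k] assms
  by (simp add: reduced_group_def tribe_group_def)

lemma cls_one:
  assumes "D \<in> K" shows "\<one>\<^bsub>Red D\<^esub> = cls D 0"
proof -
  have "cls D 0 = signature_subgroup C D"
    by (auto simp: r_coset_def tribe_group_def)
  then show ?thesis by (simp add: reduced_group_def)
qed

lemma cls_inv:
  assumes "D \<in> K" "support x \<subseteq> C D"
  shows "inv\<^bsub>Red D\<^esub> (cls D x) = cls D (- x)"
proof -
  interpret comm_group "Red D" by (rule reduced_comm_group[OF assms(1)])
  have neg: "support (- x) \<subseteq> C D" using assms(2) by simp
  have "cls D x \<in> carrier (Red D)" "cls D (- x) \<in> carrier (Red D)"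
    using carrier_reduced assms(2) neg by blast+
  then show ?thesis
    using cls_mult[OF assms(1) neg assms(2)]
    by (intro inv_equality) (auto simp: cls_one assms(1))
qed

text \<open>
  The values of the tribal cycle and of the tribal parity are of this form.  It is additive in \<open>f\<close> and \<open>y\<close>, so
  that relations in the group reduce to relations between integers for each crossing.
\<close>

definition ext_sum :: "diag \<Rightarrow> (nat \<Rightarrow> int) \<Rightarrow> int \<Rightarrow> (nat set \<Rightarrow>\<^sub>0 int) set \<times> int" where
  "ext_sum D f y = (cls D (tribe_sum D f), y)"

lemma ext_sum_cong: "(\<And>v. v \<in> clas D \<Longrightarrow> f v = g v) \<Longrightarrow> ext_sum D f y = ext_sum D g y"
  using tribe_sum_cong[of D f g] by (simp add: ext_sum_def)

lemma ext_comm_group: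
  assumes "D \<in> K" shows "comm_group (Ext D)"
proof -
  interpret R: comm_group "Red D" by (rule reduced_comm_group[OF assms])
  interpret Z: comm_group integer_group by (rule abelian_integer_group)
  have "Group.group (Ext D)"
    unfolding ext_group_def by (rule DirProd_group) (rule R.is_group Z.is_group)+
  then show ?thesis
    by (rule group.group_comm_groupI) (auto simp: ext_group_def R.m_comm)
qed

lemma ext_sum_in: "D \<in> K \<Longrightarrow> ext_sum D f y \<in> carrier (Ext D)"
  using tribe_sum_in by (auto simp: ext_sum_def ext_group_def carrier_reduced)

lemma ext_sum_mult:
  assumes "D \<in> K"
  shows "ext_sum D f y \<otimes>\<^bsub>Ext D\<^esub> ext_sum D g z = ext_sum D (\<lambda>v. f v + g v) (y + z)"
  by (simp add: ext_sum_def ext_group_def cls_mult tribe_sum_in assms tribe_sum_add)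

lemma ext_sum_zero: "D \<in> K \<Longrightarrow> ext_sum D (\<lambda>v. 0) 0 = \<one>\<^bsub>Ext D\<^esub>"
  by (simp add: ext_sum_def ext_group_def cls_one tribe_sum_def)

lemma ext_sum_inv:
  assumes "D \<in> K"
  shows "inv\<^bsub>Ext D\<^esub> (ext_sum D f y) = ext_sum D (\<lambda>v. - f v) (- y)"
proof -
  interpret comm_group "Ext D" by (rule ext_comm_group[OF assms])
  show ?thesis
    by (rule inv_equality) (simp_all add: ext_sum_in assms ext_sum_mult ext_sum_zero)
qed

lemma ext_sum_pow:
  assumes "D \<in> K"
  shows "ext_sum D f y [^]\<^bsub>Ext D\<^esub> (k::int) = ext_sum D (\<lambda>v. k * f v) (k * y)"
proof -
  interpret comm_group "Ext D" by (rule ext_comm_group[OF assms])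
  let ?h = "\<lambda>k. ext_sum D (\<lambda>v. k * f v) (k * y)"
  have "?h \<in> hom integer_group (Ext D)"
    by (rule homI) (simp_all add: ext_sum_in ext_sum_mult assms distrib_right)
  then have "?h ((1::int) [^]\<^bsub>integer_group\<^esub> k) = ?h 1 [^]\<^bsub>Ext D\<^esub> k"
    by (intro hom_int_pow) (simp_all add: is_group)
  then show ?thesis by simp
qed

lemma ext_sum_finprod:
  assumes "D \<in> K" "finite A"
  shows "(\<Otimes>\<^bsub>Ext D\<^esub>i\<in>A. ext_sum D (f i) (y i)) = ext_sum D (\<lambda>v. \<Sum>i\<in>A. f i v) (\<Sum>i\<in>A. y i)"
  using assms(2)
proof (induction A rule: finite_induct)
  interpret comm_group "Ext D" by (rule ext_comm_group[OF assms(1)])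
  case empty
  show ?case by (simp add: ext_sum_zero assms)
next
  interpret comm_group "Ext D" by (rule ext_comm_group[OF assms(1)])
  case (insert i A)
  then show ?case by (simp add: Pi_def ext_sum_in assms ext_sum_mult)
qed

lemma finprod_tribe_class:
  assumes D: "D \<in> K" and A: "finite A" "A \<subseteq> clas D"
  shows "(\<Otimes>\<^bsub>Red D\<^esub>v\<in>A. tribe_class C D v [^]\<^bsub>Red D\<^esub> f v)
    = cls D (\<Sum>v\<in>A. frag_cmul (f v) (frag_of (tribe C D v)))"
  using A
proof (induction A rule: finite_induct)
  interpret comm_group "Red D" by (rule reduced_comm_group[OF D])
  case empty
  show ?case by (simp add: cls_one D)
next
  interpret comm_group "Red D" by (rule reduced_comm_group[OF D])
  case (insert v A)
  have cl: "tribe_class C D w [^]\<^bsub>Red D\<^esub> f w = cls D (frag_cmul (f w) (frag_of (tribe C D w)))"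
    "support (frag_cmul (f w) (frag_of (tribe C D w))) \<subseteq> C D" if "w \<in> insert v A" for w
  proof -
    have "support (frag_of (tribe C D w)) \<subseteq> C D"
      using tribe_in(1)[OF D, of w] insert.prems that by (auto simp: keys_frag_of)
    then show "tribe_class C D w [^]\<^bsub>Red D\<^esub> f w = cls D (frag_cmul (f w) (frag_of (tribe C D w)))"
      "support (frag_cmul (f w) (frag_of (tribe C D w))) \<subseteq> C D"
      unfolding tribe_class_def using cls_pow[OF D] keys_cmul by blast+
  qed
  have "support (\<Sum>v\<in>A. frag_cmul (f v) (frag_of (tribe C D v))) \<subseteq> C D"
    by (rule keys_sum_subset) (use tribe_in(1)[OF D] insert.prems in auto)
  moreover have "tribe_class C D w [^]\<^bsub>Red D\<^esub> f w \<in> carrier (Red D)"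
    if "w \<in> insert v A" for w
    using cl[OF that] carrier_reduced by metis
  moreover from this have "(\<Otimes>\<^bsub>Red D\<^esub>v\<in>insert v A. tribe_class C D v [^]\<^bsub>Red D\<^esub> f v)
      = tribe_class C D v [^]\<^bsub>Red D\<^esub> f v \<otimes>\<^bsub>Red D\<^esub>
        (\<Otimes>\<^bsub>Red D\<^esub>v\<in>A. tribe_class C D v [^]\<^bsub>Red D\<^esub> f v)"
    using insert.hyps by (intro finprod_insert) auto
  ultimately show ?case
    using insert cl[of v] by (simp add: cls_mult[OF D])
qed

lemma tribal_cycle_eq: "D \<in> K \<Longrightarrow> tribal_cycle C D a = ext_sum D (\<lambda>v. right_half D v a) 1"
  using finprod_tribe_class[of D "clas D"] knot_diagram_nxt(4)[OF knot]
  by (simp add: tribal_cycle_def ext_sum_def tribe_sum_def whole_def)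

lemma tribal_parity_eq: "D \<in> K \<Longrightarrow> tribal_parity C D v =
    ext_sum D (\<lambda>w. isect D (left_half D v) (right_half D w)) (- index_parity D v)"
  using finprod_tribe_class[of D "clas D"] knot_diagram_nxt(4)[OF knot]
  by (simp add: tribal_parity_def ext_sum_def tribe_sum_def)

text \<open>
  By antisymmetry, \<open>D \<cdot> D\<^sup>r\<^sub>v = D\<^sup>l\<^sub>v \<cdot> D\<close> is minus the index parity, so the sum is the multiple \<open>k\<close> of the
  signature.
\<close>

lemma ext_sum_whole:
  assumes "D \<in> K"
  shows "ext_sum D (\<lambda>v. k * isect D whole (right_half D v)) 0 = \<one>\<^bsub>Ext D\<^esub>"
proof -
  interpret comm_group "Ext D" by (rule ext_comm_group[OF assms])
  note kd = knot[OF assms]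
  have "isect D whole (right_half D v) = - index_parity D v" if "v \<in> clas D" for v
    using intersection_antisym[OF kd balanced_halves(1)[OF kd that] balanced_whole]
    by (simp add: intersection_right_half[OF kd that] intersection_whole_whole[OF kd] index_parity_def)
  then have "ext_sum D (\<lambda>v. isect D whole (right_half D v)) 0 = (cls D (signature C D), 0)"
    unfolding signature_eq ext_sum_def by (simp cong: tribe_sum_cong)
  also have "cls D (signature C D) = cls D 0"
    unfolding cls_eq_iff[OF assms] by (rule exI[of _ 1]) simp
  also have "(cls D 0, 0) = \<one>\<^bsub>Ext D\<^esub>"
    by (simp add: ext_group_def cls_one assms)
  finally show ?thesis
    using ext_sum_pow[OF assms, of "\<lambda>v. isect D whole (right_half D v)" 0 k] by simp
qed

lemma intersection_ext_sum:
  assumes "D \<in> K"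
  shows "intersection (Ext D) D X (\<lambda>a. ext_sum D (F a) (y a)) =
    ext_sum D (\<lambda>v. isect D X (\<lambda>a. F a v)) (isect D X y)"
proof -
  have fin: "finite (clas D)" "finite preceding"
    using knot_diagram_nxt(4)[OF knot[OF assms]] by (simp_all add: preceding_eq)
  show ?thesis
    unfolding intersection_def
    by (simp add: ext_sum_pow[OF assms] ext_sum_finprod[OF assms] finprod_integer_group fin)
qed

lemma tribal_cycle_is_cycle:
  assumes "D \<in> K" shows "is_cycle (Ext D) D (tribal_cycle C D)"
  unfolding is_cycle_def is_chain_def
proof safe
  fix a show "tribal_cycle C D a \<in> carrier (Ext D)"
    by (simp add: tribal_cycle_eq assms ext_sum_in)
next
  fix v assume v: "v \<in> clas D"
  let ?r = "\<lambda>w c. right_half D w (arc_at D (v, c))"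
  have "ext_sum D (\<lambda>w. ?r w SW + ?r w SE + - (?r w NW + ?r w NE)) 0 = ext_sum D (\<lambda>w. 0) 0"
    using balanced_halves(2)[OF knot[OF assms]] v
    by (intro ext_sum_cong) (force simp: balanced_def sum_corner outflow_def)
  then show "tribal_cycle C D (arc_at D (v, SW)) \<otimes>\<^bsub>Ext D\<^esub> tribal_cycle C D (arc_at D (v, SE))
      \<otimes>\<^bsub>Ext D\<^esub> inv\<^bsub>Ext D\<^esub> (tribal_cycle C D (arc_at D (v, NW))
      \<otimes>\<^bsub>Ext D\<^esub> tribal_cycle C D (arc_at D (v, NE))) = \<one>\<^bsub>Ext D\<^esub>"
    by (simp add: tribal_cycle_eq assms ext_sum_mult ext_sum_inv ext_sum_zero)
qed

lemma tribal_cycle_normalized: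
  assumes "D \<in> K"
  shows "intersection (Ext D) D whole (tribal_cycle C D) = \<one>\<^bsub>Ext D\<^esub>"
proof -
  have "tribal_cycle C D = (\<lambda>a. ext_sum D (\<lambda>v. right_half D v a) (whole a))"
    by (rule ext) (simp add: tribal_cycle_eq assms whole_def)
  then have "intersection (Ext D) D whole (tribal_cycle C D)
      = ext_sum D (\<lambda>v. isect D whole (\<lambda>a. right_half D v a)) 0"
    by (simp add: intersection_ext_sum[OF assms] intersection_whole_whole[OF knot[OF assms]])
  then show ?thesis
    using ext_sum_whole[OF assms, of 1] by simp
qed

end

section \<open>Partial isomorphisms\<close>

text \<open>
  A partial map presented by two homomorphisms from a common group of parameters.  Domain and range
  are their images, and the last assumption on the kernels makes the map injective.
\<close>

lemma partial_iso_of_homs: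
  assumes groups: "Group.group P" "Group.group G" "Group.group H"
    and phi: "\<phi> \<in> hom P G" and psi: "\<psi> \<in> hom P H"
    and dom: "dom f = \<phi> ` carrier P" and f: "\<And>p. p \<in> carrier P \<Longrightarrow> f (\<phi> p) = Some (\<psi> p)"
    and ker: "\<And>p. p \<in> carrier P \<Longrightarrow> \<psi> p = \<one>\<^bsub>H\<^esub> \<Longrightarrow> \<phi> p = \<one>\<^bsub>G\<^esub>"
  shows "partial_iso G H f"
proof -
  interpret phi: group_hom P G \<phi> using groups phi by (simp add: group_hom_def group_hom_axioms_def)
  interpret psi: group_hom P H \<psi> using groups psi by (simp add: group_hom_def group_hom_axioms_def)
  have ran: "ran f = \<psi> ` carrier P"
  proof
    show "ran f \<subseteq> \<psi> ` carrier P"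
    proof
      fix b assume "b \<in> ran f"
      then obtain a where a: "f a = Some b" by (auto simp: ran_def)
      then have "a \<in> \<phi> ` carrier P" using dom by blast
      then show "b \<in> \<psi> ` carrier P" using f a by force
    qed
    show "\<psi> ` carrier P \<subseteq> ran f"
      using f by (force intro: ranI)
  qed
  have inj: "\<phi> p = \<phi> q" if "p \<in> carrier P" "q \<in> carrier P" "\<psi> p = \<psi> q" for p q
  proof -
    have "\<psi> (p \<otimes>\<^bsub>P\<^esub> inv\<^bsub>P\<^esub> q) = \<one>\<^bsub>H\<^esub>"
      using that by simp
    then have "\<phi> (p \<otimes>\<^bsub>P\<^esub> inv\<^bsub>P\<^esub> q) = \<one>\<^bsub>G\<^esub>"
      using that by (intro ker) auto
    then have "\<phi> p \<otimes>\<^bsub>G\<^esub> inv\<^bsub>G\<^esub> (\<phi> q) = \<one>\<^bsub>G\<^esub>"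
      using that by simp
    then show ?thesis
      using that phi.H.inv_equality[of "\<phi> p" "inv\<^bsub>G\<^esub> (\<phi> q)"] by simp
  qed
  have "the \<circ> f \<in> hom (G\<lparr>carrier := dom f\<rparr>) (H\<lparr>carrier := ran f\<rparr>)"
  proof (rule homI)
    fix a assume "a \<in> carrier (G\<lparr>carrier := dom f\<rparr>)"
    then show "(the \<circ> f) a \<in> carrier (H\<lparr>carrier := ran f\<rparr>)"
      by (auto intro: ranI)
  next
    fix a b assume "a \<in> carrier (G\<lparr>carrier := dom f\<rparr>)" "b \<in> carrier (G\<lparr>carrier := dom f\<rparr>)"
    then obtain p q where pq: "p \<in> carrier P" "q \<in> carrier P" "a = \<phi> p" "b = \<phi> q"
      using dom by auto
    then have "f (a \<otimes>\<^bsub>G\<^esub> b) = Some (\<psi> p \<otimes>\<^bsub>H\<^esub> \<psi> q)"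
      using f[of "p \<otimes>\<^bsub>P\<^esub> q"] by simp
    then show "(the \<circ> f) (a \<otimes>\<^bsub>G\<lparr>carrier := dom f\<rparr>\<^esub> b) = (the \<circ> f) a \<otimes>\<^bsub>H\<lparr>carrier := ran f\<rparr>\<^esub> (the \<circ> f) b"
      using pq f by simp
  qed
  moreover have "bij_betw (the \<circ> f) (dom f) (ran f)"
    unfolding bij_betw_def
  proof
    show "inj_on (the \<circ> f) (dom f)"
    proof (rule inj_onI)
      fix a b assume ab: "a \<in> dom f" "b \<in> dom f" "(the \<circ> f) a = (the \<circ> f) b"
      obtain p q where pq: "p \<in> carrier P" "a = \<phi> p" "q \<in> carrier P" "b = \<phi> q"
        using ab(1,2) unfolding dom by blast
      have "\<psi> p = \<psi> q" using ab(3) pq f by simp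
      then show "a = b" using inj[OF pq(1,3)] pq by simp
    qed
    show "(the \<circ> f) ` dom f = ran f"
      unfolding dom ran image_image by (rule image_cong) (simp_all add: f)
  qed
  ultimately show ?thesis
    unfolding partial_iso_def iso_def using phi.img_is_subgroup psi.img_is_subgroup dom ran by simp
qed

section \<open>Inverses of moves\<close>

lemma crossing_map_in:
  assumes "is_move D m D'" "crossing_map D m D' v = Some v'"
  shows "v \<in> clas D" "v' \<in> clas D'"
  using assms by (cases m; auto simp: crossing_map_def is_move_def isotopic_by_def split: if_splits)+

lemma isotopic_by_inverse:
  assumes D: "knot_diagram D" and iso: "isotopic_by g D D'"
  shows "isotopic_by (inv_into (dpts D) g) D' D"
proof -
  let ?i = "inv_into (dpts D) g"
  have b: "bij_betw g (dpts D) (dpts D')" and c: "clas D' = g ` clas D" and o: "over D' = map_prod g id ` over D"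
    and n: "\<And>p. p \<in> dpts D \<times> UNIV \<Longrightarrow> nxt D' (map_prod g id p) = map_prod g id (nxt D p)"
    using iso by (auto simp: isotopic_by_def)
  have sub: "clas D \<subseteq> dpts D" "over D \<subseteq> clas D \<times> UNIV"
    using D by (auto simp: knot_diagram_def)
  have i: "?i (g v) = v" if "v \<in> dpts D" for v
    using b that by (simp add: bij_betw_def)
  have ip: "map_prod ?i id (map_prod g id p) = p" if "p \<in> dpts D \<times> UNIV" for p
    using that i by auto
  show ?thesis
    unfolding isotopic_by_def
  proof (intro conjI ballI)
    show "bij_betw ?i (dpts D') (dpts D)"
      using b by (rule bij_betw_inv_into)
    show "clas D = ?i ` clas D'"
      using i sub(1) unfolding c image_image by force
    show "over D = map_prod ?i id ` over D'"
      using ip sub unfolding o image_image by force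
    fix p' :: passage assume "p' \<in> dpts D' \<times> UNIV"
    then obtain p where p: "p \<in> dpts D \<times> UNIV" "p' = map_prod g id p"
      using b by (force simp: bij_betw_def)
    have np: "nxt D p \<in> dpts D \<times> UNIV"
      using p(1) permutes_in_image[OF knot_diagram_nxt(1)[OF D]] by blast
    then show "nxt D (map_prod ?i id p') = map_prod ?i id (nxt D' p')"
      by (simp only: p(2) n[OF p(1)] ip[OF p(1)] ip[OF np])
  qed
qed

lemma detour_sym: "detour D D' \<Longrightarrow> detour D' D"
proof -
  assume "detour D D'"
  then obtain q n q' n' where *: "virtual_path D q n" "virtual_path D' q' n'"
    "erase (path_points D q n) D = erase (path_points D' q' n') D'"
    "(dpts D - path_points D q n) \<times> (UNIV::strand set) \<noteq> {} \<Longrightarrow>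
      prior (nxt D) ((dpts D - path_points D q n) \<times> UNIV) q
      = prior (nxt D') ((dpts D - path_points D q n) \<times> UNIV) q'"
    unfolding detour_def Let_def by blast
  have "dpts D - path_points D q n = dpts D' - path_points D' q' n'"
    using *(3) by (simp add: erase_def)
  then show "detour D' D"
    unfolding detour_def Let_def using * by metis
qed

text \<open>
  The tribal axioms transport tribes only forwards along moves; the inverse move provides the other
  direction.
\<close>

lemma inverse_move:
  assumes m: "is_move D m D'"
  shows "\<exists>m'. is_move D' m' D \<and>
    (\<forall>v v'. crossing_map D m D' v = Some v' \<longrightarrow> crossing_map D' m' D v' = Some v)"
proof -
  note D = is_moveD(1)[OF m] and D' = is_moveD(2)[OF m] and shape = is_moveD(3)[OF m]
  show ?thesis
  proof (cases m)
    case (Isotopy g)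
    then have iso: "isotopic_by g D D'" using shape by simp
    then have i: "inv_into (dpts D) g (g v) = v" "g v \<in> clas D'" if "v \<in> clas D" for v
      using that knot_diagram_nxt(3)[OF D] by (auto simp: isotopic_by_def bij_betw_def)
    show ?thesis
      using isotopic_by_inverse[OF D iso] D D' i
      by (intro exI[of _ "Isotopy (inv_into (dpts D) g)"])
        (auto simp: is_move_def crossing_map_def Isotopy split: if_splits)
  next
    case Detour
    then show ?thesis
      using shape detour_sym D D'
      by (intro exI[of _ Detour]) (auto simp: is_move_def crossing_map_def split: if_splits)
  next
    case (R1_dec h)
    then show ?thesis
      using shape D D'
      by (intro exI[of _ "R1_inc h"]) (auto simp: is_move_def crossing_map_def split: if_splits)
  next
    case (R1_inc h)
    then show ?thesis
      using shape D D'
      by (intro exI[of _ "R1_dec h"]) (auto simp: is_move_def crossing_map_def split: if_splits)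
  next
    case (R2_dec h1 h2)
    then show ?thesis
      using shape D D'
      by (intro exI[of _ "R2_inc h1 h2"]) (auto simp: is_move_def crossing_map_def split: if_splits)
  next
    case (R2_inc h1 h2)
    then show ?thesis
      using shape D D'
      by (intro exI[of _ "R2_dec h1 h2"]) (auto simp: is_move_def crossing_map_def split: if_splits)
  next
    case (R3 h1 h2 h3)
    then interpret triangle_move D D' h1 h2 h3
      using D D' shape by unfold_locales auto
    show ?thesis
      using inverse_triangle_move D D' R3
      by (intro exI[of _ "R3 (across h1) (across h2) (across h3)"])
        (auto simp: is_move_def crossing_map_def split: if_splits)
  qed
qed

section \<open>The maps of the tribe groups\<close>

lemma (in tribal) tribe_transfer:
  assumes "D \<in> K" "is_move D m D'" and v: "crossing_map D m D' v = Some v'" "crossing_map D m D' w = Some w'"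
    and eq: "tribe C D v = tribe C D w"
  shows "tribe C D' v' = tribe C D' w'"
proof -
  have "v \<in> clas D" "w \<in> clas D"
    using crossing_map_in[OF assms(2)] v by auto
  then have T: "tribe C D v \<in> C D" "v \<in> tribe C D v" "w \<in> tribe C D v"
    using tribe_in[OF assms(1)] eq by auto
  have T0: "\<forall>T\<in>C D. \<forall>v\<^sub>1\<in>T. \<forall>v\<^sub>2\<in>T. \<forall>v\<^sub>1' v\<^sub>2'.
      crossing_map D m D' v\<^sub>1 = Some v\<^sub>1' \<and> crossing_map D m D' v\<^sub>2 = Some v\<^sub>2' \<longrightarrow>
      (\<exists>T'\<in>C D'. v\<^sub>1' \<in> T' \<and> v\<^sub>2' \<in> T')"
    using C assms(1,2) unfolding tribal_system_def by blast
  obtain T' where "T' \<in> C D'" "v' \<in> T'" "w' \<in> T'"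
    using T0[rule_format, OF T(1,2,3) conjI[OF v]] by blast
  then show ?thesis
    using tribe_eqI[OF virtual_knot_move[OF K assms(1,2)]] by metis
qed

locale tribal_move = tribal +
  fixes D :: diag and m :: move and D' :: diag
  assumes DK: "D \<in> K" and move: "is_move D m D'"
begin

lemma D'K: "D' \<in> K"
  by (rule virtual_knot_move[OF K DK move])

abbreviation "cm \<equiv> crossing_map D m D'"
abbreviation "tm \<equiv> tribe_map C D m D'"

text \<open>
  From this, \<open>tribe_map\<close> is a well-defined and injective partial map.
\<close>

lemma same_tribe:
  assumes "cm v = Some v'" "cm w = Some w'"
  shows "tribe C D' v' = tribe C D' w' \<longleftrightarrow> tribe C D v = tribe C D w"
proof
  obtain m' where m': "is_move D' m' D" "crossing_map D' m' D v' = Some v" "crossing_map D' m' D w' = Some w"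
    using inverse_move[OF move] assms by blast
  show "tribe C D' v' = tribe C D' w' \<Longrightarrow> tribe C D v = tribe C D w"
    by (rule tribe_transfer[OF D'K m'])
  show "tribe C D v = tribe C D w \<Longrightarrow> tribe C D' v' = tribe C D' w'"
    by (rule tribe_transfer[OF DK move assms])
qed

lemma tribe_map_tribe:
  assumes v: "cm v = Some v'" shows "tm (tribe C D v) = Some (tribe C D' v')"
proof -
  have vv: "v \<in> clas D" "v' \<in> clas D'" using crossing_map_in[OF move v] by auto
  note T = tribe_in[OF DK vv(1)] tribe_in[OF D'K vv(2)]
  have "(THE T'. T' \<in> C D' \<and> (\<exists>u\<in>tribe C D v. \<exists>u'\<in>T'. cm u = Some u')) = tribe C D' v'"
  proof (rule the_equality)
    show "tribe C D' v' \<in> C D' \<and> (\<exists>u\<in>tribe C D v. \<exists>u'\<in>tribe C D' v'. cm u = Some u')"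
      using T v by blast
    fix T' assume "T' \<in> C D' \<and> (\<exists>u\<in>tribe C D v. \<exists>u'\<in>T'. cm u = Some u')"
    then obtain u u' where u: "T' \<in> C D'" "u \<in> tribe C D v" "u' \<in> T'" "cm u = Some u'" by blast
    have "tribe C D u = tribe C D v" by (rule tribe_eqI[OF DK T(1) u(2)])
    then have "tribe C D' u' = tribe C D' v'" using same_tribe[OF u(4) v] by simp
    then show "T' = tribe C D' v'" using tribe_eqI[OF D'K u(1,3)] by simp
  qed
  moreover have "tribe C D v \<in> C D \<and> (\<exists>T'\<in>C D'. \<exists>u\<in>tribe C D v. \<exists>u'\<in>T'. cm u = Some u')"
    using T v by blast
  ultimately show ?thesis
    by (simp add: tribe_map_def)
qed

lemma tribe_map_dom:
  assumes "T \<in> dom tm"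
  obtains v v' where "cm v = Some v'" "T = tribe C D v" "tm T = Some (tribe C D' v')"
proof -
  have "T \<in> C D \<and> (\<exists>T'\<in>C D'. \<exists>v\<in>T. \<exists>v'\<in>T'. cm v = Some v')"
    using assms by (auto simp: tribe_map_def split: if_splits)
  then obtain v v' where "T \<in> C D" "v \<in> T" "cm v = Some v'" by blast
  then show thesis
    using that tribe_eqI[OF DK] tribe_map_tribe by metis
qed

text \<open>
  The domain of the partial map of the tribe groups, and the homomorphism that it is there.
\<close>

definition survives :: "(nat set \<Rightarrow>\<^sub>0 int) \<Rightarrow> bool" where
  "survives x \<longleftrightarrow> support x \<subseteq> dom tm"

definition push :: "(nat set \<Rightarrow>\<^sub>0 int) \<Rightarrow> (nat set \<Rightarrow>\<^sub>0 int)" where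
  "push = frag_extend (\<lambda>T. frag_of (the (tm T)))"

lemma tribe_group_map_eq: "tribe_group_map C D m D' x = (if survives x then Some (push x) else None)"
  by (simp add: tribe_group_map_def survives_def push_def)

lemma survives_in: "survives x \<Longrightarrow> support x \<subseteq> C D"
  by (auto simp: survives_def tribe_map_def split: if_splits)

lemma survives_cmul: "survives x \<Longrightarrow> survives (frag_cmul n x)"
  unfolding survives_def using keys_cmul[of n x] by blast

lemma survives_minus: "survives x \<Longrightarrow> survives (- x)"
  by (simp add: survives_def)

lemma push_in: "survives x \<Longrightarrow> support (push x) \<subseteq> C D'"
proof -
  assume x: "survives x"
  have "the (tm T) \<in> C D'" if "T \<in> dom tm" for T
    using that
  proof (rule tribe_map_dom)
    fix v v' assume "cm v = Some v'" "tm T = Some (tribe C D' v')"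
    then show ?thesis
      using tribe_in(1)[OF D'K] crossing_map_in[OF move] by simp
  qed
  then show ?thesis
    using x keys_frag_extend[of "\<lambda>T. frag_of (the (tm T))" x]
    unfolding push_def survives_def by (force simp: keys_frag_of)
qed

lemma push_add: "push (x + y) = push x + push y"
  by (simp add: push_def frag_extend_add)

lemma push_cmul: "push (frag_cmul n x) = frag_cmul n (push x)"
  by (simp add: push_def frag_extend_cmul)

lemma push_minus: "push (- x) = - push x"
  by (simp add: push_def frag_extend_minus)

lemma push_inj:
  assumes "survives x" "survives y" "push x = push y" shows "x = y"
proof -
  let ?f = "\<lambda>T. the (tm T)"
  have inj: "inj_on ?f (dom tm)"
  proof (rule inj_onI)
    fix S T assume ST: "S \<in> dom tm" "T \<in> dom tm" "?f S = ?f T"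
    obtain v v' where v: "cm v = Some v'" "S = tribe C D v" "tm S = Some (tribe C D' v')"
      by (rule tribe_map_dom[OF ST(1)])
    obtain w w' where w: "cm w = Some w'" "T = tribe C D w" "tm T = Some (tribe C D' w')"
      by (rule tribe_map_dom[OF ST(2)])
    show "S = T"
      using same_tribe[OF v(1) w(1)] v w ST(3) by simp
  qed
  have "frag_extend (\<lambda>T. frag_of (inv_into (dom tm) ?f T)) (push z) = z" if "survives z" for z
  proof -
    have "frag_extend (\<lambda>T. frag_of (inv_into (dom tm) ?f T)) (push z)
        = frag_extend ((\<lambda>T. frag_of (inv_into (dom tm) ?f T)) \<circ> ?f) z"
      using frag_extend_compose[of "\<lambda>T. frag_of (inv_into (dom tm) ?f T)" ?f z]
      by (simp add: push_def o_def)
    also have "\<dots> = frag_extend frag_of z"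
    proof (rule frag_extend_eq)
      fix T assume "T \<in> support z"
      then have "T \<in> dom tm" using that unfolding survives_def by blast
      then show "((\<lambda>T. frag_of (inv_into (dom tm) ?f T)) \<circ> ?f) T = frag_of T"
        by (simp only: o_apply inv_into_f_f[OF inj])
    qed
    finally show ?thesis by (simp flip: frag_expansion)
  qed
  then show ?thesis using assms by metis
qed

text \<open>
  The terms by which the maps of the extended groups correct the map of the quotients, at
  disappearing and at new crossings respectively; at most one of them is nonzero.
\<close>

definition lost :: "int \<Rightarrow> (nat set \<Rightarrow>\<^sub>0 int)" where
  "lost y = (case m of
     R1_dec h \<Rightarrow> frag_cmul (loop_coeff h * y) (frag_of (tribe C D (fst h)))
   | R2_dec h1 h2 \<Rightarrow> frag_cmul y (frag_of (tribe C D (fst h1)))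
   | _ \<Rightarrow> 0)"

definition gained :: "int \<Rightarrow> (nat set \<Rightarrow>\<^sub>0 int)" where
  "gained y = (case m of
     R1_inc h \<Rightarrow> frag_cmul (loop_coeff h * y) (frag_of (tribe C D' (fst h)))
   | R2_inc h1 h2 \<Rightarrow> frag_cmul y (frag_of (tribe C D' (fst h1)))
   | _ \<Rightarrow> 0)"

lemma lost_add: "lost (y + z) = lost y + lost z" and gained_add: "gained (y + z) = gained y + gained z"
  by (simp_all add: lost_def gained_def distrib_left frag_cmul_distrib split: move.split)

lemma lost_zero [simp]: "lost 0 = 0" and gained_zero [simp]: "gained 0 = 0"
  by (simp_all add: lost_def gained_def split: move.split)

lemma lost_in: "support (lost y) \<subseteq> C D"
  and gained_in: "support (gained y) \<subseteq> C D'"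
proof -
  have *: "support (frag_cmul k (frag_of (tribe C E v))) \<subseteq> C E"
    if "E \<in> K" "v \<in> clas E" for E k v
    using tribe_in(1)[OF that] by (auto simp: keys_frag_of)
  note shape = is_moveD(3)[OF move]
  show "support (lost y) \<subseteq> C D"
    unfolding lost_def using shape *[OF DK] by (cases m) (simp_all add: monogon_def bigon_def)
  show "support (gained y) \<subseteq> C D'"
    unfolding gained_def using shape *[OF D'K] by (cases m) (simp_all add: monogon_def bigon_def)
qed

lemma bigon_tribes:
  "m = R2_dec h1 h2 \<Longrightarrow> tribe C D (fst h1) = tribe C D (fst h2)"
  "m = R2_inc h1 h2 \<Longrightarrow> tribe C D' (fst h1) = tribe C D' (fst h2)"
proof -
  have *: "tribe C E (fst h1) = tribe C E (fst h2)" if E: "E \<in> K" "is_move E (R2_dec h1 h2) E'" for E E'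
  proof -
    obtain T where "T \<in> C E" "fst h1 \<in> T" "fst h2 \<in> T"
      using C[unfolded tribal_system_def, THEN conjunct2, THEN conjunct2, rule_format, OF E] by meson
    then show ?thesis using tribe_eqI[OF E(1)] by metis
  qed
  show "m = R2_dec h1 h2 \<Longrightarrow> tribe C D (fst h1) = tribe C D (fst h2)"
    using *[OF DK] move by blast
  assume "m = R2_inc h1 h2"
  then have "is_move D' (R2_dec h1 h2) D" using move by (auto simp: is_move_def)
  then show "tribe C D' (fst h1) = tribe C D' (fst h2)"
    by (rule *[OF D'K])
qed

lemma tribe_sum_remove:
  assumes "E \<in> K" "v \<in> clas E"
  shows "tribe_sum E f = frag_cmul (f v) (frag_of (tribe C E v))
    + (\<Sum>w\<in>clas E - {v}. frag_cmul (f w) (frag_of (tribe C E w)))"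
  unfolding tribe_sum_def using knot_diagram_nxt(4)[OF knot[OF assms(1)]] assms(2) by (rule sum.remove)

lemma tribe_sum_remove2:
  assumes "E \<in> K" "v \<in> clas E" "w \<in> clas E" "v \<noteq> w" "tribe C E v = tribe C E w"
  shows "tribe_sum E f = frag_cmul (f v + f w) (frag_of (tribe C E v))
    + (\<Sum>u\<in>clas E - {v, w}. frag_cmul (f u) (frag_of (tribe C E u)))"
proof -
  have "(\<Sum>u\<in>clas E - {v}. frag_cmul (f u) (frag_of (tribe C E u)))
      = frag_cmul (f w) (frag_of (tribe C E w))
        + (\<Sum>u\<in>clas E - {v} - {w}. frag_cmul (f u) (frag_of (tribe C E u)))"
    using knot_diagram_nxt(4)[OF knot[OF assms(1)]] assms(3,4) by (intro sum.remove) auto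
  moreover have "clas E - {v} - {w} = clas E - {v, w}" by auto
  ultimately show ?thesis
    using tribe_sum_remove[OF assms(1,2), of f] assms(5) by (simp add: frag_cmul_distrib add.assoc)
qed

text \<open>
  In a sum of tribes, the tribe of the crossings that disappear or appear occurs, in addition to its
  surviving crossings, with exactly the corrected coefficient.  For R2 this uses that both crossings
  belong to one tribe.
\<close>

lemma transfers_sums:
  assumes t: "transfers D m D' f f' y"
  shows "tribe_sum D f - lost y = (\<Sum>v\<in>dom cm. frag_cmul (f v) (frag_of (tribe C D v)))"
    "tribe_sum D' f' - gained y = (\<Sum>v\<in>dom cm. frag_cmul (f v) (frag_of (tribe C D' (the (cm v)))))"
proof -
  let ?s = "\<Sum>v\<in>dom cm. frag_cmul (f v) (frag_of (tribe C D v))"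
  let ?s' = "\<Sum>v\<in>dom cm. frag_cmul (f v) (frag_of (tribe C D' (the (cm v))))"
  note shape = is_moveD(3)[OF move]
  have ff: "f' v' = f v" if "cm v = Some v'" for v v'
    using t that by (simp add: transfers_def)
  have "tribe_sum D f - lost y = ?s \<and> tribe_sum D' f' - gained y = ?s'"
  proof (cases "\<exists>g. m = Isotopy g")
    case True
    then obtain g where g: "m = Isotopy g" by blast
    have dom: "dom cm = clas D" by (auto simp: crossing_map_def g split: if_splits)
    have b: "bij_betw g (clas D) (clas D')"
      using relabels_isotopy[OF is_moveD(1,2)[OF move]] shape g by (simp add: relabels_def)
    have "f' (g v) = f v \<and> the (cm v) = g v" if "v \<in> clas D" for v
      using ff[of v "g v"] that by (simp add: crossing_map_def g)
    then show ?thesis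
      unfolding dom tribe_sum_def sum.reindex_bij_betw[OF b, symmetric] lost_def gained_def
      by (simp add: g)
  next
    case False
    then have cm: "cm v = (if v \<in> clas D \<inter> clas D' then Some v else None)" for v
      by (cases m) (auto simp: crossing_map_def)
    have dom: "dom cm = clas D \<inter> clas D'" by (auto simp: cm split: if_splits)
    have ff': "f' v = f v" if "v \<in> clas D \<inter> clas D'" for v
      using ff[of v v] that by (simp add: cm)
    have s': "?s' = (\<Sum>v\<in>clas D \<inter> clas D'. frag_cmul (f' v) (frag_of (tribe C D' v)))"
      unfolding dom by (rule sum.cong) (auto simp: cm ff')
    have neutral: ?thesis if "clas D' = clas D" "lost y = 0" "gained y = 0"
      using that unfolding s' unfolding dom by (simp add: tribe_sum_def)
    show ?thesis
    proof (cases m)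
      case (Isotopy g)
      then show ?thesis using False by blast
    next
      case Detour
      then have "detour D D'" using shape by simp
      moreover have "lost y = 0" "gained y = 0"
        unfolding lost_def gained_def by (simp_all add: Detour)
      ultimately show ?thesis
        using relabels_detour(2)[OF is_moveD(1,2)[OF move]] by (intro neutral)
    next
      case (R3 h1 h2 h3)
      then have "clas D' = clas D" using shape by (simp add: r3_diag_def)
      moreover have "lost y = 0" "gained y = 0"
        unfolding lost_def gained_def by (simp_all add: R3)
      ultimately show ?thesis
        by (rule neutral)
    next
      case (R1_dec h)
      then have e: "fst h \<in> clas D" "clas D' = clas D - {fst h}" "f (fst h) = loop_coeff h * y"
        using shape t by (auto simp: monogon_def transfers_def)
      have i: "clas D \<inter> clas D' = clas D - {fst h}" using e by auto
      have corr: "lost y = frag_cmul (f (fst h)) (frag_of (tribe C D (fst h)))" "gained y = 0"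
        unfolding lost_def gained_def by (simp_all add: R1_dec e(3))
      show ?thesis
        using tribe_sum_remove[OF DK e(1), of f] unfolding s' unfolding dom i
        by (simp add: corr) (simp add: tribe_sum_def e(2))
    next
      case (R1_inc h)
      then have e: "fst h \<in> clas D'" "clas D = clas D' - {fst h}" "f' (fst h) = loop_coeff h * y"
        using shape t by (auto simp: monogon_def transfers_def)
      have i: "clas D \<inter> clas D' = clas D' - {fst h}" using e by auto
      have corr: "gained y = frag_cmul (f' (fst h)) (frag_of (tribe C D' (fst h)))" "lost y = 0"
        unfolding lost_def gained_def by (simp_all add: R1_inc e(3))
      show ?thesis
        using tribe_sum_remove[OF D'K e(1), of f'] unfolding s' unfolding dom i
        by (simp add: corr) (simp add: tribe_sum_def e(2))
    next
      case (R2_dec h1 h2)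
      then have e: "fst h1 \<in> clas D" "fst h2 \<in> clas D" "fst h1 \<noteq> fst h2"
          "clas D' = clas D - {fst h1, fst h2}" "f (fst h1) + f (fst h2) = y"
        using shape t by (auto simp: bigon_def transfers_def)
      have i: "clas D \<inter> clas D' = clas D - {fst h1, fst h2}" using e by auto
      have corr: "lost y = frag_cmul (f (fst h1) + f (fst h2)) (frag_of (tribe C D (fst h1)))" "gained y = 0"
        unfolding lost_def gained_def by (simp_all add: R2_dec e(5))
      show ?thesis
        using tribe_sum_remove2[OF DK e(1-3) bigon_tribes(1)[OF R2_dec], of f] unfolding s' unfolding dom i
        by (simp add: corr) (simp add: tribe_sum_def e(4))
    next
      case (R2_inc h1 h2)
      then have e: "fst h1 \<in> clas D'" "fst h2 \<in> clas D'" "fst h1 \<noteq> fst h2"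
          "clas D = clas D' - {fst h1, fst h2}" "f' (fst h1) + f' (fst h2) = y"
        using shape t by (auto simp: bigon_def transfers_def)
      have i: "clas D \<inter> clas D' = clas D' - {fst h1, fst h2}" using e by auto
      have corr: "gained y = frag_cmul (f' (fst h1) + f' (fst h2)) (frag_of (tribe C D' (fst h1)))" "lost y = 0"
        unfolding lost_def gained_def by (simp_all add: R2_inc e(5))
      show ?thesis
        using tribe_sum_remove2[OF D'K e(1-3) bigon_tribes(2)[OF R2_inc], of f'] unfolding s' unfolding dom i
        by (simp add: corr) (simp add: tribe_sum_def e(4))
    qed
  qed
  then show "tribe_sum D f - lost y = ?s" "tribe_sum D' f' - gained y = ?s'" by blast+
qed

lemma push_transfers:
  assumes t: "transfers D m D' f f' y"
  shows "survives (tribe_sum D f - lost y)" "push (tribe_sum D f - lost y) = tribe_sum D' f' - gained y"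
proof -
  have fin: "finite (dom cm)"
    using knot_diagram_nxt(4)[OF knot[OF DK]]
    by (rule finite_subset[rotated]) (auto simp: crossing_map_def split: if_splits)
  have tm: "tm (tribe C D v) = Some (tribe C D' (the (cm v)))" if "v \<in> dom cm" for v
    using that tribe_map_tribe by auto
  show "survives (tribe_sum D f - lost y)"
    unfolding transfers_sums(1)[OF t] survives_def by (rule keys_sum_subset) (use tm in blast)
  show "push (tribe_sum D f - lost y) = tribe_sum D' f' - gained y"
    unfolding transfers_sums[OF t] push_def frag_extend_sum[OF fin]
    by (rule sum.cong) (simp_all add: frag_extend_cmul tm)
qed

text \<open>
  The case \<open>y = 0\<close> of the index parity: crossings of an R1 have index parity 0 and those of an R2
  opposite ones, so no correction is needed.
\<close>

lemma push_signature: "survives (signature C D)" "push (signature C D) = signature C D'"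
proof -
  note t = push_transfers[OF transfers_index_parity[OF move], simplified]
  have "signature C D = - tribe_sum D (index_parity D)" for D
    using tribe_sum_cmul[of D "-1" "index_parity D"] by (simp add: signature_eq)
  then show "survives (signature C D)" "push (signature C D) = signature C D'"
    using t by (simp_all add: survives_minus push_minus)
qed

text \<open>
  Two representatives of a class differ by a multiple of the signature, and their images by the same
  multiple of the signature of \<open>D'\<close>.
\<close>

lemma reduced_group_map_eq:
  assumes x: "survives x"
  shows "reduced_group_map C D m D' (cls D x) = Some (cls D' (push x))"
proof -
  have "x \<in> cls D x" unfolding in_cls[OF DK] by (rule exI[of _ 0]) simp
  then have "\<exists>z\<in>cls D x. z \<in> dom (tribe_group_map C D m D')"
    using x by (auto simp: tribe_group_map_eq)
  moreover have "cls D x \<in> carrier (Red D)"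
    using carrier_reduced survives_in[OF x] by blast
  moreover have "(THE Y. Y \<in> carrier (Red D') \<and>
      (\<exists>z\<in>cls D x. \<exists>y\<in>Y. tribe_group_map C D m D' z = Some y)) = cls D' (push x)"
  proof (rule the_equality)
    have "push x \<in> cls D' (push x)" unfolding in_cls[OF D'K] by (rule exI[of _ 0]) simp
    then show "cls D' (push x) \<in> carrier (Red D') \<and>
        (\<exists>z\<in>cls D x. \<exists>y\<in>cls D' (push x). tribe_group_map C D m D' z = Some y)"
      using carrier_reduced push_in[OF x] \<open>x \<in> cls D x\<close> x by (auto simp: tribe_group_map_eq)
    fix Y assume "Y \<in> carrier (Red D') \<and>
        (\<exists>z\<in>cls D x. \<exists>y\<in>Y. tribe_group_map C D m D' z = Some y)"
    then obtain z y y0 where z: "z \<in> cls D x" "y \<in> Y" "tribe_group_map C D m D' z = Some y" "Y = cls D' y0"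
      unfolding carrier_reduced by blast
    obtain n where n: "z = frag_cmul n (signature C D) + x"
      using z(1) unfolding in_cls[OF DK] by blast
    have "y = push z" using z(3) by (simp add: tribe_group_map_eq split: if_splits)
    then have y: "y = frag_cmul n (signature C D') + push x"
      by (simp add: n push_add push_cmul push_signature)
    obtain k where "y = frag_cmul k (signature C D') + y0"
      using z(2,4) in_cls[OF D'K] by blast
    then have "cls D' y = cls D' y0" "cls D' y = cls D' (push x)"
      using cls_eq_iff[OF D'K] y by blast+
    then show "Y = cls D' (push x)" using z(4) by simp
  qed
  ultimately show ?thesis
    by (simp add: reduced_group_map_def)
qed

lemma reduced_group_map_dom:
  assumes "reduced_group_map C D m D' X \<noteq> None"
  obtains z where "survives z" "X = cls D z"
proof -
  have "X \<in> carrier (Red D)" "\<exists>z\<in>X. z \<in> dom (tribe_group_map C D m D')"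
    using assms by (auto simp: reduced_group_map_def split: if_splits)
  then obtain x z where z: "X = cls D x" "z \<in> cls D x" "survives z"
    unfolding carrier_reduced by (auto simp: tribe_group_map_eq split: if_splits)
  then have "cls D z = cls D x"
    using in_cls[OF DK] cls_eq_iff[OF DK] by blast
  then show thesis using that z by simp
qed

text \<open>
  As \<open>lost\<close> and \<open>gained\<close> are zero where a move needs no correction, domain and kernel have to be
  studied for one formula only.
\<close>

lemma ext_group_map_eq:
  "ext_group_map C D m D' (X, y) = (if X \<notin> carrier (Red D) then None else
     map_option (\<lambda>u. (u \<otimes>\<^bsub>Red D'\<^esub> cls D' (gained y), y))
       (reduced_group_map C D m D' (X \<otimes>\<^bsub>Red D\<^esub> inv\<^bsub>Red D\<^esub> (cls D (lost y)))))"
proof (cases "X \<in> carrier (Red D)")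
  case True
  interpret R: comm_group "Red D" by (rule reduced_comm_group[OF DK])
  interpret R': comm_group "Red D'" by (rule reduced_comm_group[OF D'K])
  have no_loss: "X \<otimes>\<^bsub>Red D\<^esub> inv\<^bsub>Red D\<^esub> (cls D 0) = X"
    using True by (simp flip: cls_one[OF DK])
  have no_gain: "u \<otimes>\<^bsub>Red D'\<^esub> cls D' 0 = u" if Zu: "reduced_group_map C D m D' Z = Some u" for Z u
  proof -
    obtain z where z: "survives z" "Z = cls D z"
      by (rule reduced_group_map_dom[of Z]) (use Zu in simp)
    then have "u = cls D' (push z)" using reduced_group_map_eq Zu by simp
    then have "u \<in> carrier (Red D')" using carrier_reduced push_in[OF z(1)] by blast
    then show ?thesis by (simp flip: cls_one[OF D'K])
  qed
  have no_gain': "map_option (\<lambda>u. (u \<otimes>\<^bsub>Red D'\<^esub> cls D' 0, y)) (reduced_group_map C D m D' Z)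
      = map_option (\<lambda>u. (u, y)) (reduced_group_map C D m D' Z)" for Z
    by (cases "reduced_group_map C D m D' Z") (simp_all add: no_gain)
  have class_pow: "tribe_class C E v [^]\<^bsub>Red E\<^esub> (k::int) = cls E (frag_cmul k (frag_of (tribe C E v)))"
    if "E \<in> K" "v \<in> clas E" for E v k
    unfolding tribe_class_def using tribe_in(1)[OF that] by (intro cls_pow[OF that(1)]) (simp add: keys_frag_of)
  have points: "\<And>h. m = R1_dec h \<Longrightarrow> fst h \<in> clas D" "\<And>h. m = R1_inc h \<Longrightarrow> fst h \<in> clas D'"
    "\<And>h1 h2. m = R2_dec h1 h2 \<Longrightarrow> fst h1 \<in> clas D" "\<And>h1 h2. m = R2_inc h1 h2 \<Longrightarrow> fst h1 \<in> clas D'"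
    using is_moveD(3)[OF move] by (auto simp: monogon_def bigon_def)
  \<comment> \<open>Naming the map keeps the case distinction from rewriting the move inside it.\<close>
  define \<rho> where "\<rho> = reduced_group_map C D m D'"
  note no_gain'' = no_gain'[folded \<rho>_def]
  show ?thesis
    unfolding ext_group_map_def lost_def gained_def Let_def \<rho>_def[symmetric]
    using True points
    by (cases m) (simp_all add: no_loss no_gain'' class_pow[OF DK] class_pow[OF D'K])
qed (simp add: ext_group_map_def Let_def)

lemma ext_group_map_cls:
  assumes x: "survives x"
  shows "ext_group_map C D m D' (cls D (x + lost y), y) = Some (cls D' (push x + gained y), y)"
proof -
  have k: "support (x + lost y) \<subseteq> C D"
    using keys_add[of x "lost y"] survives_in[OF x] lost_in[of y] by blast
  have "cls D (x + lost y) \<otimes>\<^bsub>Red D\<^esub> inv\<^bsub>Red D\<^esub> (cls D (lost y)) = cls D x"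
    using k lost_in[of y] by (simp add: cls_inv cls_mult DK)
  moreover have "cls D (x + lost y) \<in> carrier (Red D)"
    using carrier_reduced k by blast
  ultimately show ?thesis
    by (simp add: ext_group_map_eq reduced_group_map_eq[OF x] cls_mult[OF D'K] push_in[OF x] gained_in)
qed

lemma ext_group_map_transfers:
  assumes "transfers D m D' f f' y"
  shows "ext_group_map C D m D' (ext_sum D f y) = Some (ext_sum D' f' y)"
  using ext_group_map_cls[OF push_transfers(1)[OF assms], of y] push_transfers(2)[OF assms]
  by (simp add: ext_sum_def)

text \<open>
  The map is parametrized by the surviving sums of tribes \<open>x\<close> and the integers \<open>y\<close>.  Injectivity: if
  \<open>push x\<close> is a multiple of the signature of \<open>D'\<close>, then \<open>x\<close> is the same multiple of the signature of
  \<open>D\<close>.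
\<close>

lemma ext_group_map_partial_iso:
  "partial_iso (Ext D) (Ext D') (ext_group_map C D m D')"
proof (rule partial_iso_of_homs)
  let ?P = "free_Abelian_group (dom tm) \<times>\<times> integer_group"
  let ?\<phi> = "\<lambda>(x, y). (cls D (x + lost y), y)"
  let ?\<psi> = "\<lambda>(x, y). (cls D' (push x + gained y), y)"
  have P: "p \<in> carrier ?P \<longleftrightarrow> survives (fst p)" for p
    by (cases p) (simp add: survives_def)
  have in_D: "support (x + lost y) \<subseteq> C D" if "survives x" for x y
    using keys_add[of x "lost y"] survives_in[OF that] lost_in[of y] by blast
  have in_D': "support (push x + gained y) \<subseteq> C D'" if "survives x" for x y
    using keys_add[of "push x" "gained y"] push_in[OF that] gained_in[of y] by blast
  show "Group.group ?P" by (intro DirProd_group) simp_all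
  show "Group.group (Ext D)" "Group.group (Ext D')"
    using ext_comm_group DK D'K comm_group.axioms(2) by blast+
  show "?\<phi> \<in> hom ?P (Ext D)"
  proof (rule homI)
    fix p assume "p \<in> carrier ?P"
    then show "?\<phi> p \<in> carrier (Ext D)"
      using carrier_reduced in_D unfolding P by (cases p) (simp add: ext_group_def, blast)
  next
    fix p q assume "p \<in> carrier ?P" "q \<in> carrier ?P"
    then show "?\<phi> (p \<otimes>\<^bsub>?P\<^esub> q) = ?\<phi> p \<otimes>\<^bsub>Ext D\<^esub> ?\<phi> q"
      unfolding P by (cases p; cases q) (simp add: ext_group_def cls_mult[OF DK] in_D lost_add algebra_simps)
  qed
  show "?\<psi> \<in> hom ?P (Ext D')"
  proof (rule homI)
    fix p assume "p \<in> carrier ?P"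
    then show "?\<psi> p \<in> carrier (Ext D')"
      using carrier_reduced in_D' unfolding P by (cases p) (simp add: ext_group_def, blast)
  next
    fix p q assume "p \<in> carrier ?P" "q \<in> carrier ?P"
    then show "?\<psi> (p \<otimes>\<^bsub>?P\<^esub> q) = ?\<psi> p \<otimes>\<^bsub>Ext D'\<^esub> ?\<psi> q"
      unfolding P
      by (cases p; cases q) (simp add: ext_group_def cls_mult[OF D'K] in_D' in_D'[unfolded add.commute[of "push _"]]
          gained_add push_add algebra_simps)
  qed
  show map: "ext_group_map C D m D' (?\<phi> p) = Some (?\<psi> p)" if "p \<in> carrier ?P" for p
    using that unfolding P by (cases p) (simp add: ext_group_map_cls)
  show "?\<phi> p = \<one>\<^bsub>Ext D\<^esub>" if "p \<in> carrier ?P" "?\<psi> p = \<one>\<^bsub>Ext D'\<^esub>" for p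
  proof -
    obtain x y where p: "p = (x, y)" by fastforce
    have x: "survives x" using that(1) unfolding P p by simp
    have one: "(cls D' (push x + gained y), y) = (cls D' 0, 0)"
      using that(2) by (simp only: p ext_group_def case_prod_conv one_DirProd one_integer_group cls_one[OF D'K])
    then have y: "y = 0"
      by (rule Pair_inject)
    have "cls D' (push x) = cls D' 0"
      using one[unfolded y gained_zero add_0_right] by (rule Pair_inject)
    then obtain n where "push x = frag_cmul n (signature C D') + 0"
      unfolding cls_eq_iff[OF D'K] by blast
    then have "push x = push (frag_cmul n (signature C D))"
      by (simp add: push_cmul push_signature)
    then have "x = frag_cmul n (signature C D) + 0"
      using push_inj[OF x survives_cmul[OF push_signature(1)]] by simp
    then have "cls D x = cls D 0"
      using cls_eq_iff[OF DK] by blast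
    then show ?thesis
      by (simp add: p y ext_group_def cls_one[OF DK])
  qed
  show "dom (ext_group_map C D m D') = ?\<phi> ` carrier ?P"
  proof
    show "?\<phi> ` carrier ?P \<subseteq> dom (ext_group_map C D m D')"
      using map by auto
    show "dom (ext_group_map C D m D') \<subseteq> ?\<phi> ` carrier ?P"
    proof
      fix z assume z: "z \<in> dom (ext_group_map C D m D')"
      obtain X y where Xy: "z = (X, y)" by fastforce
      interpret R: comm_group "Red D" by (rule reduced_comm_group[OF DK])
      have X: "X \<in> carrier (Red D)"
        using z by (auto simp: Xy ext_group_map_eq split: if_splits)
      moreover have "reduced_group_map C D m D' (X \<otimes>\<^bsub>Red D\<^esub> inv\<^bsub>Red D\<^esub> (cls D (lost y))) \<noteq> None"
        using z by (auto simp: Xy ext_group_map_eq split: if_splits)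
      then obtain x where x: "survives x"
          "X \<otimes>\<^bsub>Red D\<^esub> inv\<^bsub>Red D\<^esub> (cls D (lost y)) = cls D x"
        by (rule reduced_group_map_dom)
      have "cls D (lost y) \<in> carrier (Red D)"
        using carrier_reduced lost_in by blast
      then have "X = cls D x \<otimes>\<^bsub>Red D\<^esub> cls D (lost y)"
        using X x(2)[symmetric] by (simp add: R.m_assoc)
      then have "X = cls D (x + lost y)"
        by (simp add: cls_mult[OF DK] survives_in[OF x(1)] lost_in)
      then have "z = ?\<phi> (x, y)" by (simp add: Xy)
      moreover have "(x, y) \<in> carrier ?P" unfolding P using x(1) by simp
      ultimately show "z \<in> ?\<phi> ` carrier ?P" by blast
    qed
  qed
qed

end

section \<open>The tribal cycle and the tribal parity\<close>

context tribal
begin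

theorem tribal_cycle_normalized_invariant:
  "normalized_invariant_cycle K Ext (ext_group_map C) (tribal_cycle C)"
  unfolding normalized_invariant_cycle_def
proof (intro conjI ballI allI impI)
  fix D assume D: "D \<in> K"
  show "is_cycle (Ext D) D (tribal_cycle C D)"
    by (rule tribal_cycle_is_cycle[OF D])
  show "intersection (Ext D) D whole (tribal_cycle C D) = \<one>\<^bsub>Ext D\<^esub>"
    by (rule tribal_cycle_normalized[OF D])
  fix m D' a a' assume m: "is_move D m D' \<and> correspondent D m D' a a'"
  then interpret tribal_move K C D m D'
    using D by unfold_locales auto
  show "ext_group_map C D m D' (tribal_cycle C D a) = Some (tribal_cycle C D' a')"
    unfolding tribal_cycle_eq[OF DK] tribal_cycle_eq[OF D'K]
    by (rule ext_group_map_transfers) (use m in \<open>simp add: transfers_right_half\<close>)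
qed

text \<open>
  The relations P1, P2 and P3+ are the face relations for the monogon, the bigon and the triangle,
  intersected with the tribal cycle: what remains is a multiple of the intersection of the whole
  diagram with it, which is zero.
\<close>

theorem tribal_parity_functor:
  "oriented_parity_functor K Ext (ext_group_map C) (tribal_parity C)"
  unfolding oriented_parity_functor_def
proof (intro conjI ballI allI impI)
  fix D assume D: "D \<in> K"
  note kd = knot[OF D]
  let ?I = "isect D"
  let ?l = "left_half D" and ?r = "right_half D"
  show "comm_group (Ext D)"
    by (rule ext_comm_group[OF D])
  show "tribal_parity C D \<in> clas D \<rightarrow> carrier (Ext D)"
    by (simp add: tribal_parity_eq[OF D] ext_sum_in[OF D])
  {
    fix m D' assume "is_move D m D'"
    then interpret tribal_move K C D m D'
      using D by unfold_locales auto
    show "partial_iso (Ext D) (Ext D') (ext_group_map C D m D')"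
      by (rule ext_group_map_partial_iso)
    fix v v' assume v: "crossing_map D m D' v = Some v'"
    show "ext_group_map C D m D' (tribal_parity C D v) = Some (tribal_parity C D' v')"
      unfolding tribal_parity_eq[OF DK] tribal_parity_eq[OF D'K] intersections_move(2)[OF move v]
      by (rule ext_group_map_transfers) (rule transfers_intersection[OF move v])
  next
    fix h D' assume "is_move D (R1_dec h) D'"
    then have h: "monogon D h" by (simp add: is_move_def)
    have "tribal_parity C D (fst h)
        = ext_sum D (\<lambda>w. (1 - loop_coeff h) * ?I whole (?r w)) 0"
      unfolding tribal_parity_eq[OF D] monogon_intersections(1)[OF kd h] minus_zero
      by (rule ext_sum_cong) (simp add: monogon_halves(2)[OF kd h balanced_halves(2)[OF kd]])
    then show "tribal_parity C D (fst h) = \<one>\<^bsub>Ext D\<^esub>"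
      using ext_sum_whole[OF D] by simp
  next
    fix h1 h2 D' assume "is_move D (R2_dec h1 h2) D'"
    then have h: "bigon D h1 h2" by (simp add: is_move_def)
    have "- index_parity D (fst h1) + - index_parity D (fst h2) = 0"
      using bigon_intersections(1)[OF kd h] by linarith
    then have "tribal_parity C D (fst h1) \<otimes>\<^bsub>Ext D\<^esub> tribal_parity C D (fst h2)
        = ext_sum D (\<lambda>w. ?I (?l (fst h1)) (?r w) + ?I (?l (fst h2)) (?r w)) 0"
      by (simp only: tribal_parity_eq[OF D] ext_sum_mult[OF D])
    also have "\<dots> = ext_sum D (\<lambda>w. 1 * ?I whole (?r w)) 0"
      by (rule ext_sum_cong) (simp add: bigon_halves(2)[OF kd h balanced_halves(2)[OF kd]])
    finally show "tribal_parity C D (fst h1) \<otimes>\<^bsub>Ext D\<^esub> tribal_parity C D (fst h2) = \<one>\<^bsub>Ext D\<^esub>"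
      unfolding ext_sum_whole[OF D] .
  next
    fix h1 h2 h3 D' assume "is_move D (R3 h1 h2 h3) D'"
    then have h: "triangle D h1 h2 h3" by (simp add: is_move_def)
    obtain k where k: "\<And>Y. balanced D Y \<Longrightarrow>
        incidence h1 * ?I (?l (fst h1)) Y + incidence h2 * ?I (?l (fst h2)) Y
        + incidence h3 * ?I (?l (fst h3)) Y = k * ?I whole Y"
      using triangle_halves[OF kd h] by blast
    have "incidence h1 * - index_parity D (fst h1) + incidence h2 * - index_parity D (fst h2)
        + incidence h3 * - index_parity D (fst h3) = 0"
      using k[OF balanced_whole] by (simp add: index_parity_def intersection_whole_whole[OF kd])
    then have "tribal_parity C D (fst h1) [^]\<^bsub>Ext D\<^esub> incidence h1
        \<otimes>\<^bsub>Ext D\<^esub> tribal_parity C D (fst h2) [^]\<^bsub>Ext D\<^esub> incidence h2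
        \<otimes>\<^bsub>Ext D\<^esub> tribal_parity C D (fst h3) [^]\<^bsub>Ext D\<^esub> incidence h3
      = ext_sum D (\<lambda>w. incidence h1 * ?I (?l (fst h1)) (?r w) + incidence h2 * ?I (?l (fst h2)) (?r w)
        + incidence h3 * ?I (?l (fst h3)) (?r w)) 0"
      by (simp only: tribal_parity_eq[OF D] ext_sum_mult[OF D] ext_sum_pow[OF D])
    also have "\<dots> = ext_sum D (\<lambda>w. k * ?I whole (?r w)) 0"
      by (rule ext_sum_cong) (simp add: k[OF balanced_halves(2)[OF kd]])
    finally show "tribal_parity C D (fst h1) [^]\<^bsub>Ext D\<^esub> incidence h1
        \<otimes>\<^bsub>Ext D\<^esub> tribal_parity C D (fst h2) [^]\<^bsub>Ext D\<^esub> incidence h2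
        \<otimes>\<^bsub>Ext D\<^esub> tribal_parity C D (fst h3) [^]\<^bsub>Ext D\<^esub> incidence h3
      = \<one>\<^bsub>Ext D\<^esub>"
      unfolding ext_sum_whole[OF D] .
  }
qed

end

theorem theorem13:
  fixes K :: "diag set" and C :: "diag \<Rightarrow> nat set set"
  assumes "virtual_knot K" and "tribal_system K C"
  shows "normalized_invariant_cycle K (ext_group C) (ext_group_map C) (tribal_cycle C) \<and>
         oriented_parity_functor K (ext_group C) (ext_group_map C) (tribal_parity C)"
proof -
  interpret tribal K C
    using assms by unfold_locales
  show ?thesis
    using tribal_cycle_normalized_invariant tribal_parity_functor by blast
qed

end
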